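(* Let $\mathcal{S}\neq\{0\}$ be a submodule of $H^2(\triangle_H)$. Then $\mathcal{S}$ is doubly commuting if and only if $\mathcal{S}=q\,H^2_+(\triangle_H)$ for some unimodular function $q$ on $\triangle_H$.
   Context: The Hartogs triangle is $\triangle_H=\{(z,w)\in\mathbb{C}^2: |z|<|w|<1\}$. The Hardy space $H^2(\triangle_H)$ is the Hilbert space of holomorphic $f$ on $\triangle_H$ with $\|f\|^2=\sup_{s,t\in(0,1)}\frac{1}{4\pi^2}\int_0^{2\pi}\int_0^{2\pi}|f(ste^{i\theta},te^{i\gamma})|^2\,st^2\,d\theta\,d\gamma<\infty$. Equivalently, it consists of the functions $f(z,w)=\sum_{\alpha\in\mathcal{I}}a_\alpha z^{\alpha_1}w^{\alpha_2}$ with $\|f\|^2=\sum|a_\alpha|^2<\infty$, where $\mathcal{I}=\{(\alpha_1,\alpha_2)\in\mathbb{Z}^2:\alpha_1\ge0,\ \alpha_1+\alpha_2+1\ge0\}$; it is identified with the corresponding closed subspace of $L^2(\mathbb{T}^2)$ (boundary values $\sum a_\alpha\zeta^\alpha$ on the distinguished boundary $\mathbb{T}^2$, normalized Lebesgue measure). The functions $\frac1w(\frac zw)^iw^j$, $i,j\ge0$, form an orthonormal basis. $H^2_+(\triangle_H)$ is the closed subspace of those $f\in H^2(\triangle_H)$ of the form $\sum_{i,j\ge0}a_{i,j}z^iw^j$. $M_z,M_w$ are multiplication by $z$ and $w$ on $H^2(\triangle_H)$. A submodule is a closed subspace $\mathcal{S}$ with $M_z\mathcal{S}\subseteq\mathcal{S}$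 and $M_w\mathcal{S}\subseteq\mathcal{S}$; put $S_z=M_z|_{\mathcal{S}}$, $S_w=M_w|_{\mathcal{S}}$ (operators on $\mathcal S$). $\mathcal{S}$ is doubly commuting if $S_z^*S_w=S_wS_z^*$. A unimodular function on $\triangle_H$ is a function $q\in H^2(\triangle_H)$ whose boundary function satisfies $|q|=1$ a.e. on $\mathbb{T}^2$. *)

theory Defs
  imports "HOL-Analysis.Analysis"
begin

definition hartogs_triangle :: "(complex \<times> complex) set" where
  "hartogs_triangle = {(z, w). cmod z < cmod w \<and> cmod w < 1}"

text \<open>Holomorphy in two variables: complex differentiability at each point of the (open) set,
  that is, real differentiability with a complex-linear derivative.\<close>

definition holomorphic2_on :: "(complex \<times> complex \<Rightarrow> complex) \<Rightarrow> (complex \<times> complex) set \<Rightarrow> bool" where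
  "holomorphic2_on f A \<longleftrightarrow>
     (\<forall>p\<in>A. \<exists>a b. (f has_derivative (\<lambda>(u, v). a * u + b * v)) (at p))"

definition hardy_ennorm2 :: "(complex \<times> complex \<Rightarrow> complex) \<Rightarrow> ennreal" where
  "hardy_ennorm2 f =
     (SUP (s, t) \<in> {0<..<1::real} \<times> {0<..<1::real}.
        ennreal (1 / (4 * pi\<^sup>2)) *
        (\<integral>\<^sup>+ \<theta>\<in>{0..2*pi}. (\<integral>\<^sup>+ \<gamma>\<in>{0..2*pi}.
           ennreal ((cmod (f (of_real (s * t) * cis \<theta>, of_real t * cis \<gamma>)))\<^sup>2 * (s * t\<^sup>2))
         \<partial>lborel) \<partial>lborel))"

text \<open>A function on the triangle is represented by its extension by zero to the whole type, so
  that equality in the logic is equality of functions on the triangle, and so that the Hardy space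
  is closed under the pointwise operations.\<close>

definition hardy :: "(complex \<times> complex \<Rightarrow> complex) set" where
  "hardy = {f. holomorphic2_on f hartogs_triangle \<and> (\<forall>p. p \<notin> hartogs_triangle \<longrightarrow> f p = 0) \<and>
               hardy_ennorm2 f < \<infinity>}"

definition hardy_norm :: "(complex \<times> complex \<Rightarrow> complex) \<Rightarrow> real" where
  "hardy_norm f = sqrt (enn2real (hardy_ennorm2 f))"

text \<open>The inner product of the Hilbert space, recovered from its norm by polarization; it is
  linear in the first argument and conjugate-linear in the second.\<close>

definition hardy_inner ::
  "(complex \<times> complex \<Rightarrow> complex) \<Rightarrow> (complex \<times> complex \<Rightarrow> complex) \<Rightarrow> complex" where
  "hardy_inner f g =
     (of_real ((hardy_norm (\<lambda>p. f p + g p))\<^sup>2) - of_real ((hardy_norm (\<lambda>p. f p - g p))\<^sup>2)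
      + \<i> * of_real ((hardy_norm (\<lambda>p. f p + \<i> * g p))\<^sup>2)
      - \<i> * of_real ((hardy_norm (\<lambda>p. f p - \<i> * g p))\<^sup>2)) / 4"

definition hardy_plus :: "(complex \<times> complex \<Rightarrow> complex) set" where
  "hardy_plus = {f \<in> hardy. \<exists>a :: nat \<times> nat \<Rightarrow> complex. \<forall>(z, w) \<in> hartogs_triangle.
     ((\<lambda>(i, j). a (i, j) * z ^ i * w ^ j) has_sum f (z, w)) UNIV}"

definition index_set :: "(int \<times> int) set" where
  "index_set = {(m, n). m \<ge> 0 \<and> m + n + 1 \<ge> 0}"

text \<open>Normalized Lebesgue measure on the distinguished boundary, as a Borel measure on the
  ambient space that is concentrated on the torus.\<close>

definition torus_measure :: "(complex \<times> complex) measure" where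
  "torus_measure =
     distr (uniform_measure lborel ({0..2*pi} \<times> {0..2*pi})) borel (\<lambda>(\<theta>, \<gamma>). (cis \<theta>, cis \<gamma>))"

text \<open>\<open>b\<close> represents the boundary function of \<open>f\<close>: if \<open>a\<close> are the Laurent coefficients of \<open>f\<close>, then
  the series with coefficients \<open>a\<close> converges to \<open>b\<close> in \<open>L\<^sup>2\<close> of the torus (which forces
  \<open>b\<close> to be square-integrable and determines it almost everywhere).\<close>

definition has_boundary_function ::
  "(complex \<times> complex \<Rightarrow> complex) \<Rightarrow> (complex \<times> complex \<Rightarrow> complex) \<Rightarrow> bool" where
  "has_boundary_function f b \<longleftrightarrow>
     b \<in> borel_measurable borel \<and>
     (\<exists>a :: int \<times> int \<Rightarrow> complex.
        (\<forall>(z, w) \<in> hartogs_triangle.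
           ((\<lambda>(m, n). a (m, n) * (z powi m) * (w powi n)) has_sum f (z, w)) index_set) \<and>
        ((\<lambda>F. \<integral>\<^sup>+ (\<zeta>, \<omega>). ennreal ((cmod (b (\<zeta>, \<omega>)
                 - (\<Sum>(m, n)\<in>F. a (m, n) * (\<zeta> powi m) * (\<omega> powi n))))\<^sup>2) \<partial>torus_measure)
           \<longlongrightarrow> 0) (finite_subsets_at_top index_set))"

definition unimodular :: "(complex \<times> complex \<Rightarrow> complex) \<Rightarrow> bool" where
  "unimodular q \<longleftrightarrow>
     q \<in> hardy \<and> (\<exists>b. has_boundary_function q b \<and> (AE \<zeta> in torus_measure. cmod (b \<zeta>) = 1))"

definition mult_z :: "(complex \<times> complex \<Rightarrow> complex) \<Rightarrow> complex \<times> complex \<Rightarrow> complex" where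
  "mult_z f = (\<lambda>(z, w). z * f (z, w))"

definition mult_w :: "(complex \<times> complex \<Rightarrow> complex) \<Rightarrow> complex \<times> complex \<Rightarrow> complex" where
  "mult_w f = (\<lambda>(z, w). w * f (z, w))"

definition closed_hardy_subspace :: "(complex \<times> complex \<Rightarrow> complex) set \<Rightarrow> bool" where
  "closed_hardy_subspace S \<longleftrightarrow>
     S \<subseteq> hardy \<and> (\<lambda>_. 0) \<in> S \<and>
     (\<forall>f\<in>S. \<forall>g\<in>S. (\<lambda>p. f p + g p) \<in> S) \<and>
     (\<forall>c. \<forall>f\<in>S. (\<lambda>p. c * f p) \<in> S) \<and>
     (\<forall>F f. (\<forall>n::nat. F n \<in> S) \<and> f \<in> hardy \<and>
        (\<lambda>n. hardy_norm (\<lambda>p. F n p - f p)) \<longlonglongrightarrow> 0 \<longrightarrow> f \<in> S)"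

definition hardy_submodule :: "(complex \<times> complex \<Rightarrow> complex) set \<Rightarrow> bool" where
  "hardy_submodule S \<longleftrightarrow> closed_hardy_subspace S \<and> mult_z ` S \<subseteq> S \<and> mult_w ` S \<subseteq> S"

text \<open>Adjoint of an operator \<open>T\<close> on the Hilbert space \<open>S\<close>; only its values on \<open>S\<close> are meaningful,
  where they exist and are unique if \<open>S\<close> is a closed subspace and \<open>T\<close> maps \<open>S\<close> boundedly into
  itself.\<close>

definition adjoint_on ::
  "(complex \<times> complex \<Rightarrow> complex) set \<Rightarrow>
   ((complex \<times> complex \<Rightarrow> complex) \<Rightarrow> (complex \<times> complex \<Rightarrow> complex)) \<Rightarrow>
   (complex \<times> complex \<Rightarrow> complex) \<Rightarrow> (complex \<times> complex \<Rightarrow> complex)" where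
  "adjoint_on S T g = (THE h. h \<in> S \<and> (\<forall>f\<in>S. hardy_inner (T f) g = hardy_inner f h))"

definition doubly_commuting :: "(complex \<times> complex \<Rightarrow> complex) set \<Rightarrow> bool" where
  "doubly_commuting S \<longleftrightarrow>
     (\<forall>f\<in>S. adjoint_on S mult_z (mult_w f) = mult_w (adjoint_on S mult_z f))"

end

theory Submission
  imports Defs "HOL-Complex_Analysis.Complex_Analysis"
begin

text \<open>Expanding in Laurent series identifies the Hardy space of the triangle with the square-summable
families of coefficients that vanish off \<^const>\<open>index_set\<close> (\<open>hardy_eq_ev\<close>, \<open>hardy_norm_ev\<close>).
Multiplication by \<open>z\<close> and by \<open>w\<close> become the shifts by \<open>(1, 0)\<close> and \<open>(0, 1)\<close>. On families indexed
by all of \<open>\<int> \<times> \<int>\<close> these shifts are invertible isometries, and passing to boundary values turns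
them into multiplication by the coordinates of the torus. Both directions of the theorem are
arguments about such families. Boundary values enter through two facts: the modulus of a boundary
function is \<open>1\<close> almost everywhere if and only if the family has norm \<open>1\<close> and is orthogonal to
all its nontrivial translates (\<open>unimodular_boundary_iff\<close>), and then nothing but \<open>0\<close> is orthogonal to
all translates (\<open>zero_if_orthogonal_to_shifts\<close>).

Let \<open>S\<close> be doubly commuting and nonzero. No nonzero function is divisible by all powers of \<open>z\<close> (or of \<open>w\<close>)
within the Hardy space, so the defect space \<open>E = S \<ominus> zS\<close> is nonzero; double
commutativity says exactly that \<open>E\<close> is invariant under \<open>w\<close>, and for the same reason
\<open>E \<ominus> wE\<close> contains a unit vector \<open>q\<close>. It is orthogonal to \<open>zS\<close> and to \<open>wS\<close>, and double
commutativity yields that \<open>q\<close> is orthogonal to \<open>z\<^sup>m w\<^sup>n q\<close> for all integers \<open>(m, n) \<noteq> (0, 0)\<close>, mixed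
signs included. Hence \<open>q\<close> is unimodular. If \<open>r \<in> S\<close> is orthogonal to \<open>z\<^sup>m w\<^sup>n q\<close> for all \<open>m, n \<ge> 0\<close>,
the same computation extends this to all integers \<open>m, n\<close>, so all Fourier coefficients of the
boundary function of \<open>r\<close> times the conjugate of that of \<open>q\<close> vanish; as \<open>q\<close> is unimodular, \<open>r = 0\<close>.
Thus the functions \<open>z\<^sup>m w\<^sup>n q\<close> with \<open>m, n \<ge> 0\<close> form an orthonormal basis of \<open>S\<close>, which means that
\<open>S\<close> is \<open>q\<close> times \<^const>\<open>hardy_plus\<close> (\<open>wandering_vector\<close>, \<open>multiplication_series\<close>).

Conversely, multiplication by a unimodular \<open>q\<close> maps the orthonormal basis \<open>z\<^sup>m w\<^sup>n\<close> of
\<^const>\<open>hardy_plus\<close> to an orthonormal family. It is therefore an isometry onto \<open>S\<close> that intertwines the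
multiplication operators, and on \<^const>\<open>hardy_plus\<close> the adjoint of multiplication by \<open>z\<close> is the backward
shift in the first exponent, which commutes with the shift in the second.

The analysis behind the identification has three ingredients. Integrable functions on the torus
are determined by their Fourier coefficients (\<open>null_coefs_AE_zero\<close>), by polynomial approximation of
continuous functions. Square-summable families are Fourier coefficients (\<open>riesz_fischer\<close>). By the
theorem of Cauchy in each variable, the Fourier coefficients of a holomorphic function on the tori
inside the triangle are fixed numbers times monomials in the radii (\<open>laurent_coef_exists\<close>); finiteness of the
Hardy norm makes these numbers square-summable, as the radii tend to \<open>1\<close>, and kills, as a radius
tends to \<open>0\<close>, those off \<^const>\<open>index_set\<close>.\<close>

section \<open>The Hilbert space of square-summable families\<close>

typedef 'a ell2 = "{f :: 'a \<Rightarrow> complex. (\<lambda>i. (cmod (f i))\<^sup>2) summable_on UNIV}"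
  morphisms coef Abs_ell2
  by (rule exI[of _ "\<lambda>_. 0"]) simp

setup_lifting type_definition_ell2

lemma square_summable_coef: "(\<lambda>i. (cmod (coef a i))\<^sup>2) summable_on UNIV"
  using coef[of a] by simp

lemma coef_Abs_ell2: "(\<lambda>i. (cmod (f i))\<^sup>2) summable_on UNIV \<Longrightarrow> coef (Abs_ell2 f) = f"
  by (simp add: Abs_ell2_inverse)

lemma ell2_eqI: "(\<And>i. coef a i = coef b i) \<Longrightarrow> a = b"
  by (metis coef_inject ext)

lemma square_summable_add:
  assumes "(\<lambda>i. (cmod (f i))\<^sup>2) summable_on UNIV" "(\<lambda>i. (cmod (g i))\<^sup>2) summable_on UNIV"
  shows "(\<lambda>i. (cmod (f i + g i))\<^sup>2) summable_on UNIV"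
proof -
  have "(\<lambda>i. 2 * (cmod (f i))\<^sup>2 + 2 * (cmod (g i))\<^sup>2) summable_on UNIV"
    by (intro summable_on_add summable_on_cmult_right assms)
  moreover have "norm ((cmod (f i + g i))\<^sup>2) \<le> 2 * (cmod (f i))\<^sup>2 + 2 * (cmod (g i))\<^sup>2" for i
  proof -
    have "(cmod (f i + g i))\<^sup>2 \<le> (cmod (f i) + cmod (g i))\<^sup>2"
      by (intro power_mono norm_triangle_ineq norm_ge_zero)
    moreover have "0 \<le> (cmod (f i) - cmod (g i))\<^sup>2" by simp
    ultimately show ?thesis by (simp add: power2_eq_square algebra_simps)
  qed
  ultimately have "(\<lambda>i. norm ((cmod (f i + g i))\<^sup>2)) summable_on UNIV"
    by (rule Infinite_Sum.abs_summable_on_comparison_test')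
  then show ?thesis by simp
qed

lemma square_summable_cmult:
  assumes "(\<lambda>i. (cmod (f i))\<^sup>2) summable_on UNIV"
  shows "(\<lambda>i. (cmod (c * f i))\<^sup>2) summable_on UNIV"
  using summable_on_cmult_right[OF assms, of "(cmod c)\<^sup>2"] by (simp add: norm_mult power_mult_distrib)

lift_definition cscale :: "complex \<Rightarrow> 'a ell2 \<Rightarrow> 'a ell2" is "\<lambda>c f i. c * f i"
  by (rule square_summable_cmult)

instantiation ell2 :: (type) real_vector
begin
lift_definition zero_ell2 :: "'a ell2" is "\<lambda>_. 0" by simp
lift_definition plus_ell2 :: "'a ell2 \<Rightarrow> 'a ell2 \<Rightarrow> 'a ell2" is "\<lambda>f g i. f i + g i"
  by (rule square_summable_add)
lift_definition uminus_ell2 :: "'a ell2 \<Rightarrow> 'a ell2" is "\<lambda>f i. - f i" by simp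
definition minus_ell2 :: "'a ell2 \<Rightarrow> 'a ell2 \<Rightarrow> 'a ell2" where "minus_ell2 a b = a + - b"
definition scaleR_ell2 :: "real \<Rightarrow> 'a ell2 \<Rightarrow> 'a ell2" where "scaleR_ell2 r a = cscale (of_real r) a"
instance
proof
  fix a b c :: "'a ell2" and r t :: real
  show "a + b + c = a + (b + c)" by transfer (simp add: add.assoc)
  show "a + b = b + a" by transfer (simp add: add.commute)
  show "0 + a = a" by transfer simp
  show "- a + a = 0" by transfer simp
  show "a - b = a + - b" by (simp add: minus_ell2_def)
  show "r *\<^sub>R (a + b) = r *\<^sub>R a + r *\<^sub>R b"
    unfolding scaleR_ell2_def by transfer (simp add: distrib_left)
  show "(r + t) *\<^sub>R a = r *\<^sub>R a + t *\<^sub>R a"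
    unfolding scaleR_ell2_def by transfer (simp add: distrib_right)
  show "r *\<^sub>R t *\<^sub>R a = (r * t) *\<^sub>R a"
    unfolding scaleR_ell2_def by transfer (simp add: mult.assoc)
  show "1 *\<^sub>R a = a" unfolding scaleR_ell2_def by transfer simp
qed
end

lemma coef_zero [simp]: "coef 0 i = 0" by (simp add: zero_ell2.rep_eq)
lemma coef_add [simp]: "coef (a + b) i = coef a i + coef b i" by (simp add: plus_ell2.rep_eq)
lemma coef_minus [simp]: "coef (- a) i = - coef a i" by (simp add: uminus_ell2.rep_eq)
lemma coef_diff [simp]: "coef (a - b) i = coef a i - coef b i"
  by (simp only: minus_ell2_def coef_add coef_minus) simp
lemma coef_cscale [simp]: "coef (cscale c a) i = c * coef a i" by (simp add: cscale.rep_eq)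
lemma coef_sum [simp]: "coef (sum f F) i = (\<Sum>x\<in>F. coef (f x) i)"
  by (induction F rule: infinite_finite_induct) auto

definition cinner :: "'a ell2 \<Rightarrow> 'a ell2 \<Rightarrow> complex" where
  "cinner a b = (\<Sum>\<^sub>\<infinity>i. coef a i * cnj (coef b i))"

lemma abs_summable_cinner: "(\<lambda>i. norm (coef a i * cnj (coef b i))) summable_on UNIV"
proof (rule Infinite_Sum.abs_summable_on_comparison_test')
  show "(\<lambda>i. (cmod (coef a i))\<^sup>2 + (cmod (coef b i))\<^sup>2) summable_on UNIV"
    by (intro summable_on_add square_summable_coef)
  fix i :: 'a
  have "0 \<le> (cmod (coef a i) - cmod (coef b i))\<^sup>2" by simp
  then have "2 * (cmod (coef a i) * cmod (coef b i)) \<le> (cmod (coef a i))\<^sup>2 + (cmod (coef b i))\<^sup>2"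
    by (simp add: power2_eq_square algebra_simps)
  moreover have "0 \<le> cmod (coef a i) * cmod (coef b i)" by simp
  ultimately have "cmod (coef a i) * cmod (coef b i) \<le> (cmod (coef a i))\<^sup>2 + (cmod (coef b i))\<^sup>2"
    by linarith
  then show "norm (coef a i * cnj (coef b i)) \<le> (cmod (coef a i))\<^sup>2 + (cmod (coef b i))\<^sup>2"
    by (simp add: norm_mult)
qed

lemma has_sum_cinner: "((\<lambda>i. coef a i * cnj (coef b i)) has_sum cinner a b) UNIV"
  unfolding cinner_def
  by (rule has_sum_infsum[OF abs_summable_summable[OF abs_summable_cinner]])

lemma cinner_add_left: "cinner (a + b) c = cinner a c + cinner b c"
proof -
  have "((\<lambda>i. coef (a + b) i * cnj (coef c i)) has_sum cinner a c + cinner b c) UNIV"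
    using has_sum_add[OF has_sum_cinner[of a c] has_sum_cinner[of b c]] by (simp add: distrib_right)
  then show ?thesis using has_sum_unique has_sum_cinner by blast
qed

lemma cinner_cscale_left: "cinner (cscale k a) c = k * cinner a c"
proof -
  have "((\<lambda>i. coef (cscale k a) i * cnj (coef c i)) has_sum k * cinner a c) UNIV"
    using has_sum_cmult_right[OF has_sum_cinner[of a c], of k] by (simp add: mult.assoc)
  then show ?thesis using has_sum_unique has_sum_cinner by blast
qed

lemma cinner_commute: "cinner a b = cnj (cinner b a)"
proof -
  have "((\<lambda>i. coef a i * cnj (coef b i)) has_sum cnj (cinner b a)) UNIV"
    using has_sum_cnj_iff[THEN iffD2, OF has_sum_cinner[of b a]] by (simp add: mult.commute)
  then show ?thesis using has_sum_unique has_sum_cinner by blast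
qed

lemma cinner_self: "cinner a a = of_real (\<Sum>\<^sub>\<infinity>i. (cmod (coef a i))\<^sup>2)"
proof -
  have "((\<lambda>i. (cmod (coef a i))\<^sup>2) has_sum (\<Sum>\<^sub>\<infinity>i. (cmod (coef a i))\<^sup>2)) UNIV"
    by (intro has_sum_infsum square_summable_coef)
  then have "((\<lambda>i. complex_of_real ((cmod (coef a i))\<^sup>2)) has_sum of_real (\<Sum>\<^sub>\<infinity>i. (cmod (coef a i))\<^sup>2)) UNIV"
    by (rule has_sum_of_real)
  then show ?thesis
    using has_sum_unique[OF has_sum_cinner[of a a]] by (simp add: complex_norm_square del: of_real_power)
qed

lemma norm_coef_sq_le: "(cmod (coef a i))\<^sup>2 \<le> Re (cinner a a)"
proof -
  have "(\<Sum>\<^sub>\<infinity>j\<in>{i}. (cmod (coef a j))\<^sup>2) \<le> (\<Sum>\<^sub>\<infinity>j. (cmod (coef a j))\<^sup>2)"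
    by (rule infsum_mono2) (auto intro: square_summable_coef)
  then show ?thesis by (simp add: cinner_self)
qed

instantiation ell2 :: (type) real_inner
begin
definition inner_ell2 :: "'a ell2 \<Rightarrow> 'a ell2 \<Rightarrow> real" where "inner_ell2 a b = Re (cinner a b)"
definition norm_ell2 :: "'a ell2 \<Rightarrow> real" where "norm_ell2 a = sqrt (inner a a)"
definition dist_ell2 :: "'a ell2 \<Rightarrow> 'a ell2 \<Rightarrow> real" where "dist_ell2 a b = norm (a - b)"
definition sgn_ell2 :: "'a ell2 \<Rightarrow> 'a ell2" where "sgn_ell2 a = inverse (norm a) *\<^sub>R a"
definition uniformity_ell2 :: "('a ell2 \<times> 'a ell2) filter" where
  "uniformity_ell2 = (INF e\<in>{0<..}. principal {(x, y). dist x y < e})"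
definition open_ell2 :: "'a ell2 set \<Rightarrow> bool" where
  "open_ell2 U = (\<forall>x\<in>U. eventually (\<lambda>(x', y). x' = x \<longrightarrow> y \<in> U) uniformity)"
instance
proof
  fix x y z :: "'a ell2" and r :: real and U :: "'a ell2 set"
  show "dist x y = norm (x - y)" by (simp add: dist_ell2_def)
  show "sgn x = x /\<^sub>R norm x" by (simp add: sgn_ell2_def)
  show "uniformity = (INF e\<in>{0<..}. principal {(x, y::'a ell2). dist x y < e})"
    by (simp add: uniformity_ell2_def)
  show "open U = (\<forall>x\<in>U. eventually (\<lambda>(x', y). x' = x \<longrightarrow> y \<in> U) uniformity)"
    by (simp add: open_ell2_def)
  show "inner x y = inner y x"
    unfolding inner_ell2_def by (subst cinner_commute) simp
  show "inner (x + y) z = inner x z + inner y z"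
    by (simp add: inner_ell2_def cinner_add_left)
  show "inner (r *\<^sub>R x) y = r * inner x y"
    by (simp add: inner_ell2_def scaleR_ell2_def cinner_cscale_left)
  show "0 \<le> inner x x" unfolding inner_ell2_def cinner_self
    by (auto intro: infsum_nonneg)
  show "inner x x = 0 \<longleftrightarrow> x = 0"
  proof
    assume "inner x x = 0"
    then have "(cmod (coef x i))\<^sup>2 \<le> 0" for i
      using norm_coef_sq_le[of x i] by (simp add: inner_ell2_def)
    then show "x = 0" by (intro ell2_eqI) simp
  qed (simp add: inner_ell2_def cinner_self)
  show "norm x = sqrt (inner x x)" by (simp add: norm_ell2_def)
qed
end

lemma norm_ell2_sq: "(norm a)\<^sup>2 = (\<Sum>\<^sub>\<infinity>i. (cmod (coef a i))\<^sup>2)"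
  by (simp add: power2_norm_eq_inner inner_ell2_def cinner_self)

lemma cinner_same: "cinner a a = of_real ((norm a)\<^sup>2)"
  by (simp add: norm_ell2_sq cinner_self)

lemma norm_coef_le: "cmod (coef a i) \<le> norm a"
  using norm_coef_sq_le[of a i] unfolding cinner_same Re_complex_of_real
  by (rule power2_le_imp_le) simp

lemma sum_coef_sq_le: "finite F \<Longrightarrow> (\<Sum>i\<in>F. (cmod (coef a i))\<^sup>2) \<le> (norm a)\<^sup>2"
  unfolding norm_ell2_sq
  using infsum_mono2[of "\<lambda>i. (cmod (coef a i))\<^sup>2" F UNIV] by (simp add: square_summable_coef)

lemma square_summable_bounded:
  assumes "\<And>F. finite F \<Longrightarrow> (\<Sum>i\<in>F. (cmod (f i))\<^sup>2) \<le> C"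
  shows "(\<lambda>i. (cmod (f i))\<^sup>2) summable_on UNIV"
  by (rule nonneg_bdd_above_summable_on) (auto intro!: bdd_aboveI2[where M=C] assms)

lemma norm_ell2_sq_le:
  assumes "\<And>F. finite F \<Longrightarrow> (\<Sum>i\<in>F. (cmod (coef a i))\<^sup>2) \<le> C"
  shows "(norm a)\<^sup>2 \<le> C"
  unfolding norm_ell2_sq by (rule infsum_le_finite_sums) (auto simp: square_summable_coef assms)

instance ell2 :: (type) complete_space
proof
  fix X :: "nat \<Rightarrow> 'a ell2"
  assume C: "Cauchy X"
  have "Cauchy (\<lambda>n. coef (X n) i)" for i
    unfolding Cauchy_def
  proof (intro allI impI)
    fix e :: real assume "e > 0"
    then obtain M where M: "\<forall>m\<ge>M. \<forall>n\<ge>M. dist (X m) (X n) < e" using C unfolding Cauchy_def by blast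
    have "dist (coef (X m) i) (coef (X n) i) \<le> dist (X m) (X n)" for m n
      using norm_coef_le[of "X m - X n" i] by (simp add: dist_norm)
    then show "\<exists>M. \<forall>m\<ge>M. \<forall>n\<ge>M. dist (coef (X m) i) (coef (X n) i) < e"
      using M by (meson order_le_less_trans)
  qed
  then have "\<forall>i. \<exists>l. (\<lambda>n. coef (X n) i) \<longlonglongrightarrow> l" by (simp add: Cauchy_convergent_iff convergent_def)
  then obtain c where c: "\<And>i. (\<lambda>n. coef (X n) i) \<longlonglongrightarrow> c i" by metis
  have tail: "\<exists>M. \<forall>m\<ge>M. \<forall>F. finite F \<longrightarrow> (\<Sum>i\<in>F. (cmod (c i - coef (X m) i))\<^sup>2) \<le> e\<^sup>2"
    if e: "e > 0" for e
  proof -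
    obtain M where M: "\<forall>m\<ge>M. \<forall>n\<ge>M. dist (X m) (X n) < e" using C e unfolding Cauchy_def by blast
    have "(\<Sum>i\<in>F. (cmod (c i - coef (X m) i))\<^sup>2) \<le> e\<^sup>2" if m: "m \<ge> M" and F: "finite F" for m F
    proof (rule tendsto_upperbound)
      show "(\<lambda>n. \<Sum>i\<in>F. (cmod (coef (X n) i - coef (X m) i))\<^sup>2) \<longlonglongrightarrow> (\<Sum>i\<in>F. (cmod (c i - coef (X m) i))\<^sup>2)"
        by (intro tendsto_intros c)
      show "\<forall>\<^sub>F n in sequentially. (\<Sum>i\<in>F. (cmod (coef (X n) i - coef (X m) i))\<^sup>2) \<le> e\<^sup>2"
      proof (rule eventually_sequentiallyI)
        fix n assume "n \<ge> M"
        then have "norm (X n - X m) \<le> e" using M m by (auto simp: dist_norm less_imp_le)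
        then have "(norm (X n - X m))\<^sup>2 \<le> e\<^sup>2" by (rule power_mono) simp
        then show "(\<Sum>i\<in>F. (cmod (coef (X n) i - coef (X m) i))\<^sup>2) \<le> e\<^sup>2"
          using sum_coef_sq_le[OF F, of "X n - X m"] by simp
      qed
    qed simp
    then show ?thesis by blast
  qed
  obtain M where M: "\<And>F. finite F \<Longrightarrow> (\<Sum>i\<in>F. (cmod (c i - coef (X M) i))\<^sup>2) \<le> 1\<^sup>2"
    using tail[of 1] by auto
  have "(\<lambda>i. (cmod ((c i - coef (X M) i) + coef (X M) i))\<^sup>2) summable_on UNIV"
    by (rule square_summable_add[OF square_summable_bounded[OF M] square_summable_coef])
  then have cl: "coef (Abs_ell2 c) = c" by (simp add: coef_Abs_ell2)
  have "X \<longlonglongrightarrow> Abs_ell2 c"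
  proof (rule metric_LIMSEQ_I)
    fix r :: real assume r: "r > 0"
    obtain M where M: "\<And>m F. m \<ge> M \<Longrightarrow> finite F \<Longrightarrow> (\<Sum>i\<in>F. (cmod (c i - coef (X m) i))\<^sup>2) \<le> (r/2)\<^sup>2"
      using tail[of "r/2"] r by auto
    have "dist (X m) (Abs_ell2 c) < r" if "m \<ge> M" for m
    proof -
      have "(norm (Abs_ell2 c - X m))\<^sup>2 \<le> (r/2)\<^sup>2"
        by (rule norm_ell2_sq_le) (use M[OF that] cl in simp)
      then have "norm (Abs_ell2 c - X m) \<le> r/2" by (rule power2_le_imp_le) (use r in simp)
      then show ?thesis using r by (simp add: dist_norm norm_minus_commute)
    qed
    then show "\<exists>M. \<forall>m\<ge>M. dist (X m) (Abs_ell2 c) < r" by blast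
  qed
  then show "convergent X" by (auto simp: convergent_def)
qed

lemma cinner_add_right: "cinner c (a + b) = cinner c a + cinner c b"
  by (subst (1 2 3) cinner_commute) (simp add: cinner_add_left)
lemma cinner_cscale_right: "cinner c (cscale k a) = cnj k * cinner c a"
  by (subst (1 2) cinner_commute) (simp add: cinner_cscale_left)
lemma cscale_minus_one: "cscale (-1) a = - a" by (rule ell2_eqI) simp
lemma cinner_minus_left: "cinner (- a) c = - cinner a c"
  using cinner_cscale_left[of "-1" a c] by (simp add: cscale_minus_one)
lemma cinner_diff_left: "cinner (a - b) c = cinner a c - cinner b c"
  using cinner_add_left[of a "-b" c] by (simp add: cinner_minus_left)
lemma cinner_diff_right: "cinner c (a - b) = cinner c a - cinner c b"
  by (subst (1 2 3) cinner_commute) (simp add: cinner_diff_left)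
lemma cinner_zero_left [simp]: "cinner 0 a = 0" using cinner_add_left[of 0 0 a] by simp
lemma cinner_zero_right [simp]: "cinner a 0 = 0" using cinner_add_right[of a 0 0] by simp
lemma cinner_sum_left: "cinner (sum f F) c = (\<Sum>x\<in>F. cinner (f x) c)"
  by (induction F rule: infinite_finite_induct) (auto simp: cinner_add_left)
lemma cinner_sum_right: "cinner c (sum f F) = (\<Sum>x\<in>F. cinner c (f x))"
  by (induction F rule: infinite_finite_induct) (auto simp: cinner_add_right)

lemma cinner_eq_Complex: "cinner a b = Complex (inner a b) (inner a (cscale \<i> b))"
  by (simp add: inner_ell2_def cinner_cscale_right complex_eq_iff)

lemma tendsto_cinner_left: "(f \<longlongrightarrow> a) F \<Longrightarrow> ((\<lambda>x. cinner (f x) b) \<longlongrightarrow> cinner a b) F"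
  unfolding cinner_eq_Complex by (intro tendsto_intros)

lemma norm_cscale: "norm (cscale c a) = cmod c * norm a"
proof -
  have "(norm (cscale c a))\<^sup>2 = (cmod c * norm a)\<^sup>2"
    by (simp add: norm_ell2_sq norm_mult power_mult_distrib infsum_cmult_right')
  then show ?thesis by (simp add: power2_eq_iff_nonneg)
qed

section \<open>Projections and orthonormal series\<close>

text \<open>A minimizing sequence for the distance from \<open>x\<close> to \<open>M\<close> is Cauchy by the parallelogram law; its
limit is the foot of the perpendicular, since moving from it in a direction of \<open>M\<close> cannot decrease
the distance.\<close>

lemma projection_exists:
  fixes M :: "'a::{real_inner,complete_space} set"
  assumes M: "subspace M" "closed M"
  shows "\<exists>p\<in>M. \<forall>m\<in>M. inner (x - p) m = 0"
proof -
  define d where "d = (INF m\<in>M. (norm (x - m))\<^sup>2)"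
  have bdd: "bdd_below ((\<lambda>m. (norm (x - m))\<^sup>2) ` M)" by (rule bdd_belowI2[where m=0]) simp
  have ne: "M \<noteq> {}" using M(1) subspace_0 by blast
  have d_le: "d \<le> (norm (x - m))\<^sup>2" if "m \<in> M" for m
    unfolding d_def by (rule cINF_lower[OF bdd that])
  have "\<exists>m\<in>M. (norm (x - m))\<^sup>2 < d + inverse (real (Suc n))" for n
    using cInf_lessD[of "(\<lambda>m. (norm (x - m))\<^sup>2) ` M" "d + inverse (real (Suc n))"] ne
    unfolding d_def by force
  then obtain y where y: "\<And>n. y n \<in> M" "\<And>n. (norm (x - y n))\<^sup>2 < d + inverse (real (Suc n))" by metis
  have par: "(norm (y m - y n))\<^sup>2 \<le> 2 * inverse (real (Suc m)) + 2 * inverse (real (Suc n))" for m n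
  proof -
    \<comment> \<open>The midpoint of two nearly optimal points is no better than optimal, so they are close.\<close>
    have mid: "(1/2) *\<^sub>R (y m + y n) \<in> M" using M(1) y by (simp add: subspace_add subspace_scale)
    have eq: "(norm (y m - y n))\<^sup>2 = 2 * (norm (x - y m))\<^sup>2 + 2 * (norm (x - y n))\<^sup>2
        - 4 * (norm (x - (1/2) *\<^sub>R (y m + y n)))\<^sup>2"
      unfolding power2_norm_eq_inner by (simp add: inner_simps inner_commute algebra_simps)
    have "4 * d \<le> 4 * (norm (x - (1/2) *\<^sub>R (y m + y n)))\<^sup>2" using d_le[OF mid] by simp
    then show ?thesis using y(2)[of m] y(2)[of n] eq by linarith
  qed
  have "Cauchy y"
  proof (rule metric_CauchyI)
    fix e :: real assume e: "e > 0"
    obtain N where N: "inverse (real (Suc N)) < e\<^sup>2 / 4" using reals_Archimedean[of "e\<^sup>2/4"] e by auto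
    have "dist (y m) (y n) < e" if "m \<ge> N" "n \<ge> N" for m n
    proof -
      have "inverse (real (Suc m)) \<le> inverse (real (Suc N))" "inverse (real (Suc n)) \<le> inverse (real (Suc N))"
        using that by (auto simp: field_simps)
      then have "(norm (y m - y n))\<^sup>2 < e\<^sup>2" using par[of m n] N by linarith
      then show ?thesis using e by (simp add: dist_norm power_less_imp_less_base)
    qed
    then show "\<exists>M. \<forall>m\<ge>M. \<forall>n\<ge>M. dist (y m) (y n) < e" by blast
  qed
  then obtain p where p: "y \<longlonglongrightarrow> p" using Cauchy_convergent convergent_def by blast
  have pM: "p \<in> M" using closed_sequentially[OF M(2) y(1) p] .
  have "(norm (x - p))\<^sup>2 \<le> d"
  proof (rule tendsto_le)
    show "(\<lambda>n. d + inverse (real (Suc n))) \<longlonglongrightarrow> d"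
      using tendsto_add[OF tendsto_const LIMSEQ_inverse_real_of_nat, of d] by simp
    show "(\<lambda>n. (norm (x - y n))\<^sup>2) \<longlonglongrightarrow> (norm (x - p))\<^sup>2" by (intro tendsto_intros p)
    show "\<forall>\<^sub>F n in sequentially. (norm (x - y n))\<^sup>2 \<le> d + inverse (real (Suc n))"
      using y(2) by (intro always_eventually allI less_imp_le)
  qed simp
  then have min: "(norm (x - p))\<^sup>2 \<le> (norm (x - m))\<^sup>2" if "m \<in> M" for m
    using d_le[OF that] by linarith
  have "inner (x - p) m = 0" if m: "m \<in> M" for m
  proof (cases "m = 0")
    case False
    define t where "t = inner (x - p) m / inner m m"
    have mm: "inner m m > 0" using False by simp
    have "p + t *\<^sub>R m \<in> M" using M(1) pM m by (simp add: subspace_add subspace_scale)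
    from min[OF this] have "inner (x - p) (x - p) \<le> inner (x - p) (x - p) - 2 * t * inner (x - p) m + t * t * inner m m"
      unfolding power2_norm_eq_inner by (simp add: inner_simps inner_commute algebra_simps)
    then have "t * inner (x - p) m \<le> 0" using mm unfolding t_def by (simp add: field_simps)
    then have "(inner (x - p) m)\<^sup>2 \<le> 0" using mm unfolding t_def by (simp add: field_simps power2_eq_square mult_le_0_iff)
    then show ?thesis by simp
  qed simp
  with pM show ?thesis by blast
qed

text \<open>On a subspace closed under multiplication by \<open>\<i>\<close>, real orthogonality implies complex
orthogonality.\<close>

lemma complex_projection_exists:
  fixes M :: "'a ell2 set"
  assumes M: "subspace M" "closed M" and cM: "\<And>c m. m \<in> M \<Longrightarrow> cscale c m \<in> M"
  shows "\<exists>p\<in>M. \<forall>m\<in>M. cinner (x - p) m = 0"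
proof -
  obtain p where "p \<in> M" "\<And>m. m \<in> M \<Longrightarrow> inner (x - p) m = 0"
    using projection_exists[OF M] by blast
  then show ?thesis using cM by (intro bexI[of _ p]) (auto simp: cinner_eq_Complex complex_eq_iff)
qed

lemma norm_orthonormal_sum:
  fixes e :: "'i \<Rightarrow> 'a ell2"
  assumes "\<And>i j. i \<in> A \<Longrightarrow> j \<in> A \<Longrightarrow> cinner (e i) (e j) = (if i = j then 1 else 0)"
    and "finite F" "F \<subseteq> A"
  shows "(norm (\<Sum>i\<in>F. cscale (c i) (e i)))\<^sup>2 = (\<Sum>i\<in>F. (cmod (c i))\<^sup>2)"
proof -
  have "cinner (\<Sum>i\<in>F. cscale (c i) (e i)) (\<Sum>i\<in>F. cscale (c i) (e i))
      = (\<Sum>i\<in>F. \<Sum>j\<in>F. c i * cnj (c j) * cinner (e i) (e j))"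
    by (simp add: cinner_sum_left)
      (simp add: cinner_sum_right cinner_cscale_left cinner_cscale_right algebra_simps sum_distrib_left)
  also have "\<dots> = (\<Sum>i\<in>F. \<Sum>j\<in>F. if i = j then c i * cnj (c j) else 0)"
    using assms by (intro sum.cong refl) (auto simp: subset_iff)
  also have "\<dots> = (\<Sum>i\<in>F. c i * cnj (c i))" using assms(2) by simp
  also have "\<dots> = of_real (\<Sum>i\<in>F. (cmod (c i))\<^sup>2)"
    by (simp add: complex_norm_square[symmetric])
  finally have "complex_of_real ((norm (\<Sum>i\<in>F. cscale (c i) (e i)))\<^sup>2) = of_real (\<Sum>i\<in>F. (cmod (c i))\<^sup>2)"
    by (simp only: cinner_same)
  then show ?thesis using of_real_eq_iff by blast
qed

text \<open>By the theorem of Pythagoras, the partial sums form a Cauchy net because the tails of the series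
of squared moduli are small. The sum is taken over finite subsets, not absolutely: the norms of
the terms need not be summable.\<close>

lemma orthonormal_series:
  fixes e :: "'i \<Rightarrow> 'a ell2"
  assumes on: "\<And>i j. i \<in> A \<Longrightarrow> j \<in> A \<Longrightarrow> cinner (e i) (e j) = (if i = j then 1 else 0)"
    and c: "(\<lambda>i. (cmod (c i))\<^sup>2) summable_on A"
  shows "\<exists>x. ((\<lambda>i. cscale (c i) (e i)) has_sum x) A \<and> (norm x)\<^sup>2 = (\<Sum>\<^sub>\<infinity>i\<in>A. (cmod (c i))\<^sup>2)"
proof -
  define f where "f = (\<lambda>i. cscale (c i) (e i))"
  define L where "L = (\<Sum>\<^sub>\<infinity>i\<in>A. (cmod (c i))\<^sup>2)"
  have lim: "((\<lambda>F. \<Sum>i\<in>F. (cmod (c i))\<^sup>2) \<longlongrightarrow> L) (finite_subsets_at_top A)"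
    using has_sum_infsum[OF c] unfolding has_sum_def L_def by simp
  have le: "(\<Sum>i\<in>F. (cmod (c i))\<^sup>2) \<le> L" if "finite F" "F \<subseteq> A" for F
    unfolding L_def using infsum_mono2[of "\<lambda>i. (cmod (c i))\<^sup>2" F A] that c by simp
  have diff: "(norm (sum f F - sum f G))\<^sup>2 \<le> L - (\<Sum>i\<in>G. (cmod (c i))\<^sup>2)"
    if "finite F" "F \<subseteq> A" "G \<subseteq> F" for F G
  proof -
    have fG: "finite G" using that finite_subset by blast
    have "sum f F - sum f G = sum f (F - G)" using that by (simp add: sum_diff)
    then have "(norm (sum f F - sum f G))\<^sup>2 = (\<Sum>i\<in>F - G. (cmod (c i))\<^sup>2)"
      unfolding f_def using norm_orthonormal_sum[OF on, of A "F - G" c] that by auto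
    also have "\<dots> = (\<Sum>i\<in>F. (cmod (c i))\<^sup>2) - (\<Sum>i\<in>G. (cmod (c i))\<^sup>2)" using that fG by (simp add: sum_diff)
    finally show ?thesis using le that by auto
  qed
  have "\<exists>P. eventually P (finite_subsets_at_top A) \<and> (\<forall>F F'. P F \<and> P F' \<longrightarrow> dist (sum f F) (sum f F') < \<epsilon>)"
    if "\<epsilon> > 0" for \<epsilon>
  proof -
    have "eventually (\<lambda>F. dist (\<Sum>i\<in>F. (cmod (c i))\<^sup>2) L < (\<epsilon>/2)\<^sup>2) (finite_subsets_at_top A)"
      using lim that by (intro tendstoD) auto
    then obtain G where G: "finite G" "G \<subseteq> A" "dist (\<Sum>i\<in>G. (cmod (c i))\<^sup>2) L < (\<epsilon>/2)\<^sup>2"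
      unfolding eventually_finite_subsets_at_top by blast
    define P where "P = (\<lambda>F. finite F \<and> G \<subseteq> F \<and> F \<subseteq> A)"
    have near: "norm (sum f F - sum f G) < \<epsilon>/2" if "P F" for F
    proof -
      have "(norm (sum f F - sum f G))\<^sup>2 < (\<epsilon>/2)\<^sup>2"
        using diff[of F G] that G(3) unfolding P_def by (simp add: dist_real_def abs_less_iff)
      then show ?thesis using \<open>\<epsilon> > 0\<close> by (intro power2_less_imp_less[of _ "\<epsilon>/2"]) auto
    qed
    have "dist (sum f F) (sum f F') < \<epsilon>" if "P F" "P F'" for F F'
      using norm_diff_triangle_less[OF near[OF that(1)], of "sum f F'" "\<epsilon>/2"] near[OF that(2)]
      by (simp add: dist_norm norm_minus_commute)
    moreover have "eventually P (finite_subsets_at_top A)"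
      unfolding P_def eventually_finite_subsets_at_top using G by blast
    ultimately show ?thesis by blast
  qed
  then have \<open>cauchy_filter (filtermap (sum f) (finite_subsets_at_top A))\<close>
    by (simp add: cauchy_filter_metric_filtermap)
  moreover have "complete (UNIV::'a ell2 set)"
    by (meson Cauchy_convergent UNIV_I complete_def convergent_def)
  ultimately obtain x where x: \<open>(sum f \<longlongrightarrow> x) (finite_subsets_at_top A)\<close>
    using complete_uniform[where S="UNIV :: 'a ell2 set"] by (force simp add: filterlim_def)
  have "((\<lambda>F. (norm (sum f F))\<^sup>2) \<longlongrightarrow> (norm x)\<^sup>2) (finite_subsets_at_top A)"
    by (intro tendsto_intros x)
  moreover have "\<forall>\<^sub>F F in finite_subsets_at_top A. (norm (sum f F))\<^sup>2 = (\<Sum>i\<in>F. (cmod (c i))\<^sup>2)"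
    unfolding f_def
    by (rule eventually_finite_subsets_at_top_weakI) (rule norm_orthonormal_sum[OF on])
  ultimately have "((\<lambda>F. \<Sum>i\<in>F. (cmod (c i))\<^sup>2) \<longlongrightarrow> (norm x)\<^sup>2) (finite_subsets_at_top A)"
    by (rule Lim_transform_eventually)
  then have "(norm x)\<^sup>2 = L" using lim tendsto_unique finite_subsets_at_top_neq_bot by blast
  then show ?thesis using x unfolding has_sum_def f_def L_def by blast
qed

lemma bessel_inequality:
  fixes e :: "'i \<Rightarrow> 'a ell2"
  assumes on: "\<And>i j. i \<in> A \<Longrightarrow> j \<in> A \<Longrightarrow> cinner (e i) (e j) = (if i = j then 1 else 0)"
    and F: "finite F" "F \<subseteq> A"
  shows "(\<Sum>i\<in>F. (cmod (cinner x (e i)))\<^sup>2) \<le> (norm x)\<^sup>2"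
proof -
  define y where "y = (\<Sum>i\<in>F. cscale (cinner x (e i)) (e i))"
  have y2: "(norm y)\<^sup>2 = (\<Sum>i\<in>F. (cmod (cinner x (e i)))\<^sup>2)"
    unfolding y_def by (rule norm_orthonormal_sum[OF on F]) 
  have "cinner x y = (\<Sum>i\<in>F. cnj (cinner x (e i)) * cinner x (e i))"
    unfolding y_def by (simp add: cinner_sum_right cinner_cscale_right)
  also have "\<dots> = of_real ((norm y)\<^sup>2)" unfolding y2
    by (simp add: complex_norm_square[symmetric] mult.commute)
  finally have xy: "inner x y = (norm y)\<^sup>2" by (simp add: inner_ell2_def)
  have "0 \<le> inner (x - y) (x - y)" by simp
  also have "\<dots> = (norm x)\<^sup>2 - (norm y)\<^sup>2"
    unfolding power2_norm_eq_inner
    using xy by (simp add: inner_diff_left inner_diff_right inner_commute[of y x] power2_norm_eq_inner)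
  finally show ?thesis using y2 by simp
qed

section \<open>Fourier coefficients on the torus\<close>

text \<open>The monomials \<open>z\<^sup>m w\<^sup>n\<close>, used both as characters of the torus and as the terms of Laurent
series.\<close>

definition mon :: "int \<times> int \<Rightarrow> complex \<times> complex \<Rightarrow> complex" where
  "mon \<alpha> p = fst p powi fst \<alpha> * snd p powi snd \<alpha>"

abbreviation torus_param :: "real \<times> real \<Rightarrow> complex \<times> complex" where
  "torus_param \<equiv> \<lambda>(\<theta>, \<gamma>). (cis \<theta>, cis \<gamma>)"

lemma continuous_cis: "continuous_on A cis"
  unfolding cis_conv_exp by (intro continuous_intros)

lemma measurable_cis [measurable]: "cis \<in> borel_measurable borel"
  by (rule borel_measurable_continuous_onI[OF continuous_cis])

lemma measurable_torus_param [measurable]: "torus_param \<in> borel_measurable borel"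
  by (intro borel_measurable_continuous_onI)
    (auto simp: case_prod_unfold intro!: continuous_intros continuous_on_compose2[OF continuous_cis])

lemma measurable_fst_borel [measurable]: "fst \<in> borel_measurable (borel :: (complex \<times> complex) measure)"
  by (intro borel_measurable_continuous_onI continuous_intros)
lemma measurable_snd_borel [measurable]: "snd \<in> borel_measurable (borel :: (complex \<times> complex) measure)"
  by (intro borel_measurable_continuous_onI continuous_intros)

lemma measurable_mon [measurable]: "mon \<alpha> \<in> borel_measurable borel"
  unfolding mon_def power_int_def by measurable

lemma sets_torus [simp, measurable_cong]: "sets torus_measure = sets borel"
  by (simp add: torus_measure_def)
lemma space_torus [simp]: "space torus_measure = UNIV"
  by (simp add: torus_measure_def)

abbreviation param_box :: "(real \<times> real) set" where "param_box \<equiv> {0..2*pi} \<times> {0..2*pi}"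

lemma emeasure_param_box: "emeasure lborel param_box = ennreal (4 * pi\<^sup>2)"
proof -
  have "emeasure (lborel \<Otimes>\<^sub>M lborel) ({0..2*pi} \<times> {0..2*pi::real}) = ennreal (2*pi) * ennreal (2*pi)"
    by (subst lborel.emeasure_pair_measure_Times) auto
  then show ?thesis by (simp add: lborel_prod power2_eq_square flip: ennreal_mult)
qed

lemma param_box_sets [measurable]: "param_box \<in> sets borel"
  by (intro borel_closed closed_Times) auto

lemma uniform_box_eq: "uniform_measure lborel param_box = density lborel (\<lambda>x. ennreal (indicator param_box x / (4 * pi\<^sup>2)))"
  unfolding uniform_measure_def emeasure_param_box
  by (intro density_cong AE_I2) (auto split: split_indicator simp: divide_ennreal simp flip: ennreal_1)

text \<open>The iterated integral in the Hardy norm is an integral with respect to \<^const>\<open>torus_measure\<close>.\<close>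

lemma nn_integral_torus:
  assumes [measurable]: "h \<in> borel_measurable borel"
  shows "(\<integral>\<^sup>+ p. h p \<partial>torus_measure) = ennreal (1 / (4 * pi\<^sup>2)) *
     (\<integral>\<^sup>+ \<theta>\<in>{0..2*pi}. (\<integral>\<^sup>+ \<gamma>\<in>{0..2*pi}. h (cis \<theta>, cis \<gamma>) \<partial>lborel) \<partial>lborel)"
proof -
  have [measurable]: "(\<lambda>x. h (torus_param x)) \<in> borel_measurable borel" by measurable
  have m: "(\<lambda>x. h (torus_param x) * indicator param_box x) \<in> borel_measurable (lborel \<Otimes>\<^sub>M lborel)"
    unfolding lborel_prod by measurable
  have "(\<integral>\<^sup>+ p. h p \<partial>torus_measure) = (\<integral>\<^sup>+ x. ennreal (indicator param_box x / (4 * pi\<^sup>2)) * h (torus_param x) \<partial>lborel)"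
    unfolding torus_measure_def uniform_box_eq
    by (subst nn_integral_distr) (auto simp: nn_integral_density)
  also have "\<dots> = (\<integral>\<^sup>+ x. ennreal (1 / (4 * pi\<^sup>2)) * (h (torus_param x) * indicator param_box x) \<partial>lborel)"
    by (intro nn_integral_cong) (auto split: split_indicator)
  also have "\<dots> = ennreal (1 / (4 * pi\<^sup>2)) * (\<integral>\<^sup>+ x. h (torus_param x) * indicator param_box x \<partial>lborel)"
    by (intro nn_integral_cmult) measurable
  also have "(\<integral>\<^sup>+ x. h (torus_param x) * indicator param_box x \<partial>lborel)
      = (\<integral>\<^sup>+ \<theta>. \<integral>\<^sup>+ \<gamma>. h (cis \<theta>, cis \<gamma>) * indicator param_box (\<theta>, \<gamma>) \<partial>lborel \<partial>lborel)"
    using lborel.nn_integral_fst[OF m] unfolding lborel_prod by simp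
  also have "\<dots> = (\<integral>\<^sup>+ \<theta>. \<integral>\<^sup>+ \<gamma>. (h (cis \<theta>, cis \<gamma>) * indicator {0..2*pi} \<gamma>) * indicator {0..2*pi} \<theta> \<partial>lborel \<partial>lborel)"
    by (intro nn_integral_cong) (auto split: split_indicator)
  also have "\<dots> = (\<integral>\<^sup>+ \<theta>\<in>{0..2*pi}. (\<integral>\<^sup>+ \<gamma>\<in>{0..2*pi}. h (cis \<theta>, cis \<gamma>) \<partial>lborel) \<partial>lborel)"
    by (intro nn_integral_cong nn_integral_multc) measurable
  finally show ?thesis .
qed

lemma emeasure_torus_UNIV: "emeasure torus_measure UNIV = 1"
proof -
  have "torus_param -` UNIV = UNIV" by simp
  then show ?thesis unfolding torus_measure_def
    by (subst emeasure_distr) (auto simp: emeasure_param_box divide_ennreal simp flip: ennreal_1)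
qed

interpretation torus: finite_measure torus_measure
  by standard (simp add: emeasure_torus_UNIV)

lemma measure_torus_UNIV [simp]: "measure torus_measure UNIV = 1"
  by (simp add: measure_def emeasure_torus_UNIV)

lemma AE_torus: "AE p in torus_measure. cmod (fst p) = 1 \<and> cmod (snd p) = 1"
  unfolding torus_measure_def by (subst AE_distr_iff) auto

lemma norm_mon: "cmod (fst p) = 1 \<Longrightarrow> cmod (snd p) = 1 \<Longrightarrow> cmod (mon \<alpha> p) = 1"
  by (simp add: mon_def norm_mult norm_power_int)

lemma AE_norm_mon: "AE p in torus_measure. cmod (mon \<alpha> p) = 1"
  using AE_torus by eventually_elim (simp add: norm_mon)

lemma mon_add: "fst p \<noteq> 0 \<Longrightarrow> snd p \<noteq> 0 \<Longrightarrow> mon (\<alpha> + \<beta>) p = mon \<alpha> p * mon \<beta> p"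
  by (simp add: mon_def power_int_add)

lemma mon_zero [simp]: "mon 0 p = 1" by (simp add: mon_def)

lemma cnj_mon: "cmod (fst p) = 1 \<Longrightarrow> cmod (snd p) = 1 \<Longrightarrow> cnj (mon \<alpha> p) = mon (- \<alpha>) p"
proof -
  assume a: "cmod (fst p) = 1" "cmod (snd p) = 1"
  then have "fst p \<noteq> 0" "snd p \<noteq> 0" by auto
  then have "mon \<alpha> p * mon (-\<alpha>) p = 1" using mon_add[of p \<alpha> "-\<alpha>"] by simp
  moreover have "mon \<alpha> p * cnj (mon \<alpha> p) = 1"
    using norm_mon[OF a] complex_norm_square[of "mon \<alpha> p"] by simp
  ultimately show ?thesis by (metis mult_cancel_left mult_zero_left zero_neq_one)
qed

lemma integrable_torus_bounded:
  fixes h :: "complex \<times> complex \<Rightarrow> 'b::{banach, second_countable_topology}"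
  assumes "h \<in> borel_measurable borel" "AE p in torus_measure. norm (h p) \<le> B"
  shows "integrable torus_measure h"
  by (rule torus.integrable_const_bound[OF assms(2)]) (use assms(1) in measurable)

lemma integrable_mon [simp]: "integrable torus_measure (mon \<alpha>)"
  by (rule integrable_torus_bounded[where B=1]) (use AE_norm_mon[of \<alpha>] in auto)

lemma
  fixes h :: "complex \<times> complex \<Rightarrow> complex"
  assumes i: "integrable torus_measure h"
  shows integral_torus_fst: "integral\<^sup>L torus_measure h = (1 / (4 * pi\<^sup>2)) *\<^sub>R
     (LBINT \<theta>:{0..2*pi}. (LBINT \<gamma>:{0..2*pi}. h (cis \<theta>, cis \<gamma>)))"
    and integral_torus_snd: "integral\<^sup>L torus_measure h = (1 / (4 * pi\<^sup>2)) *\<^sub>R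
     (LBINT \<gamma>:{0..2*pi}. (LBINT \<theta>:{0..2*pi}. h (cis \<theta>, cis \<gamma>)))"
proof -
  have [measurable]: "h \<in> borel_measurable borel" using i by (auto dest: borel_measurable_integrable)
  have hm: "(\<lambda>x. h (torus_param x)) \<in> borel_measurable borel" by measurable
  define k where "k = (\<lambda>x. indicat_real param_box x *\<^sub>R h (torus_param x))"
  have i2: "integrable lborel (\<lambda>x. (indicator param_box x / (4 * pi\<^sup>2)) *\<^sub>R h (torus_param x))"
    using i unfolding torus_measure_def uniform_box_eq
    by (subst (asm) integrable_distr_eq) (use hm in \<open>auto simp: integrable_density\<close>)
  have "integrable lborel (\<lambda>x. (4 * pi\<^sup>2) *\<^sub>R ((indicator param_box x / (4 * pi\<^sup>2)) *\<^sub>R h (torus_param x)))"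
    by (intro integrable_scaleR_right i2)
  then have ik: "integrable (lborel \<Otimes>\<^sub>M lborel) k" unfolding k_def by (simp add: lborel_prod)
  have "integral\<^sup>L torus_measure h = (\<integral>x. (indicator param_box x / (4 * pi\<^sup>2)) *\<^sub>R h (torus_param x) \<partial>lborel)"
    unfolding torus_measure_def uniform_box_eq
    by (subst integral_distr) (use hm in \<open>auto simp: integral_density\<close>)
  also have "\<dots> = (\<integral>x. (1 / (4 * pi\<^sup>2)) *\<^sub>R k x \<partial>lborel)" unfolding k_def
    by (intro Bochner_Integration.integral_cong) auto
  also have "\<dots> = (1 / (4 * pi\<^sup>2)) *\<^sub>R integral\<^sup>L (lborel \<Otimes>\<^sub>M lborel) k"
    by (simp add: lborel_prod)
  finally have eq: "integral\<^sup>L torus_measure h = (1 / (4 * pi\<^sup>2)) *\<^sub>R integral\<^sup>L (lborel \<Otimes>\<^sub>M lborel) k" .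
  have 1: "integral\<^sup>L (lborel \<Otimes>\<^sub>M lborel) k = (\<integral>\<theta>. \<integral>\<gamma>. k (\<theta>, \<gamma>) \<partial>lborel \<partial>lborel)"
    using lborel_pair.integral_fst'[OF ik] by simp
  also have "\<dots> = (LBINT \<theta>:{0..2*pi}. (LBINT \<gamma>:{0..2*pi}. h (cis \<theta>, cis \<gamma>)))"
    unfolding set_lebesgue_integral_def k_def
    by (intro Bochner_Integration.integral_cong refl)
      (auto simp: indicator_def intro!: Bochner_Integration.integral_cong)
  finally show "integral\<^sup>L torus_measure h = (1 / (4 * pi\<^sup>2)) *\<^sub>R
     (LBINT \<theta>:{0..2*pi}. (LBINT \<gamma>:{0..2*pi}. h (cis \<theta>, cis \<gamma>)))" using eq by simp
  have "integral\<^sup>L (lborel \<Otimes>\<^sub>M lborel) k = (\<integral>\<gamma>. \<integral>\<theta>. k (\<theta>, \<gamma>) \<partial>lborel \<partial>lborel)"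
    using lborel_pair.Fubini_integral[of "\<lambda>x y. k (x, y)"] ik 1 by simp
  also have "\<dots> = (LBINT \<gamma>:{0..2*pi}. (LBINT \<theta>:{0..2*pi}. h (cis \<theta>, cis \<gamma>)))"
    unfolding set_lebesgue_integral_def k_def
    by (intro Bochner_Integration.integral_cong refl)
      (auto simp: indicator_def intro!: Bochner_Integration.integral_cong)
  finally show "integral\<^sup>L torus_measure h = (1 / (4 * pi\<^sup>2)) *\<^sub>R
     (LBINT \<gamma>:{0..2*pi}. (LBINT \<theta>:{0..2*pi}. h (cis \<theta>, cis \<gamma>)))" using eq by simp
qed

lemma integral_cis_power: "(LBINT \<theta>:{0..2*pi}. cis \<theta> powi m) = (if m = 0 then of_real (2*pi) else 0)"
proof -
  have eq: "cis \<theta> powi m = cis (of_int m * \<theta>)" for \<theta> by (simp add: cis_power_int)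
  have "set_integrable lborel {0..2*pi} (\<lambda>\<theta>. cis (of_int m * \<theta>))"
    by (intro borel_integrable_atLeastAtMost') (auto intro!: continuous_intros continuous_on_compose2[OF continuous_cis])
  then have "(LBINT \<theta>:{0..2*pi}. cis (of_int m * \<theta>)) = integral {0..2*pi} (\<lambda>\<theta>. cis (of_int m * \<theta>))"
    by (rule set_borel_integral_eq_integral)
  also have "\<dots> = (if m = 0 then of_real (2*pi) else 0)"
  proof (cases "m = 0")
    case False
    define F where "F = (\<lambda>\<theta>::real. cis (of_int m * \<theta>) / (\<i> * of_int m))"
    have "((\<lambda>\<theta>. cis (of_int m * \<theta>)) has_integral (F (2*pi) - F 0)) {0..2*pi}"
    proof (rule fundamental_theorem_of_calculus)
      fix x :: real
      have "((\<lambda>z. exp (\<i> * (of_int m * z)) / (\<i> * of_int m)) has_field_derivative exp (\<i> * (of_int m * of_real x))) (at (of_real x))"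
        using False by (auto intro!: derivative_eq_intros simp: ac_simps)
      from has_vector_derivative_real_field[OF this]
      have "((\<lambda>\<theta>. exp (\<i> * of_real (of_int m * \<theta>)) / (\<i> * of_int m)) has_vector_derivative exp (\<i> * of_real (of_int m * x))) (at x within {0..2*pi})"
        by simp
      then show "(F has_vector_derivative cis (of_int m * x)) (at x within {0..2*pi})"
        unfolding F_def cis_conv_exp .
    qed simp
    moreover have "cis (of_int m * (2*pi)) = 1" using cis_multiple_2pi[of "of_int m"] by (simp add: mult.commute)
    ultimately show ?thesis using False by (simp add: F_def integral_unique)
  qed (simp add: scaleR_conv_of_real)
  finally show ?thesis by (simp add: eq)
qed

lemma integral_mon: "integral\<^sup>L torus_measure (mon \<alpha>) = (if \<alpha> = 0 then 1 else 0)"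
proof -
  have "integral\<^sup>L torus_measure (mon \<alpha>) = (1 / (4 * pi\<^sup>2)) *\<^sub>R
     (LBINT \<theta>:{0..2*pi}. (LBINT \<gamma>:{0..2*pi}. cis \<theta> powi fst \<alpha> * cis \<gamma> powi snd \<alpha>))"
    by (subst integral_torus_fst) (simp_all add: mon_def)
  also have "(\<lambda>\<theta>. LBINT \<gamma>:{0..2*pi}. cis \<theta> powi fst \<alpha> * cis \<gamma> powi snd \<alpha>)
     = (\<lambda>\<theta>. cis \<theta> powi fst \<alpha> * (LBINT \<gamma>:{0..2*pi}. cis \<gamma> powi snd \<alpha>))" by (rule ext) simp
  also have "(1 / (4 * pi\<^sup>2)) *\<^sub>R (LBINT \<theta>:{0..2*pi}. cis \<theta> powi fst \<alpha> * (LBINT \<gamma>:{0..2*pi}. cis \<gamma> powi snd \<alpha>))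
     = (if \<alpha> = 0 then 1 else 0)"
    unfolding integral_cis_power
    by (simp add: integral_cis_power prod_eq_iff scaleR_conv_of_real power2_eq_square)
  finally show ?thesis .
qed

definition fcoef :: "(complex \<times> complex \<Rightarrow> complex) \<Rightarrow> int \<times> int \<Rightarrow> complex" where
  "fcoef b \<alpha> = (\<integral>p. b p * cnj (mon \<alpha> p) \<partial>torus_measure)"

definition L2_torus :: "(complex \<times> complex \<Rightarrow> complex) set" where
  "L2_torus = {b \<in> borel_measurable borel. integrable torus_measure (\<lambda>p. (cmod (b p))\<^sup>2)}"

definition tpoly :: "(int \<times> int \<Rightarrow> complex) \<Rightarrow> (int \<times> int) set \<Rightarrow> complex \<times> complex \<Rightarrow> complex" where
  "tpoly a F p = (\<Sum>\<alpha>\<in>F. a \<alpha> * mon \<alpha> p)"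

abbreviation L2_sq :: "(complex \<times> complex \<Rightarrow> complex) \<Rightarrow> real" where
  "L2_sq b \<equiv> \<integral>p. (cmod (b p))\<^sup>2 \<partial>torus_measure"

lemma L2_measurable: "b \<in> L2_torus \<Longrightarrow> b \<in> borel_measurable borel" by (simp add: L2_torus_def)

lemma L2_integrable_mult:
  assumes "b \<in> L2_torus" "c \<in> L2_torus"
  shows "integrable torus_measure (\<lambda>p. b p * cnj (c p))"
proof (rule Bochner_Integration.integrable_bound)
  show "integrable torus_measure (\<lambda>p. (cmod (b p))\<^sup>2 + (cmod (c p))\<^sup>2)"
    using assms by (simp add: L2_torus_def)
  have [measurable]: "b \<in> borel_measurable borel" "c \<in> borel_measurable borel"
    using assms by (auto simp: L2_torus_def)
  have [measurable]: "cnj \<in> borel_measurable borel"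
    by (intro borel_measurable_continuous_onI continuous_intros)
  show "(\<lambda>p. b p * cnj (c p)) \<in> borel_measurable torus_measure" by measurable
  have "norm (b p * cnj (c p)) \<le> norm ((cmod (b p))\<^sup>2 + (cmod (c p))\<^sup>2)" for p
  proof -
    have "0 \<le> (cmod (b p) - cmod (c p))\<^sup>2" by simp
    then have "2 * (cmod (b p) * cmod (c p)) \<le> (cmod (b p))\<^sup>2 + (cmod (c p))\<^sup>2"
      by (simp add: power2_eq_square algebra_simps)
    moreover have "0 \<le> cmod (b p) * cmod (c p)" by simp
    ultimately have "cmod (b p) * cmod (c p) \<le> (cmod (b p))\<^sup>2 + (cmod (c p))\<^sup>2" by linarith
    then show ?thesis by (simp add: norm_mult)
  qed
  then show "AE p in torus_measure. norm (b p * cnj (c p)) \<le> norm ((cmod (b p))\<^sup>2 + (cmod (c p))\<^sup>2)" by simp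
qed

lemma L2_bounded: "b \<in> borel_measurable borel \<Longrightarrow> (AE p in torus_measure. cmod (b p) \<le> B) \<Longrightarrow> b \<in> L2_torus"
proof -
  assume b: "b \<in> borel_measurable borel" and *: "AE p in torus_measure. cmod (b p) \<le> B"
  have "integrable torus_measure (\<lambda>p. (cmod (b p))\<^sup>2)"
  proof (rule integrable_torus_bounded[where B="B\<^sup>2"])
    show "(\<lambda>p. (cmod (b p))\<^sup>2) \<in> borel_measurable borel" using b by measurable
    show "AE p in torus_measure. norm ((cmod (b p))\<^sup>2) \<le> B\<^sup>2"
      using * by eventually_elim (simp add: power_mono)
  qed
  then show ?thesis using b by (simp add: L2_torus_def)
qed

lemma L2_mon: "mon \<alpha> \<in> L2_torus"
  by (rule L2_bounded[where B=1]) (use AE_norm_mon[of \<alpha>] in auto)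

lemma L2_const: "(\<lambda>_. c) \<in> L2_torus"
  by (rule L2_bounded[where B="cmod c"]) auto

lemma L2_add: "b \<in> L2_torus \<Longrightarrow> c \<in> L2_torus \<Longrightarrow> (\<lambda>p. b p + c p) \<in> L2_torus"
proof -
  assume bc: "b \<in> L2_torus" "c \<in> L2_torus"
  then have [measurable]: "b \<in> borel_measurable borel" "c \<in> borel_measurable borel"
    by (auto simp: L2_torus_def)
  have "integrable torus_measure (\<lambda>p. (cmod (b p + c p))\<^sup>2)"
  proof (rule Bochner_Integration.integrable_bound)
    show "integrable torus_measure (\<lambda>p. 2 * (cmod (b p))\<^sup>2 + 2 * (cmod (c p))\<^sup>2)"
      using bc by (simp add: L2_torus_def)
    have "norm ((cmod (b p + c p))\<^sup>2) \<le> norm (2 * (cmod (b p))\<^sup>2 + 2 * (cmod (c p))\<^sup>2)" for p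
    proof -
      have "(cmod (b p + c p))\<^sup>2 \<le> (cmod (b p) + cmod (c p))\<^sup>2"
        by (intro power_mono norm_triangle_ineq norm_ge_zero)
      moreover have "0 \<le> (cmod (b p) - cmod (c p))\<^sup>2" by simp
      ultimately show ?thesis by (simp add: power2_eq_square algebra_simps)
    qed
    then show "AE p in torus_measure. norm ((cmod (b p + c p))\<^sup>2) \<le> norm (2 * (cmod (b p))\<^sup>2 + 2 * (cmod (c p))\<^sup>2)" by simp
  qed measurable
  then show ?thesis by (simp add: L2_torus_def)
qed

lemma L2_cmult: "b \<in> L2_torus \<Longrightarrow> (\<lambda>p. k * b p) \<in> L2_torus"
  by (auto simp: L2_torus_def norm_mult power_mult_distrib)

lemma L2_diff: "b \<in> L2_torus \<Longrightarrow> c \<in> L2_torus \<Longrightarrow> (\<lambda>p. b p - c p) \<in> L2_torus"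
  using L2_add[of b "\<lambda>p. (-1) * c p"] L2_cmult[of c "-1"] by simp

lemma L2_tpoly: "tpoly a F \<in> L2_torus"
proof -
  have "(\<lambda>p. \<Sum>\<alpha>\<in>F. a \<alpha> * mon \<alpha> p) \<in> L2_torus"
  proof (induction F rule: infinite_finite_induct)
    case (insert x F)
    then show ?case by (simp add: L2_add L2_cmult L2_mon)
  qed (auto intro: L2_const)
  then show ?thesis unfolding tpoly_def[abs_def] .
qed

lemma fcoef_add: "b \<in> L2_torus \<Longrightarrow> c \<in> L2_torus \<Longrightarrow> fcoef (\<lambda>p. b p + c p) \<alpha> = fcoef b \<alpha> + fcoef c \<alpha>"
  unfolding fcoef_def using L2_integrable_mult[OF _ L2_mon] by (simp add: distrib_right)
lemma fcoef_diff: "b \<in> L2_torus \<Longrightarrow> c \<in> L2_torus \<Longrightarrow> fcoef (\<lambda>p. b p - c p) \<alpha> = fcoef b \<alpha> - fcoef c \<alpha>"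
  unfolding fcoef_def using L2_integrable_mult[OF _ L2_mon] by (simp add: left_diff_distrib)
lemma fcoef_cmult: "fcoef (\<lambda>p. k * b p) \<alpha> = k * fcoef b \<alpha>"
  unfolding fcoef_def by (simp add: mult.assoc)

lemma fcoef_mon: "fcoef (mon \<beta>) \<alpha> = (if \<alpha> = \<beta> then 1 else 0)"
proof -
  have "fcoef (mon \<beta>) \<alpha> = integral\<^sup>L torus_measure (mon (\<beta> - \<alpha>))"
    unfolding fcoef_def
  proof (rule integral_cong_AE)
    show "(\<lambda>p. mon \<beta> p * cnj (mon \<alpha> p)) \<in> borel_measurable torus_measure"
      using L2_integrable_mult[OF L2_mon L2_mon] by (rule borel_measurable_integrable)
    show "mon (\<beta> - \<alpha>) \<in> borel_measurable torus_measure" by measurable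
    show "AE p in torus_measure. mon \<beta> p * cnj (mon \<alpha> p) = mon (\<beta> - \<alpha>) p"
      using AE_torus
    proof eventually_elim
      case (elim p)
      then have "fst p \<noteq> 0" "snd p \<noteq> 0" by auto
      then show ?case using elim mon_add[of p \<beta> "-\<alpha>"] by (simp add: cnj_mon)
    qed
  qed
  then show ?thesis by (simp add: integral_mon)
qed

lemma fcoef_tpoly: "finite F \<Longrightarrow> fcoef (tpoly a F) \<alpha> = (if \<alpha> \<in> F then a \<alpha> else 0)"
proof -
  assume "finite F"
  then have "fcoef (\<lambda>p. \<Sum>\<alpha>\<in>F. a \<alpha> * mon \<alpha> p) \<alpha> = (if \<alpha> \<in> F then a \<alpha> else 0)"
  proof (induction F)
    case empty
    then show ?case by (simp add: fcoef_def)
  next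
    case (insert x F)
    have "(\<lambda>p. \<Sum>\<alpha>\<in>F. a \<alpha> * mon \<alpha> p) \<in> L2_torus" using L2_tpoly[of a F] unfolding tpoly_def[abs_def] .
    then show ?case using insert by (simp add: fcoef_add L2_cmult L2_mon fcoef_cmult fcoef_mon)
  qed
  then show ?thesis unfolding tpoly_def[abs_def] .
qed

lemma integral_tpoly_right:
  assumes "finite F" "b \<in> L2_torus"
  shows "(\<integral>p. b p * cnj (tpoly a F p) \<partial>torus_measure) = (\<Sum>\<alpha>\<in>F. cnj (a \<alpha>) * fcoef b \<alpha>)"
proof -
  have "(\<integral>p. b p * cnj (tpoly a F p) \<partial>torus_measure)
      = (\<integral>p. (\<Sum>\<alpha>\<in>F. cnj (a \<alpha>) * (b p * cnj (mon \<alpha> p))) \<partial>torus_measure)"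
    by (simp add: tpoly_def sum_distrib_left algebra_simps)
  also have "\<dots> = (\<Sum>\<alpha>\<in>F. \<integral>p. cnj (a \<alpha>) * (b p * cnj (mon \<alpha> p)) \<partial>torus_measure)"
    by (intro Bochner_Integration.integral_sum integrable_mult_right L2_integrable_mult assms L2_mon)
  finally show ?thesis by (simp add: fcoef_def)
qed

text \<open>The partial sum of the Fourier series is orthogonal to the remainder, which gives the squared
distance, and hence the inequality of Bessel.\<close>

lemma L2_dist_tpoly:
  assumes F: "finite F" and b: "b \<in> L2_torus"
  shows "L2_sq (\<lambda>p. b p - tpoly (fcoef b) F p)
    = L2_sq b - (\<Sum>\<alpha>\<in>F. (cmod (fcoef b \<alpha>))\<^sup>2)"
proof -
  define t where "t = tpoly (fcoef b) F"
  define d where "d = (\<lambda>p. b p - t p)"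
  define s where "s = (\<Sum>\<alpha>\<in>F. (cmod (fcoef b \<alpha>))\<^sup>2)"
  have t: "t \<in> L2_torus" unfolding t_def by (rule L2_tpoly)
  have d: "d \<in> L2_torus" unfolding d_def by (rule L2_diff[OF b t])
  have "(\<integral>p. d p * cnj (t p) \<partial>torus_measure) = (\<Sum>\<alpha>\<in>F. cnj (fcoef b \<alpha>) * fcoef d \<alpha>)"
    unfolding t_def by (rule integral_tpoly_right[OF F d])
  also have "\<dots> = 0" unfolding d_def
    by (intro sum.neutral ballI) (simp add: fcoef_diff[OF b t], simp add: t_def fcoef_tpoly F)
  finally have dt: "(\<integral>p. d p * cnj (t p) \<partial>torus_measure) = 0" .
  have bt: "(\<integral>p. b p * cnj (t p) \<partial>torus_measure) = of_real s"
    unfolding t_def integral_tpoly_right[OF F b] s_def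
    by (simp add: complex_norm_square[symmetric] mult.commute)
  have bd: "(\<integral>p. b p * cnj (d p) \<partial>torus_measure) = (\<integral>p. b p * cnj (b p) \<partial>torus_measure) - of_real s"
  proof -
    have "(\<integral>p. b p * cnj (d p) \<partial>torus_measure) = (\<integral>p. b p * cnj (b p) - b p * cnj (t p) \<partial>torus_measure)"
      by (simp add: d_def algebra_simps)
    then show ?thesis using bt L2_integrable_mult[OF b b] L2_integrable_mult[OF b t] by simp
  qed
  have td: "(\<integral>p. t p * cnj (d p) \<partial>torus_measure) = 0"
  proof -
    have "(\<integral>p. t p * cnj (d p) \<partial>torus_measure) = (\<integral>p. cnj (d p * cnj (t p)) \<partial>torus_measure)"
      by (simp add: mult.commute)
    also have "\<dots> = cnj (\<integral>p. d p * cnj (t p) \<partial>torus_measure)"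
      by (rule Bochner_Integration.integral_cnj)
    finally show ?thesis using dt by simp
  qed
  have sq: "complex_of_real (L2_sq h) = (\<integral>p. h p * cnj (h p) \<partial>torus_measure)" for h
    by (simp only: complex_norm_square[symmetric] integral_complex_of_real)
  have "complex_of_real (L2_sq d) = (\<integral>p. b p * cnj (d p) - t p * cnj (d p) \<partial>torus_measure)"
    unfolding sq by (simp add: d_def algebra_simps)
  also have "\<dots> = (\<integral>p. b p * cnj (b p) \<partial>torus_measure) - of_real s"
    using bd td L2_integrable_mult[OF b d] L2_integrable_mult[OF t d] by simp
  also have "\<dots> = of_real (L2_sq b - s)" by (simp add: sq[symmetric])
  finally show ?thesis unfolding of_real_eq_iff d_def t_def s_def .
qed

lemma bessel_torus:
  assumes "finite F" "b \<in> L2_torus"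
  shows "(\<Sum>\<alpha>\<in>F. (cmod (fcoef b \<alpha>))\<^sup>2) \<le> L2_sq b"
  using L2_dist_tpoly[OF assms] Bochner_Integration.integral_nonneg[of torus_measure "\<lambda>p. (cmod (b p - tpoly (fcoef b) F p))\<^sup>2"]
  by simp

lemma parseval_tpoly:
  assumes "finite F"
  shows "L2_sq (\<lambda>p. tpoly a F p) = (\<Sum>\<alpha>\<in>F. (cmod (a \<alpha>))\<^sup>2)"
proof -
  have t: "tpoly (fcoef (tpoly a F)) F = tpoly a F"
    unfolding tpoly_def[of "fcoef _"] by (rule ext, subst tpoly_def[of a F], rule sum.cong) (auto simp: fcoef_tpoly assms)
  show ?thesis using L2_dist_tpoly[OF assms L2_tpoly[of a F]] unfolding t
    by (simp add: fcoef_tpoly assms)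
qed

lemma integral_norm_sq_le:
  assumes "g \<in> L2_torus"
  shows "(\<integral>p. cmod (g p) \<partial>torus_measure)\<^sup>2 \<le> L2_sq g"
proof -
  define c where "c = (\<integral>p. cmod (g p) \<partial>torus_measure)"
  have i1: "integrable torus_measure (\<lambda>p. cmod (g p))"
    using L2_integrable_mult[OF assms L2_const[of 1]] by (auto intro: integrable_norm)
  have i2: "integrable torus_measure (\<lambda>p. (cmod (g p))\<^sup>2)" using assms by (simp add: L2_torus_def)
  have "0 \<le> (\<integral>p. (cmod (g p) - c)\<^sup>2 \<partial>torus_measure)" by (rule Bochner_Integration.integral_nonneg) simp
  also have "\<dots> = (\<integral>p. (cmod (g p))\<^sup>2 - 2 * c * cmod (g p) + c\<^sup>2 \<partial>torus_measure)"
    by (simp add: power2_diff algebra_simps)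
  also have "\<dots> = L2_sq g - 2 * c * c + c\<^sup>2"
    using i1 i2 by (simp add: c_def)
  finally show ?thesis by (simp add: c_def power2_eq_square)
qed

lemma norm_fcoef_sq_le:
  assumes "g \<in> L2_torus"
  shows "(cmod (fcoef g \<alpha>))\<^sup>2 \<le> L2_sq g"
  using bessel_torus[where F="{\<alpha>}", OF _ assms] by simp

text \<open>A single Fourier coefficient is bounded by the \<open>L\<^sup>2\<close> norm, so it passes to \<open>L\<^sup>2\<close> limits.
The index set \<open>J\<close> is arbitrary because boundary functions of Hardy functions come with sums over
\<^const>\<open>index_set\<close>.\<close>

lemma fcoef_of_L2_limit:
  assumes b: "b \<in> L2_torus"
    and lim: "((\<lambda>F. L2_sq (\<lambda>p. b p - tpoly a F p)) \<longlongrightarrow> 0) (finite_subsets_at_top J)"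
  shows "fcoef b \<alpha> = (if \<alpha> \<in> J then a \<alpha> else 0)"
proof -
  define v where "v = (if \<alpha> \<in> J then a \<alpha> else 0)"
  have "\<forall>\<^sub>F F in finite_subsets_at_top J. (cmod (fcoef b \<alpha> - v))\<^sup>2 \<le> L2_sq (\<lambda>p. b p - tpoly a F p)"
    unfolding eventually_finite_subsets_at_top
  proof (intro exI[of _ "{\<alpha>} \<inter> J"] conjI allI impI)
    fix Y assume Y: "finite Y \<and> {\<alpha>} \<inter> J \<subseteq> Y \<and> Y \<subseteq> J"
    have "fcoef (\<lambda>p. b p - tpoly a Y p) \<alpha> = fcoef b \<alpha> - v"
      using Y by (simp add: fcoef_diff[OF b L2_tpoly] fcoef_tpoly v_def) auto
    then show "(cmod (fcoef b \<alpha> - v))\<^sup>2 \<le> L2_sq (\<lambda>p. b p - tpoly a Y p)"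
      using norm_fcoef_sq_le[OF L2_diff[OF b L2_tpoly[of a Y]], of \<alpha>] by simp
  qed auto
  then have "(cmod (fcoef b \<alpha> - v))\<^sup>2 \<le> 0"
    by (rule tendsto_lowerbound[OF lim]) simp
  then show ?thesis by (simp add: v_def)
qed

section \<open>Uniqueness of Fourier coefficients\<close>

lemma measurable_cnj [measurable]: "cnj \<in> borel_measurable borel"
  by (intro borel_measurable_continuous_onI continuous_intros)

text \<open>Functions that should turn out to vanish almost everywhere. Stability of this class under
multiplication by polynomials is what makes the proof of uniqueness work.\<close>

definition null_coefs :: "(complex \<times> complex \<Rightarrow> complex) \<Rightarrow> bool" where
  "null_coefs h \<longleftrightarrow> h \<in> borel_measurable borel \<and> integrable torus_measure h \<and> (\<forall>\<alpha>. fcoef h \<alpha> = 0)"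

lemma integrable_mon_mult:
  assumes [measurable]: "h \<in> borel_measurable borel" and i: "integrable torus_measure h"
  shows "integrable torus_measure (\<lambda>p. mon \<beta> p * h p)"
proof (rule Bochner_Integration.integrable_bound[OF i])
  show "(\<lambda>p. mon \<beta> p * h p) \<in> borel_measurable torus_measure" by measurable
  show "AE p in torus_measure. norm (mon \<beta> p * h p) \<le> norm (h p)"
    using AE_norm_mon[of \<beta>] by eventually_elim (simp add: norm_mult)
qed

lemma integrable_fcoef:
  assumes [measurable]: "h \<in> borel_measurable borel" and i: "integrable torus_measure h"
  shows "integrable torus_measure (\<lambda>p. h p * cnj (mon \<beta> p))"
proof (rule Bochner_Integration.integrable_bound[OF i])
  show "(\<lambda>p. h p * cnj (mon \<beta> p)) \<in> borel_measurable torus_measure" by measurable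
  show "AE p in torus_measure. norm (h p * cnj (mon \<beta> p)) \<le> norm (h p)"
    using AE_norm_mon[of \<beta>] by eventually_elim (simp add: norm_mult)
qed

lemma fcoef_mon_mult:
  assumes [measurable]: "h \<in> borel_measurable borel"
  shows "fcoef (\<lambda>p. mon \<beta> p * h p) \<alpha> = fcoef h (\<alpha> - \<beta>)"
  unfolding fcoef_def
proof (rule integral_cong_AE)
  show "(\<lambda>p. mon \<beta> p * h p * cnj (mon \<alpha> p)) \<in> borel_measurable torus_measure" by measurable
  show "(\<lambda>p. h p * cnj (mon (\<alpha> - \<beta>) p)) \<in> borel_measurable torus_measure" by measurable
  show "AE p in torus_measure. mon \<beta> p * h p * cnj (mon \<alpha> p) = h p * cnj (mon (\<alpha> - \<beta>) p)"
    using AE_torus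
  proof eventually_elim
    case (elim p)
    then have "fst p \<noteq> 0" "snd p \<noteq> 0" by auto
    then show ?case using elim mon_add[of p \<beta> "-\<alpha>"] by (simp add: cnj_mon)
  qed
qed

lemma null_coefs_add: "null_coefs g \<Longrightarrow> null_coefs h \<Longrightarrow> null_coefs (\<lambda>p. g p + h p)"
  unfolding null_coefs_def fcoef_def using integrable_fcoef by (auto simp: distrib_right)
lemma null_coefs_cmult: "null_coefs h \<Longrightarrow> null_coefs (\<lambda>p. k * h p)"
  unfolding null_coefs_def fcoef_def by (auto simp: mult.assoc)
lemma null_coefs_mon: "null_coefs h \<Longrightarrow> null_coefs (\<lambda>p. mon \<beta> p * h p)"
  unfolding null_coefs_def
  by (simp add: fcoef_mon_mult integrable_mon_mult borel_measurable_times del: split_paired_All)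
lemma null_coefs_cong:
  assumes h: "null_coefs h" and [measurable]: "g \<in> borel_measurable borel"
    and eq: "AE p in torus_measure. g p = h p"
  shows "null_coefs g"
proof -
  have [measurable]: "h \<in> borel_measurable borel" using h by (simp add: null_coefs_def)
  have "integrable torus_measure g"
    using h integrable_cong_AE[of g torus_measure h] eq by (simp add: null_coefs_def)
  moreover have "fcoef g \<alpha> = fcoef h \<alpha>" for \<alpha>
    unfolding fcoef_def
  proof (rule integral_cong_AE)
    show "(\<lambda>p. g p * cnj (mon \<alpha> p)) \<in> borel_measurable torus_measure" by measurable
    show "(\<lambda>p. h p * cnj (mon \<alpha> p)) \<in> borel_measurable torus_measure" by measurable
    show "AE p in torus_measure. g p * cnj (mon \<alpha> p) = h p * cnj (mon \<alpha> p)"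
      using eq by eventually_elim simp
  qed
  ultimately show ?thesis using h by (simp add: null_coefs_def)
qed

lemma measurable_continuous_real: "continuous_on UNIV (g :: complex \<times> complex \<Rightarrow> real) \<Longrightarrow> g \<in> borel_measurable borel"
  by (rule borel_measurable_continuous_onI)

text \<open>On the torus, real and imaginary part of a coordinate are linear combinations of the coordinate
and its inverse, and multiplication by a monomial only shifts the Fourier coefficients.\<close>

lemma null_coefs_linear:
  assumes f: "bounded_linear (f :: complex \<times> complex \<Rightarrow> real)" and h: "null_coefs h"
  shows "null_coefs (\<lambda>p. of_real (f p) * h p)"
proof (rule null_coefs_cong)
  define H where "H = (\<lambda>p.
     (of_real (f (1, 0)) / 2 + of_real (f (\<i>, 0)) / (2 * \<i>)) * (mon (1, 0) p * h p)
     + ((of_real (f (1, 0)) / 2 - of_real (f (\<i>, 0)) / (2 * \<i>)) * (mon (-1, 0) p * h p)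
     + ((of_real (f (0, 1)) / 2 + of_real (f (0, \<i>)) / (2 * \<i>)) * (mon (0, 1) p * h p)
     + (of_real (f (0, 1)) / 2 - of_real (f (0, \<i>)) / (2 * \<i>)) * (mon (0, -1) p * h p))))"
  show "null_coefs H" unfolding H_def
    by (intro null_coefs_add null_coefs_cmult null_coefs_mon h)
  have [measurable]: "h \<in> borel_measurable borel" using h by (simp add: null_coefs_def)
  have [measurable]: "f \<in> borel_measurable borel"
    by (intro measurable_continuous_real linear_continuous_on f)
  show "(\<lambda>p. complex_of_real (f p) * h p) \<in> borel_measurable borel" by measurable
  show "AE p in torus_measure. complex_of_real (f p) * h p = H p"
    using AE_torus
  proof eventually_elim
    case (elim p)
    obtain z w where p: "p = (z, w)" by force
    have zw: "cmod z = 1" "cmod w = 1" using elim p by auto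
    interpret f: bounded_linear f by (rule f)
    have inv: "inverse x = cnj x" if "cmod x = 1" for x
      using that by (metis complex_norm_square inverse_unique of_real_1 power_one)
    have "(z, w) = Re z *\<^sub>R (1, 0) + (Im z *\<^sub>R (\<i>, 0) + (Re w *\<^sub>R (0, 1) + Im w *\<^sub>R (0, \<i>)))"
      by (simp add: complex_eq_iff)
    then have "f (z, w) = f (Re z *\<^sub>R (1, 0) + (Im z *\<^sub>R (\<i>, 0) + (Re w *\<^sub>R (0, 1) + Im w *\<^sub>R (0, \<i>))))"
      by (rule arg_cong)
    also have "\<dots> = Re z * f (1, 0) + (Im z * f (\<i>, 0) + (Re w * f (0, 1) + Im w * f (0, \<i>)))"
      by (simp only: f.add f.scaleR real_scaleR_def)
    finally have fzw: "f (z, w) = Re z * f (1, 0) + (Im z * f (\<i>, 0) + (Re w * f (0, 1) + Im w * f (0, \<i>)))" .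
    have m: "mon (1, 0) p = z" "mon (0, 1) p = w" "mon (-1, 0) p = cnj z" "mon (0, -1) p = cnj w"
      using zw by (auto simp: mon_def p inv power_int_minus)
    have re: "of_real (Re x) = (x + cnj x) / 2" "of_real (Im x) = (x - cnj x) / (2 * \<i>)" for x
      by (auto simp: complex_eq_iff)
    have fp: "complex_of_real (f p) = of_real (f (1, 0)) * ((z + cnj z) / 2) + (of_real (f (\<i>, 0)) * ((z - cnj z) / (2 * \<i>))
       + (of_real (f (0, 1)) * ((w + cnj w) / 2) + of_real (f (0, \<i>)) * ((w - cnj w) / (2 * \<i>))))"
      unfolding p fzw re[symmetric] by (simp add: mult.commute)
    show ?case unfolding H_def m fp by (simp add: field_simps)
  qed
qed

lemma null_coefs_polynomial:
  fixes f :: "complex \<times> complex \<Rightarrow> real"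
  assumes "real_polynomial_function f"
  shows "null_coefs h \<Longrightarrow> null_coefs (\<lambda>p. of_real (f p) * h p)"
  using assms
proof (induction f arbitrary: h)
  case (linear f)
  then show ?case by (intro null_coefs_linear)
next
  case (const c)
  then show ?case by (intro null_coefs_cmult)
next
  case (add f g)
  from null_coefs_add[OF add.IH(1)[OF add.prems] add.IH(2)[OF add.prems]]
  show ?case by (simp add: distrib_right)
next
  case (mult f g)
  from mult.IH(1)[OF mult.IH(2)[OF mult.prems]]
  show ?case by (simp add: mult.assoc)
qed

text \<open>The integral against a polynomial is the Fourier coefficient at \<open>0\<close> of the product, hence \<open>0\<close>, and
by the theorem of Stone and Weierstrass polynomials are uniformly dense in the continuous functions
on the torus.\<close>

lemma null_coefs_integral_continuous:
  fixes g :: "complex \<times> complex \<Rightarrow> real"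
  assumes h: "null_coefs h" and g: "continuous_on UNIV g" and i: "integrable torus_measure (\<lambda>p. of_real (g p) * h p)"
  shows "(\<integral>p. of_real (g p) * h p \<partial>torus_measure) = 0"
proof -
  define K where "K = sphere (0::complex) 1 \<times> sphere (0::complex) 1"
  have K: "compact K" unfolding K_def by (intro compact_Times compact_sphere)
  have hm [measurable]: "h \<in> borel_measurable borel" and hi: "integrable torus_measure h"
    using h by (auto simp: null_coefs_def)
  define B where "B = (\<integral>p. cmod (h p) \<partial>torus_measure)"
  have B: "0 \<le> B" unfolding B_def by (rule Bochner_Integration.integral_nonneg) simp
  have "cmod (\<integral>p. of_real (g p) * h p \<partial>torus_measure) \<le> e * B" if e: "e > 0" for e
  proof -
    obtain f where f: "real_polynomial_function f" "\<And>x. x \<in> K \<Longrightarrow> \<bar>g x - f x\<bar> < e"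
      using Stone_Weierstrass_real_polynomial_function[OF K continuous_on_subset[OF g] e] by blast
    have n: "null_coefs (\<lambda>p. of_real (f p) * h p)" by (rule null_coefs_polynomial[OF f(1) h])
    then have "fcoef (\<lambda>p. of_real (f p) * h p) 0 = 0" unfolding null_coefs_def by blast
    then have z: "(\<integral>p. of_real (f p) * h p \<partial>torus_measure) = 0"
      by (simp add: fcoef_def)
    have fi: "integrable torus_measure (\<lambda>p. of_real (f p) * h p)" using n by (simp add: null_coefs_def)
    have "(\<integral>p. of_real (g p) * h p \<partial>torus_measure) = (\<integral>p. of_real (g p) * h p - of_real (f p) * h p \<partial>torus_measure)"
      using z i fi by simp
    also have "cmod \<dots> \<le> (\<integral>p. cmod (of_real (g p) * h p - of_real (f p) * h p) \<partial>torus_measure)"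
      by (rule integral_norm_bound)
    also have "\<dots> \<le> (\<integral>p. e * cmod (h p) \<partial>torus_measure)"
    proof (rule integral_mono_AE)
      show "integrable torus_measure (\<lambda>p. cmod (of_real (g p) * h p - of_real (f p) * h p))"
        by (intro integrable_norm Bochner_Integration.integrable_diff i fi)
      show "integrable torus_measure (\<lambda>p. e * cmod (h p))" using hi by simp
      show "AE p in torus_measure. cmod (of_real (g p) * h p - of_real (f p) * h p) \<le> e * cmod (h p)"
        using AE_torus
      proof eventually_elim
        case (elim p)
        then have "p \<in> K" by (cases p) (auto simp: K_def)
        have "cmod (of_real (g p) * h p - of_real (f p) * h p) = cmod (of_real (g p - f p) * h p)"
          by (simp add: left_diff_distrib)
        also have "\<dots> = \<bar>g p - f p\<bar> * cmod (h p)" by (simp only: norm_mult norm_of_real)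
        also have "\<dots> \<le> e * cmod (h p)" using f(2)[OF \<open>p \<in> K\<close>] by (intro mult_right_mono) auto
        finally show ?case .
      qed
    qed
    also have "\<dots> = e * B" by (simp add: B_def)
    finally show ?thesis .
  qed
  then have "cmod (\<integral>p. of_real (g p) * h p \<partial>torus_measure) \<le> 0 * B"
    by (intro tendsto_lowerbound[where F="at_right 0" and f="\<lambda>e. e * B"] tendsto_intros)
      (auto simp: eventually_at_right_less elim!: eventually_mono intro!: eventually_at_rightI[of 0 1])
  then show ?thesis by simp
qed

text \<open>The indicator of a closed set is a bounded pointwise limit of continuous functions, so the
integral over every closed set vanishes; closed sets generate the Borel sets and are stable under
intersection, so the integral over every Borel set vanishes.\<close>

lemma null_coefs_AE_zero:
  assumes h: "null_coefs h"
  shows "AE p in torus_measure. h p = 0"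
proof (rule torus.density_zero)
  have hm [measurable]: "h \<in> borel_measurable borel" and hi: "integrable torus_measure h"
    using h by (auto simp: null_coefs_def)
  show "integrable torus_measure h" by (rule hi)
  have mi: "integrable torus_measure (\<lambda>p. indicat_real A p *\<^sub>R h p)" if "A \<in> sets borel" for A
    by (rule integrable_mult_indicator) (use that hi in auto)
  fix A assume "A \<in> sets torus_measure"
  then have AS: "A \<in> sigma_sets UNIV (Collect closed)" by (simp add: borel_eq_closed)
  have cl: "Int_stable (Collect (closed :: (complex \<times> complex) set \<Rightarrow> bool))" "Collect (closed :: (complex \<times> complex) set \<Rightarrow> bool) \<subseteq> Pow UNIV"
    by (auto simp: Int_stable_def)
  from cl AS show "set_lebesgue_integral torus_measure A h = 0"
  proof (induction A rule: sigma_sets_induct_disjoint)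
    case (basic C)
    then have C: "closed C" by simp
    show ?case
    proof (cases "C = {}")
      case False
      define g where "g = (\<lambda>k p. max 0 (1 - real k * infdist p C))"
      have gc: "continuous_on UNIV (g k)" for k unfolding g_def
        by (intro continuous_intros)
      have [measurable]: "g k \<in> borel_measurable borel" for k by (rule measurable_continuous_real[OF gc])
      have g01: "0 \<le> g k p" "g k p \<le> 1" for k p by (auto simp: g_def infdist_nonneg)
      have gi: "integrable torus_measure (\<lambda>p. of_real (g k p) * h p)" for k
        by (rule Bochner_Integration.integrable_bound[OF hi])
          (use g01 in \<open>auto simp: norm_mult intro!: mult_left_le_one_le\<close>)
      have "(\<lambda>k. \<integral>p. of_real (g k p) * h p \<partial>torus_measure) \<longlonglongrightarrow> (\<integral>p. indicat_real C p *\<^sub>R h p \<partial>torus_measure)"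
      proof (rule integral_dominated_convergence)
        show "(\<lambda>p. indicat_real C p *\<^sub>R h p) \<in> borel_measurable torus_measure"
          using mi[of C] C by (auto dest: borel_measurable_integrable)
        show "(\<lambda>p. of_real (g k p) * h p) \<in> borel_measurable torus_measure" for k by measurable
        show "integrable torus_measure (\<lambda>p. cmod (h p))" using hi by simp
        show "AE p in torus_measure. norm (of_real (g k p) * h p) \<le> cmod (h p)" for k
          using g01 by (auto simp: norm_mult intro!: mult_left_le_one_le)
        have "(\<lambda>k. of_real (g k p) * h p) \<longlonglongrightarrow> indicat_real C p *\<^sub>R h p" for p
        proof (cases "p \<in> C")
          case True
          then have "g k p = 1" for k by (simp add: g_def)
          then show ?thesis using True by simp
        next
          case False
          then have pos: "infdist p C > 0"
            using in_closed_iff_infdist_zero[OF C \<open>C \<noteq> {}\<close>, of p] infdist_nonneg[of p C] by linarith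
          obtain N where N: "1 / infdist p C \<le> real N" using real_arch_simple by blast
          have "g k p = 0" if "k \<ge> N" for k
          proof -
            have "1 / infdist p C \<le> real k" using N that by (meson of_nat_mono order_trans)
            then show ?thesis using pos by (simp add: g_def field_simps max_def)
          qed
          then have "eventually (\<lambda>k. of_real (g k p) * h p = 0) sequentially"
            by (auto simp: eventually_sequentially)
          then show ?thesis using False by (simp add: tendsto_eventually)
        qed
        then show "AE p in torus_measure. (\<lambda>k. of_real (g k p) * h p) \<longlonglongrightarrow> indicat_real C p *\<^sub>R h p" by simp
      qed
      then have "(\<integral>p. indicat_real C p *\<^sub>R h p \<partial>torus_measure) = 0"
        using null_coefs_integral_continuous[OF h gc gi] by (simp add: LIMSEQ_const_iff)
      then show ?thesis by (simp add: set_lebesgue_integral_def)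
    qed (simp add: set_lebesgue_integral_def)
  next
    case empty
    then show ?case by (simp add: set_lebesgue_integral_def)
  next
    case (compl A)
    then have A: "A \<in> sets borel" by (simp add: borel_eq_closed)
    have "(\<integral>p. indicat_real (UNIV - A) p *\<^sub>R h p \<partial>torus_measure) = (\<integral>p. h p - indicat_real A p *\<^sub>R h p \<partial>torus_measure)"
      by (intro Bochner_Integration.integral_cong) (auto split: split_indicator)
    also have "\<dots> = (\<integral>p. h p \<partial>torus_measure) - (\<integral>p. indicat_real A p *\<^sub>R h p \<partial>torus_measure)"
      by (rule Bochner_Integration.integral_diff[OF hi mi[OF A]])
    also have "(\<integral>p. h p \<partial>torus_measure) = fcoef h 0" by (simp add: fcoef_def)
    also have "\<dots> = 0" using h unfolding null_coefs_def by blast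
    finally show ?case using compl.IH by (simp add: set_lebesgue_integral_def)
  next
    case (union A)
    then have A: "A i \<in> sets torus_measure" for i by (auto simp: borel_eq_closed)
    have "set_lebesgue_integral torus_measure (\<Union>i. A i) h = (\<Sum>i. set_lebesgue_integral torus_measure (A i) h)"
      using A union.hyps by (intro lebesgue_integral_countable_add)
        (auto simp: disjoint_family_on_def set_integrable_def intro!: mi sets.countable_UN)
    then show ?case using union.IH by simp
  qed
qed

lemma L2_fcoef_unique:
  assumes "b \<in> L2_torus" "c \<in> L2_torus" "\<And>\<alpha>. fcoef b \<alpha> = fcoef c \<alpha>"
  shows "AE p in torus_measure. b p = c p"
proof -
  have d: "(\<lambda>p. b p - c p) \<in> L2_torus" by (rule L2_diff[OF assms(1,2)])
  have "null_coefs (\<lambda>p. b p - c p)"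
    unfolding null_coefs_def using d L2_integrable_mult[OF d L2_const[of 1]] assms
    by (auto simp: L2_measurable fcoef_diff)
  from null_coefs_AE_zero[OF this] show ?thesis by simp
qed

section \<open>The theorem of Riesz and Fischer and the identity of Parseval\<close>

text \<open>The difference is a trigonometric polynomial whose coefficients are those of \<open>a\<close>, up to sign, on the
symmetric difference.\<close>

lemma norm_tpoly_diff:
  assumes "finite A" "finite F"
  shows "L2_sq (\<lambda>p. tpoly a A p - tpoly a F p)
     = (\<Sum>\<alpha>\<in>A - F. (cmod (a \<alpha>))\<^sup>2) + (\<Sum>\<alpha>\<in>F - A. (cmod (a \<alpha>))\<^sup>2)"
proof -
  define c where "c = (\<lambda>\<alpha>. if \<alpha> \<in> A then a \<alpha> else - a \<alpha>)"
  have eq: "tpoly a A p - tpoly a F p = tpoly c ((A - F) \<union> (F - A)) p" for p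
  proof -
    have A: "tpoly a A p = (\<Sum>\<alpha>\<in>A \<inter> F. a \<alpha> * mon \<alpha> p) + (\<Sum>\<alpha>\<in>A - F. a \<alpha> * mon \<alpha> p)"
      unfolding tpoly_def by (rule sum.Int_Diff[OF assms(1)])
    have F: "tpoly a F p = (\<Sum>\<alpha>\<in>F \<inter> A. a \<alpha> * mon \<alpha> p) + (\<Sum>\<alpha>\<in>F - A. a \<alpha> * mon \<alpha> p)"
      unfolding tpoly_def by (rule sum.Int_Diff[OF assms(2)])
    have "tpoly c ((A - F) \<union> (F - A)) p = (\<Sum>\<alpha>\<in>A - F. c \<alpha> * mon \<alpha> p) + (\<Sum>\<alpha>\<in>F - A. c \<alpha> * mon \<alpha> p)"
      unfolding tpoly_def by (rule sum.union_disjoint) (use assms in auto)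
    also have "(\<Sum>\<alpha>\<in>A - F. c \<alpha> * mon \<alpha> p) = (\<Sum>\<alpha>\<in>A - F. a \<alpha> * mon \<alpha> p)"
      by (rule sum.cong) (auto simp: c_def)
    also have "(\<Sum>\<alpha>\<in>F - A. c \<alpha> * mon \<alpha> p) = - (\<Sum>\<alpha>\<in>F - A. a \<alpha> * mon \<alpha> p)"
      unfolding sum_negf[symmetric] by (rule sum.cong) (auto simp: c_def)
    finally show ?thesis unfolding A F by (simp add: Int_commute)
  qed
  have "(\<Sum>\<alpha>\<in>(A - F) \<union> (F - A). (cmod (c \<alpha>))\<^sup>2) = (\<Sum>\<alpha>\<in>A - F. (cmod (c \<alpha>))\<^sup>2) + (\<Sum>\<alpha>\<in>F - A. (cmod (c \<alpha>))\<^sup>2)"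
    by (rule sum.union_disjoint) (use assms in auto)
  also have "\<dots> = (\<Sum>\<alpha>\<in>A - F. (cmod (a \<alpha>))\<^sup>2) + (\<Sum>\<alpha>\<in>F - A. (cmod (a \<alpha>))\<^sup>2)"
    by (intro arg_cong2[where f="(+)"] sum.cong) (auto simp: c_def)
  finally show ?thesis unfolding eq using assms by (simp add: parseval_tpoly)
qed

lemma coef_sum_tendsto: "((\<lambda>F. \<Sum>\<alpha>\<in>F. (cmod (coef a \<alpha>))\<^sup>2) \<longlongrightarrow> (norm a)\<^sup>2) (finite_subsets_at_top UNIV)"
  using has_sum_infsum[OF square_summable_coef[of a]] unfolding has_sum_def norm_ell2_sq .

text \<open>Along finite sets that exhaust the norm of \<open>a\<close> geometrically fast, the partial sums have
summable increments in \<open>L\<^sup>1\<close>, hence converge almost everywhere. The lemma of Fatou bounds the distance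
from the limit to any partial sum.\<close>

lemma riesz_fischer:
  fixes a :: "(int \<times> int) ell2"
  shows "\<exists>b\<in>L2_torus. \<forall>F. finite F \<longrightarrow>
    L2_sq (\<lambda>p. b p - tpoly (coef a) F p) \<le> (norm a)\<^sup>2 - (\<Sum>\<alpha>\<in>F. (cmod (coef a \<alpha>))\<^sup>2)"
proof -
  define s where "s = (\<lambda>F. \<Sum>\<alpha>\<in>F. (cmod (coef a \<alpha>))\<^sup>2)"
  define N where "N = (norm a)\<^sup>2"
  have s_le: "s F \<le> N" if "finite F" for F unfolding s_def N_def by (rule sum_coef_sq_le[OF that])
  have s_mono: "s F \<le> s G" if "F \<subseteq> G" "finite G" for F G unfolding s_def
    using that by (intro sum_mono2) auto
  \<comment> \<open>What lies outside a finite set is controlled by what that set leaves over.\<close>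
  have s_diff: "s (F - G) \<le> N - s G" if "finite F" "finite G" for F G
  proof -
    have "s (F - G) + s G = s ((F - G) \<union> G)" unfolding s_def
      by (rule sum.union_disjoint[symmetric]) (use that in auto)
    then show ?thesis using s_le[of "(F - G) \<union> G"] that by simp
  qed
  have "\<exists>F. finite F \<and> N - (1/4)^n < s F" for n
  proof -
    have "\<forall>\<^sub>F F in finite_subsets_at_top UNIV. N - (1/4)^n < s F"
      using coef_sum_tendsto[of a] unfolding N_def s_def by (rule order_tendstoD) simp
    then show ?thesis unfolding eventually_finite_subsets_at_top by blast
  qed
  then obtain G where G: "\<And>n::nat. finite (G n)" "\<And>n. N - (1/4)^n < s (G n)" by metis
  \<comment> \<open>Increasing sets make the increments orthogonal to the earlier partial sums.\<close>
  define A where "A = (\<lambda>n. \<Union>k\<le>n. G k)"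
  have A1: "finite (A n)" "G n \<subseteq> A n" for n
    using G(1) unfolding A_def by auto
  have A: "finite (A n)" "N - (1/4)^n < s (A n)" for n
    using A1(1) s_mono[OF A1(2) A1(1), of n] G(2)[of n] by auto
  have A_Suc: "A n - A (Suc n) = {}" for n unfolding A_def by (auto simp: atMost_Suc)
  define g where "g = (\<lambda>n. tpoly (coef a) (A n))"
  have gL: "g n \<in> L2_torus" for n unfolding g_def by (rule L2_tpoly)
  have gm [measurable]: "g n \<in> borel_measurable borel" for n by (rule L2_measurable[OF gL])
  have step: "(\<integral>p. cmod (g (Suc n) p - g n p) \<partial>torus_measure) \<le> (1/2)^n" for n
  proof -
    have "(\<integral>p. cmod (g (Suc n) p - g n p) \<partial>torus_measure)\<^sup>2 \<le> L2_sq (\<lambda>p. g (Suc n) p - g n p)"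
      by (rule integral_norm_sq_le[OF L2_diff[OF gL gL]])
    also have "\<dots> = s (A (Suc n) - A n)"
      unfolding g_def norm_tpoly_diff[OF A(1) A(1)] A_Suc s_def by simp
    also have "\<dots> \<le> (1/4)^n" using s_diff[OF A(1) A(1), of "Suc n" n] A(2)[of n] by linarith
    also have "\<dots> = ((1/2)^n)\<^sup>2" by (simp add: power2_eq_square flip: power_mult_distrib)
    finally show ?thesis by (rule power2_le_imp_le) simp
  qed
  have "(\<integral>\<^sup>+p. (\<Sum>n. ennreal (cmod (g (Suc n) p - g n p))) \<partial>torus_measure)
      = (\<Sum>n. \<integral>\<^sup>+p. ennreal (cmod (g (Suc n) p - g n p)) \<partial>torus_measure)"
    by (rule nn_integral_suminf) measurable
  also have "\<dots> \<le> (\<Sum>n. ennreal ((1/2)^n))"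
  proof (rule suminf_le)
    fix n
    have "integrable torus_measure (\<lambda>p. g (Suc n) p - g n p)"
      using L2_integrable_mult[OF L2_diff[OF gL gL] L2_const[of 1]] by simp
    then have "(\<integral>\<^sup>+p. ennreal (cmod (g (Suc n) p - g n p)) \<partial>torus_measure)
       = ennreal (\<integral>p. cmod (g (Suc n) p - g n p) \<partial>torus_measure)"
      by (intro nn_integral_eq_integral) auto
    then show "(\<integral>\<^sup>+p. ennreal (cmod (g (Suc n) p - g n p)) \<partial>torus_measure) \<le> ennreal ((1/2)^n)"
      using step[of n] by (simp add: ennreal_leI)
  qed auto
  also have "\<dots> = ennreal (\<Sum>n. (1/2)^n)" by (rule suminf_ennreal2) (auto intro: summable_geometric)
  also have "\<dots> < \<infinity>" by simp
  finally have "AE p in torus_measure. (\<Sum>n. ennreal (cmod (g (Suc n) p - g n p))) \<noteq> \<infinity>"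
    by (intro nn_integral_PInf_AE) auto
  then have conv: "AE p in torus_measure. convergent (\<lambda>n. g n p)"
  proof eventually_elim
    case (elim p)
    then have "summable (\<lambda>n. cmod (g (Suc n) p - g n p))"
      by (intro summable_suminf_not_top) auto
    then have "summable (\<lambda>n. g (Suc n) p - g n p)" by (rule summable_norm_cancel)
    then have "convergent (\<lambda>n. \<Sum>i<n. g (Suc i) p - g i p)" by (simp add: summable_iff_convergent)
    then have "convergent (\<lambda>n. g n p - g 0 p)" by (simp add: sum_lessThan_telescope[of "\<lambda>n. g n p"])
    then have "convergent (\<lambda>n. (g n p - g 0 p) + g 0 p)" by (intro convergent_add convergent_const)
    then show ?case by simp
  qed
  define b where "b = (\<lambda>p. lim (\<lambda>n. g n p))"
  have bm [measurable]: "b \<in> borel_measurable borel" unfolding b_def by measurable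
  have lim: "AE p in torus_measure. (\<lambda>n. g n p) \<longlonglongrightarrow> b p"
    using conv by eventually_elim (simp add: b_def convergent_LIMSEQ_iff)
  have dist: "(\<integral>\<^sup>+p. ennreal ((cmod (b p - tpoly (coef a) F p))\<^sup>2) \<partial>torus_measure) \<le> ennreal (N - s F)"
    if F: "finite F" for F
  proof -
    have [measurable]: "tpoly (coef a) F \<in> borel_measurable borel" by (rule L2_measurable[OF L2_tpoly])
    have "(\<integral>\<^sup>+p. ennreal ((cmod (b p - tpoly (coef a) F p))\<^sup>2) \<partial>torus_measure)
      = (\<integral>\<^sup>+p. liminf (\<lambda>n. ennreal ((cmod (g n p - tpoly (coef a) F p))\<^sup>2)) \<partial>torus_measure)"
    proof (rule nn_integral_cong_AE)
      show "AE p in torus_measure. ennreal ((cmod (b p - tpoly (coef a) F p))\<^sup>2)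
        = liminf (\<lambda>n. ennreal ((cmod (g n p - tpoly (coef a) F p))\<^sup>2))"
        using lim
      proof eventually_elim
        case (elim p)
        then have "(\<lambda>n. ennreal ((cmod (g n p - tpoly (coef a) F p))\<^sup>2)) \<longlonglongrightarrow> ennreal ((cmod (b p - tpoly (coef a) F p))\<^sup>2)"
          by (intro tendsto_intros)
        then show ?case using lim_imp_Liminf trivial_limit_sequentially by metis
      qed
    qed
    also have "\<dots> \<le> liminf (\<lambda>n. \<integral>\<^sup>+p. ennreal ((cmod (g n p - tpoly (coef a) F p))\<^sup>2) \<partial>torus_measure)"
      by (rule nn_integral_liminf) measurable
    also have "\<dots> \<le> liminf (\<lambda>n. ennreal (N - s F + (1/4)^n))"
    proof (rule Liminf_mono, rule always_eventually, rule allI)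
      fix n
      have d: "(\<lambda>p. g n p - tpoly (coef a) F p) \<in> L2_torus" by (rule L2_diff[OF gL L2_tpoly])
      have "L2_sq (\<lambda>p. g n p - tpoly (coef a) F p) = s (A n - F) + s (F - A n)"
        unfolding g_def s_def by (rule norm_tpoly_diff[OF A(1) F])
      also have "\<dots> \<le> N - s F + (1/4)^n"
        using s_diff[OF A(1) F, of n] s_diff[OF F A(1), of n] A(2)[of n] by linarith
      finally show "(\<integral>\<^sup>+p. ennreal ((cmod (g n p - tpoly (coef a) F p))\<^sup>2) \<partial>torus_measure) \<le> ennreal (N - s F + (1/4)^n)"
        using d by (subst nn_integral_eq_integral) (auto simp: L2_torus_def intro: ennreal_leI)
    qed
    also have "\<dots> = ennreal (N - s F)"
    proof (rule lim_imp_Liminf)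
      have "(\<lambda>n. ennreal (N - s F + (1/4)^n)) \<longlonglongrightarrow> ennreal (N - s F + 0)"
        by (intro tendsto_intros LIMSEQ_power_zero) auto
      then show "(\<lambda>n. ennreal (N - s F + (1/4)^n)) \<longlonglongrightarrow> ennreal (N - s F)" by simp
    qed simp
    finally show ?thesis .
  qed
  have bL: "b \<in> L2_torus"
    unfolding L2_torus_def using dist[of "{}"] bm
    by (auto simp: tpoly_def integrable_iff_bounded less_top[symmetric] top_unique)
  have "L2_sq (\<lambda>p. b p - tpoly (coef a) F p) \<le> N - s F" if "finite F" for F
  proof -
    have "ennreal (L2_sq (\<lambda>p. b p - tpoly (coef a) F p)) \<le> ennreal (N - s F)"
      using dist[OF that] L2_diff[OF bL L2_tpoly[of "coef a" F]]
      by (subst nn_integral_eq_integral[symmetric]) (auto simp: L2_torus_def)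
    then show ?thesis using s_le[OF that] by simp
  qed
  then show ?thesis using bL unfolding N_def s_def by blast
qed

text \<open>For families vanishing off \<^const>\<open>index_set\<close> this describes the boundary functions of a Hardy function.
Prescribing the Fourier coefficients instead of the limit of partial sums makes linearity
and compatibility with shifts immediate; convergence of the partial sums is recovered in
\<open>boundary_tendsto\<close>.\<close>

definition boundary :: "(int \<times> int) ell2 \<Rightarrow> (complex \<times> complex \<Rightarrow> complex) \<Rightarrow> bool" where
  "boundary a b \<longleftrightarrow> b \<in> L2_torus \<and> (\<forall>\<alpha>. fcoef b \<alpha> = coef a \<alpha>)"

text \<open>Only the function built by Riesz and Fischer is known at this point to have the right norm.
Uniqueness of Fourier coefficients transfers this to every boundary function of \<open>a\<close>.\<close>

lemma parseval_for_some_boundary: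
  "\<exists>b. boundary a b \<and> L2_sq b = (norm a)\<^sup>2"
proof -
  obtain b where b: "b \<in> L2_torus" and d: "\<And>F. finite F \<Longrightarrow>
    L2_sq (\<lambda>p. b p - tpoly (coef a) F p) \<le> (norm a)\<^sup>2 - (\<Sum>\<alpha>\<in>F. (cmod (coef a \<alpha>))\<^sup>2)"
    using riesz_fischer by blast
  have "((\<lambda>F. L2_sq (\<lambda>p. b p - tpoly (coef a) F p)) \<longlongrightarrow> 0) (finite_subsets_at_top UNIV)"
  proof (rule tendsto_sandwich[where f="\<lambda>_. 0"])
    show "((\<lambda>F. (norm a)\<^sup>2 - (\<Sum>\<alpha>\<in>F. (cmod (coef a \<alpha>))\<^sup>2)) \<longlongrightarrow> 0) (finite_subsets_at_top UNIV)"
      using tendsto_diff[OF tendsto_const coef_sum_tendsto[of a], of "(norm a)\<^sup>2"] by simp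
    show "\<forall>\<^sub>F F in finite_subsets_at_top UNIV. L2_sq (\<lambda>p. b p - tpoly (coef a) F p) \<le> (norm a)\<^sup>2 - (\<Sum>\<alpha>\<in>F. (cmod (coef a \<alpha>))\<^sup>2)"
      by (rule eventually_finite_subsets_at_top_weakI) (rule d)
    show "\<forall>\<^sub>F F in finite_subsets_at_top UNIV. 0 \<le> L2_sq (\<lambda>p. b p - tpoly (coef a) F p)"
      by (rule always_eventually) (auto intro: Bochner_Integration.integral_nonneg)
  qed simp
  from fcoef_of_L2_limit[OF b this] have f: "fcoef b \<alpha> = coef a \<alpha>" for \<alpha> by simp
  have "L2_sq b \<le> (norm a)\<^sup>2" using d[of "{}"] by (simp add: tpoly_def)
  moreover have "(norm a)\<^sup>2 \<le> L2_sq b"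
    using bessel_torus[OF _ b] by (intro norm_ell2_sq_le) (simp add: f)
  ultimately show ?thesis using b f by (auto simp: boundary_def)
qed

lemma boundary_exists: "\<exists>b. boundary a b" using parseval_for_some_boundary by blast

lemma boundary_AE_unique: "boundary a b \<Longrightarrow> boundary a c \<Longrightarrow> AE p in torus_measure. b p = c p"
  by (rule L2_fcoef_unique) (auto simp: boundary_def)

lemma boundary_L2: "boundary a b \<Longrightarrow> b \<in> L2_torus" by (simp add: boundary_def)

lemma parseval:
  assumes "boundary a b"
  shows "L2_sq b = (norm a)\<^sup>2"
proof -
  obtain c where c: "boundary a c" "L2_sq c = (norm a)\<^sup>2"
    using parseval_for_some_boundary by blast
  have [measurable]: "b \<in> borel_measurable borel" "c \<in> borel_measurable borel"
    using assms c(1) by (auto simp: boundary_def L2_torus_def)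
  have "L2_sq b = L2_sq c"
  proof (rule integral_cong_AE)
    show "AE p in torus_measure. (cmod (b p))\<^sup>2 = (cmod (c p))\<^sup>2"
      using boundary_AE_unique[OF assms c(1)] by eventually_elim simp
  qed measurable
  then show ?thesis using c(2) by simp
qed

lemma boundary_add: "boundary a b \<Longrightarrow> boundary c d \<Longrightarrow> boundary (a + c) (\<lambda>p. b p + d p)"
  by (simp add: boundary_def L2_add fcoef_add)
lemma boundary_cscale: "boundary a b \<Longrightarrow> boundary (cscale k a) (\<lambda>p. k * b p)"
  by (simp add: boundary_def L2_cmult fcoef_cmult)

lemma boundary_of_L2_coefs:
  assumes "b \<in> L2_torus"
  shows "boundary (Abs_ell2 (fcoef b)) b"
proof -
  have "(\<lambda>\<alpha>. (cmod (fcoef b \<alpha>))\<^sup>2) summable_on UNIV"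
    using bessel_torus[OF _ assms] by (rule square_summable_bounded)
  then show ?thesis using assms by (simp add: boundary_def coef_Abs_ell2)
qed

lemma integral_norm_sq_add:
  assumes b: "b \<in> L2_torus" and d: "d \<in> L2_torus"
  shows "L2_sq (\<lambda>p. b p + d p)
    = L2_sq b + L2_sq d
     + 2 * Re (\<integral>p. b p * cnj (d p) \<partial>torus_measure)"
proof -
  have eq: "(cmod (x + y))\<^sup>2 = (cmod x)\<^sup>2 + (cmod y)\<^sup>2 + 2 * Re (x * cnj y)" for x y
    unfolding cmod_power2 by (simp add: power2_eq_square algebra_simps)
  have i: "integrable torus_measure (\<lambda>p. b p * cnj (d p))" by (rule L2_integrable_mult[OF b d])
  have "L2_sq (\<lambda>p. b p + d p)
     = (\<integral>p. (cmod (b p))\<^sup>2 + (cmod (d p))\<^sup>2 \<partial>torus_measure) + (\<integral>p. 2 * Re (b p * cnj (d p)) \<partial>torus_measure)"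
    unfolding eq using b d i
    by (intro Bochner_Integration.integral_add Bochner_Integration.integrable_add integrable_mult_right integrable_Re)
      (auto simp: L2_torus_def)
  also have "(\<integral>p. 2 * Re (b p * cnj (d p)) \<partial>torus_measure) = 2 * Re (\<integral>p. b p * cnj (d p) \<partial>torus_measure)"
    by (simp only: integral_mult_right_zero integral_Re[OF i])
  also have "(\<integral>p. (cmod (b p))\<^sup>2 + (cmod (d p))\<^sup>2 \<partial>torus_measure) = L2_sq b + L2_sq d"
    using b d by (intro Bochner_Integration.integral_add) (auto simp: L2_torus_def)
  finally show ?thesis .
qed

lemma norm_ell2_sq_add: "(norm (a + c))\<^sup>2 = (norm a)\<^sup>2 + (norm c)\<^sup>2 + 2 * Re (cinner a c)"
  unfolding power2_norm_eq_inner by (simp add: inner_simps inner_commute inner_ell2_def[of a c])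

text \<open>Real parts of both sides agree by polarization; replacing \<open>c\<close> by \<open>\<i> c\<close> gives the imaginary
parts.\<close>

lemma parseval_inner:
  assumes "boundary a b" "boundary c d"
  shows "(\<integral>p. b p * cnj (d p) \<partial>torus_measure) = cinner a c"
proof -
  have re: "Re (\<integral>p. b p * cnj (e p) \<partial>torus_measure) = Re (cinner a x)" if "boundary x e" for x e
    using integral_norm_sq_add[OF boundary_L2[OF assms(1)] boundary_L2[OF that]]
      norm_ell2_sq_add[of a x] parseval[OF assms(1)] parseval[OF that] parseval[OF boundary_add[OF assms(1) that]]
    by linarith
  have "Re (\<integral>p. b p * cnj (\<i> * d p) \<partial>torus_measure) = Re (cinner a (cscale \<i> c))"
    by (rule re[OF boundary_cscale[OF assms(2)]])
  moreover have "(\<integral>p. b p * cnj (\<i> * d p) \<partial>torus_measure) = - \<i> * (\<integral>p. b p * cnj (d p) \<partial>torus_measure)"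
    by (subst integral_mult_right_zero[symmetric]) (simp add: algebra_simps)
  ultimately have "Im (\<integral>p. b p * cnj (d p) \<partial>torus_measure) = Im (cinner a c)"
    by (simp add: cinner_cscale_right)
  then show ?thesis using re[OF assms(2)] by (simp add: complex_eq_iff)
qed

lemma boundary_tendsto:
  assumes b: "boundary a b" and supp: "\<And>\<alpha>. \<alpha> \<notin> J \<Longrightarrow> coef a \<alpha> = 0"
  shows "((\<lambda>F. L2_sq (\<lambda>p. b p - tpoly (coef a) F p)) \<longlongrightarrow> 0) (finite_subsets_at_top J)"
proof -
  have fa: "fcoef b = coef a" using b by (auto simp: boundary_def)
  have "((\<lambda>\<alpha>. (cmod (coef a \<alpha>))\<^sup>2) has_sum (norm a)\<^sup>2) UNIV"
    unfolding norm_ell2_sq by (intro has_sum_infsum square_summable_coef)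
  then have "((\<lambda>\<alpha>. (cmod (coef a \<alpha>))\<^sup>2) has_sum (norm a)\<^sup>2) J"
    by (subst has_sum_cong_neutral[where T=UNIV and g="\<lambda>\<alpha>. (cmod (coef a \<alpha>))\<^sup>2"]) (auto simp: supp)
  then have "((\<lambda>F. (norm a)\<^sup>2 - (\<Sum>\<alpha>\<in>F. (cmod (coef a \<alpha>))\<^sup>2)) \<longlongrightarrow> (norm a)\<^sup>2 - (norm a)\<^sup>2) (finite_subsets_at_top J)"
    unfolding has_sum_def by (intro tendsto_intros)
  moreover have "\<forall>\<^sub>F F in finite_subsets_at_top J. (norm a)\<^sup>2 - (\<Sum>\<alpha>\<in>F. (cmod (coef a \<alpha>))\<^sup>2)
      = L2_sq (\<lambda>p. b p - tpoly (coef a) F p)"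
    by (rule eventually_finite_subsets_at_top_weakI)
      (use L2_dist_tpoly[OF _ boundary_L2[OF b]] parseval[OF b] in \<open>simp add: fa\<close>)
  ultimately show ?thesis by (simp add: Lim_transform_eventually)
qed

section \<open>Translates of coefficient families\<close>

lift_definition shift :: "'a::ab_group_add \<Rightarrow> 'a ell2 \<Rightarrow> 'a ell2" is "\<lambda>\<beta> f \<alpha>. f (\<alpha> - \<beta>)"
proof -
  fix \<beta> :: 'a and f :: "'a \<Rightarrow> complex"
  assume "(\<lambda>i. (cmod (f i))\<^sup>2) summable_on UNIV"
  then show "(\<lambda>\<alpha>. (cmod (f (\<alpha> - \<beta>)))\<^sup>2) summable_on UNIV"
    by (subst summable_on_reindex_bij_witness[where S=UNIV and T=UNIV and i="\<lambda>\<alpha>. \<alpha> + \<beta>" and j="\<lambda>\<alpha>. \<alpha> - \<beta>" and h="\<lambda>i. (cmod (f i))\<^sup>2"]) auto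
qed

lemma coef_shift [simp]: "coef (shift \<beta> a) \<alpha> = coef a (\<alpha> - \<beta>)" by (simp add: shift.rep_eq)
lemma shift_shift: "shift \<alpha> (shift \<beta> a) = shift (\<alpha> + \<beta>) a" by (rule ell2_eqI) (simp add: algebra_simps)
lemma shift_0 [simp]: "shift 0 a = a" by (rule ell2_eqI) simp
lemma shift_add: "shift \<alpha> (a + b) = shift \<alpha> a + shift \<alpha> b" by (rule ell2_eqI) simp
lemma shift_diff: "shift \<alpha> (a - b) = shift \<alpha> a - shift \<alpha> b" by (rule ell2_eqI) simp
lemma shift_cscale: "shift \<alpha> (cscale k a) = cscale k (shift \<alpha> a)" by (rule ell2_eqI) simp
lemma shift_zero [simp]: "shift \<alpha> 0 = 0" by (rule ell2_eqI) simp

lemma cinner_shift: "cinner (shift \<beta> a) (shift \<beta> b) = cinner a b"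
  unfolding cinner_def
  by (rule infsum_reindex_bij_witness[where i="\<lambda>\<alpha>. \<alpha> + \<beta>" and j="\<lambda>\<alpha>. \<alpha> - \<beta>"]) auto

lemma cinner_shift_shift: "cinner (shift \<alpha> a) (shift \<beta> b) = cinner (shift (\<alpha> - \<beta>) a) b"
  using cinner_shift[of \<beta> "shift (\<alpha> - \<beta>) a" b] by (simp add: shift_shift)

lemma norm_shift [simp]: "norm (shift \<alpha> a) = norm a"
  by (simp add: norm_eq_sqrt_inner inner_ell2_def cinner_shift)

lemma boundary_shift: "boundary a b \<Longrightarrow> boundary (shift \<beta> a) (\<lambda>p. mon \<beta> p * b p)"
proof -
  assume b: "boundary a b"
  then have [measurable]: "b \<in> borel_measurable borel" by (auto simp: boundary_def L2_torus_def)
  have "integrable torus_measure (\<lambda>p. (cmod (mon \<beta> p * b p))\<^sup>2)"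
  proof (rule Bochner_Integration.integrable_bound)
    show "integrable torus_measure (\<lambda>p. (cmod (b p))\<^sup>2)" using b by (simp add: boundary_def L2_torus_def)
    show "AE p in torus_measure. norm ((cmod (mon \<beta> p * b p))\<^sup>2) \<le> norm ((cmod (b p))\<^sup>2)"
      using AE_norm_mon[of \<beta>] by eventually_elim (simp add: norm_mult)
  qed measurable
  then have "(\<lambda>p. mon \<beta> p * b p) \<in> L2_torus" by (simp add: L2_torus_def)
  then show ?thesis using b by (simp add: boundary_def fcoef_mon_mult del: split_paired_All)
qed

lemma fcoef_boundary_product:
  assumes "boundary a b" "boundary c d"
  shows "fcoef (\<lambda>p. b p * cnj (d p)) \<alpha> = cinner a (shift \<alpha> c)"
proof -
  have "fcoef (\<lambda>p. b p * cnj (d p)) \<alpha> = (\<integral>p. b p * cnj (mon \<alpha> p * d p) \<partial>torus_measure)"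
    by (simp add: fcoef_def algebra_simps)
  then show ?thesis using parseval_inner[OF assms(1) boundary_shift[OF assms(2)]] by simp
qed

text \<open>The inner products of \<open>a\<close> with its translates are the Fourier coefficients of the squared modulus of
\<open>b\<close>, and those of the constant \<open>1\<close> are \<open>1\<close> at \<open>0\<close> and \<open>0\<close> elsewhere.\<close>

lemma unimodular_boundary_iff:
  assumes b: "boundary a b"
  shows "(AE p in torus_measure. cmod (b p) = 1) \<longleftrightarrow> (\<forall>\<alpha>. cinner (shift \<alpha> a) a = (if \<alpha> = 0 then 1 else 0))"
proof -
  have bL: "b \<in> L2_torus" using b by (simp add: boundary_def)
  have bm [measurable]: "b \<in> borel_measurable borel" by (rule L2_measurable[OF bL])
  have f: "fcoef (\<lambda>p. b p * cnj (b p)) \<alpha> = cnj (cinner (shift \<alpha> a) a)" for \<alpha>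
    using fcoef_boundary_product[OF b b] cinner_commute by metis
  have one: "fcoef (\<lambda>_. 1) \<alpha> = (if \<alpha> = 0 then 1 else 0)" for \<alpha>
    using fcoef_mon[of 0 \<alpha>] by (simp add: mon_zero[abs_def])
  have u: "cmod x = 1 \<longleftrightarrow> x * cnj x = 1" for x
    by (metis complex_norm_square norm_ge_zero of_real_1 of_real_eq_iff power2_eq_1_iff neg_0_le_iff_le not_one_le_zero of_real_power one_power2)
  show ?thesis
  proof
    assume "AE p in torus_measure. cmod (b p) = 1"
    then have ae: "AE p in torus_measure. b p * cnj (b p) = 1" by (simp add: u)
    have "fcoef (\<lambda>p. b p * cnj (b p)) \<alpha> = fcoef (\<lambda>_. 1) \<alpha>" for \<alpha>
      unfolding fcoef_def
    proof (rule integral_cong_AE)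
      show "AE p in torus_measure. b p * cnj (b p) * cnj (mon \<alpha> p) = 1 * cnj (mon \<alpha> p)"
        using ae by eventually_elim simp
    qed measurable
    then have "cnj (cinner (shift \<alpha> a) a) = (if \<alpha> = 0 then 1 else 0)" for \<alpha> using f one by simp
    then have "cinner (shift \<alpha> a) a = cnj (if \<alpha> = 0 then 1 else 0)" for \<alpha>
      by (metis complex_cnj_cnj)
    then show "\<forall>\<alpha>. cinner (shift \<alpha> a) a = (if \<alpha> = 0 then 1 else 0)" by simp
  next
    assume o: "\<forall>\<alpha>. cinner (shift \<alpha> a) a = (if \<alpha> = 0 then 1 else 0)"
    have i1: "integrable torus_measure (\<lambda>p. b p * cnj (b p))" by (rule L2_integrable_mult[OF bL bL])
    have i2: "integrable torus_measure (\<lambda>_. 1::complex)" by simp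
    have "fcoef (\<lambda>p. b p * cnj (b p) - 1) \<alpha> = fcoef (\<lambda>p. b p * cnj (b p)) \<alpha> - fcoef (\<lambda>_. 1) \<alpha>" for \<alpha>
      unfolding fcoef_def left_diff_distrib
      by (rule Bochner_Integration.integral_diff; rule integrable_fcoef; (rule i1 i2)?) measurable
    then have "fcoef (\<lambda>p. b p * cnj (b p) - 1) \<alpha> = 0" for \<alpha> using f o one by simp
    then have "null_coefs (\<lambda>p. b p * cnj (b p) - 1)" unfolding null_coefs_def using i1 i2 by simp
    from null_coefs_AE_zero[OF this] show "AE p in torus_measure. cmod (b p) = 1" by (simp add: u)
  qed
qed

text \<open>The translates of \<open>q\<close> span a dense subspace: the product of the boundary function of \<open>r\<close> with the
conjugate of the unimodular boundary function of \<open>q\<close> has vanishing Fourier coefficients.\<close>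

lemma zero_if_orthogonal_to_shifts:
  fixes q r :: "(int \<times> int) ell2"
  assumes q: "\<And>\<alpha>. cinner (shift \<alpha> q) q = (if \<alpha> = 0 then 1 else 0)"
    and r: "\<And>\<alpha>. cinner r (shift \<alpha> q) = 0"
  shows "r = 0"
proof -
  obtain b d where b: "boundary q b" and d: "boundary r d" using boundary_exists by metis
  have bL: "b \<in> L2_torus" "d \<in> L2_torus" using b d by (auto simp: boundary_def)
  have [measurable]: "b \<in> borel_measurable borel" "d \<in> borel_measurable borel" using bL by (auto simp: L2_measurable)
  have "null_coefs (\<lambda>p. d p * cnj (b p))" unfolding null_coefs_def
    using fcoef_boundary_product[OF d b] r L2_integrable_mult[OF bL(2,1)] by simp
  from null_coefs_AE_zero[OF this]
  have "AE p in torus_measure. d p * cnj (b p) = 0" .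
  moreover have "AE p in torus_measure. cmod (b p) = 1" using unimodular_boundary_iff[OF b] q by simp
  ultimately have "AE p in torus_measure. (cmod (d p))\<^sup>2 = 0" by eventually_elim auto
  then have "L2_sq d = 0" by (subst integral_cong_AE[where g="\<lambda>_. 0"]) auto
  then show ?thesis using parseval[OF d] by simp
qed

section \<open>Functions on the triangle given by coefficients\<close>

lemma product_summable:
  fixes f g :: "nat \<Rightarrow> real"
  assumes f: "summable f" "\<And>n. f n \<ge> 0" and g: "summable g" "\<And>n. g n \<ge> 0"
  shows "(\<lambda>(i, j). f i * g j) summable_on UNIV"
proof -
  have gs: "(g has_sum suminf g) UNIV" using g
    by (metis summable_on_UNIV_nonneg_real_iff has_sum_infsum has_sum_imp_sums sums_unique)
  have "(\<lambda>(i, j). f i * g j) summable_on Sigma UNIV (\<lambda>_. UNIV)"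
  proof (rule summable_on_SigmaI[where g="\<lambda>i. f i * suminf g"])
    show "((\<lambda>j. case (i, j) of (i, j) \<Rightarrow> f i * g j) has_sum f i * suminf g) UNIV" for i
      using has_sum_cmult_right[OF gs, of "f i"] by simp
    show "(\<lambda>i. f i * suminf g) summable_on UNIV"
      using f by (intro summable_on_cmult_left) (simp add: summable_on_UNIV_nonneg_real_iff)
  qed (use f g in auto)
  then show ?thesis by simp
qed

text \<open>The orthonormal basis \<open>(1/w) (z/w)\<^sup>i w\<^sup>j\<close> enumerates \<^const>\<open>index_set\<close> by pairs of natural numbers and
turns Laurent series on the triangle into power series on the bidisc.\<close>

definition idx :: "nat \<times> nat \<Rightarrow> int \<times> int" where
  "idx ij = (int (fst ij), int (snd ij) - int (fst ij) - 1)"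

lemma bij_betw_idx: "bij_betw idx UNIV index_set"
proof (rule bij_betwI[where g="\<lambda>\<alpha>. (nat (fst \<alpha>), nat (fst \<alpha> + snd \<alpha> + 1))"])
  show "idx \<in> UNIV \<rightarrow> index_set" by (auto simp: idx_def index_set_def)
  show "(\<lambda>\<alpha>. (nat (fst \<alpha>), nat (fst \<alpha> + snd \<alpha> + 1))) (idx x) = x" for x
    by (cases x) (simp add: idx_def)
  show "idx (nat (fst y), nat (fst y + snd y + 1)) = y" if "y \<in> index_set" for y
    using that by (cases y) (auto simp: idx_def index_set_def)
qed auto

lemma mon_idx:
  assumes "w \<noteq> 0"
  shows "mon (idx ij) (z, w) = (1 / w) * ((z / w) ^ fst ij * w ^ snd ij)"
  using assms by (simp add: mon_def idx_def power_int_diff power_divide)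

lemma in_triangle: "(z, w) \<in> hartogs_triangle \<longleftrightarrow> cmod z < cmod w \<and> cmod w < 1"
  by (simp add: hartogs_triangle_def)

lemma triangle_snd_nonzero: "p \<in> hartogs_triangle \<Longrightarrow> snd p \<noteq> 0"
  by (auto simp: hartogs_triangle_def)

lemma open_triangle: "open hartogs_triangle"
proof -
  have "hartogs_triangle = {p. cmod (fst p) < cmod (snd p)} \<inter> {p. cmod (snd p) < 1}"
    by (auto simp: hartogs_triangle_def)
  moreover have "open ({p :: complex \<times> complex. cmod (fst p) < cmod (snd p)} \<inter> {p. cmod (snd p) < 1})"
    by (intro open_Int open_Collect_less continuous_intros)
  ultimately show ?thesis by metis
qed

lemma mon_square_summable:
  assumes "p \<in> hartogs_triangle"
  shows "(\<lambda>\<alpha>. (cmod (mon \<alpha> p))\<^sup>2) summable_on index_set"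
proof -
  obtain z w where p: "p = (z, w)" by force
  have zw: "cmod z < cmod w" "cmod w < 1" and w0: "w \<noteq> 0" using assms p by (auto simp: in_triangle)
  define x where "x = (cmod z / cmod w)\<^sup>2"
  define y where "y = (cmod w)\<^sup>2"
  have xy: "0 \<le> x" "x < 1" "0 \<le> y" "y < 1" unfolding x_def y_def
    using zw w0 by (auto simp: power_less_one_iff)
  have "(\<lambda>(i, j). x ^ i * y ^ j) summable_on UNIV"
    using xy by (intro product_summable summable_geometric) auto
  then have "(\<lambda>ij. (1 / y) * (case ij of (i, j) \<Rightarrow> x ^ i * y ^ j)) summable_on UNIV"
    by (rule summable_on_cmult_right)
  moreover have "(cmod (mon (idx ij) p))\<^sup>2 = (1 / y) * (case ij of (i, j) \<Rightarrow> x ^ i * y ^ j)" for ij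
    unfolding p mon_idx[OF w0] x_def y_def
    by (simp add: norm_mult norm_divide norm_power power_mult_distrib power_divide case_prod_unfold power_mult[symmetric] mult.commute)
  ultimately have "(\<lambda>ij. (cmod (mon (idx ij) p))\<^sup>2) summable_on UNIV" by simp
  then show ?thesis
    using summable_on_reindex_bij_betw[OF bij_betw_idx, of "\<lambda>\<alpha>. (cmod (mon \<alpha> p))\<^sup>2"] by simp
qed

text \<open>The coefficients of the reproducing kernel: the value at \<open>p\<close> of a Hardy function is the inner
product with it. It is \<open>0\<close> off the triangle because Hardy functions are extended by \<open>0\<close>.\<close>

lift_definition kern :: "complex \<times> complex \<Rightarrow> (int \<times> int) ell2" is
  "\<lambda>p \<alpha>. if p \<in> hartogs_triangle \<and> \<alpha> \<in> index_set then cnj (mon \<alpha> p) else 0"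
proof -
  fix p :: "complex \<times> complex"
  show "(\<lambda>\<alpha>. (cmod (if p \<in> hartogs_triangle \<and> \<alpha> \<in> index_set then cnj (mon \<alpha> p) else 0))\<^sup>2) summable_on UNIV"
  proof (cases "p \<in> hartogs_triangle")
    case True
    show ?thesis
      by (subst summable_on_cong_neutral[where T=index_set and g="\<lambda>\<alpha>. (cmod (mon \<alpha> p))\<^sup>2"])
        (use True mon_square_summable[OF True] in auto)
  qed simp
qed

text \<open>The function on the triangle with Laurent coefficients \<open>a\<close>. Defining it as an inner product makes it
linear and continuous in \<open>a\<close>; only the coefficients on \<^const>\<open>index_set\<close> contribute.\<close>

definition ev :: "(int \<times> int) ell2 \<Rightarrow> complex \<times> complex \<Rightarrow> complex" where
  "ev a p = cinner a (kern p)"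

definition hardy_coefs :: "(int \<times> int) ell2 set" where
  "hardy_coefs = {a. \<forall>\<alpha>. \<alpha> \<notin> index_set \<longrightarrow> coef a \<alpha> = 0}"

lemma hardy_coefs_outside: "a \<in> hardy_coefs \<Longrightarrow> \<alpha> \<notin> index_set \<Longrightarrow> coef a \<alpha> = 0"
  unfolding hardy_coefs_def by blast

lemma kern_outside: "p \<notin> hartogs_triangle \<Longrightarrow> kern p = 0"
  by (rule ell2_eqI) (simp add: kern.rep_eq)

lemma ev_outside: "p \<notin> hartogs_triangle \<Longrightarrow> ev a p = 0"
  by (simp add: ev_def kern_outside)

lemma has_sum_ev:
  assumes "p \<in> hartogs_triangle"
  shows "((\<lambda>\<alpha>. coef a \<alpha> * mon \<alpha> p) has_sum ev a p) index_set"
  using has_sum_cinner[of a "kern p"] unfolding ev_def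
  by (subst has_sum_cong_neutral[where T=UNIV and g="\<lambda>\<alpha>. coef a \<alpha> * cnj (coef (kern p) \<alpha>)"])
    (use assms in \<open>auto simp: kern.rep_eq\<close>)

lemma ev_add: "ev (a + b) p = ev a p + ev b p" by (simp add: ev_def cinner_add_left)
lemma ev_diff: "ev (a - b) p = ev a p - ev b p" by (simp add: ev_def cinner_diff_left)
lemma ev_cscale: "ev (cscale k a) p = k * ev a p" by (simp add: ev_def cinner_cscale_left)
lemma ev_tendsto: "(f \<longlongrightarrow> a) F \<Longrightarrow> ((\<lambda>x. ev (f x) p) \<longlongrightarrow> ev a p) F"
  unfolding ev_def by (rule tendsto_cinner_left)

section \<open>Holomorphy of the Laurent sums\<close>

text \<open>On a smaller bidisc the partial derivatives of the terms are dominated by products of convergent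
series in one variable, so the series may be differentiated term by term.\<close>

lemma power_series2_has_derivative:
  fixes c :: "nat \<times> nat \<Rightarrow> complex"
  assumes c: "\<And>ij. cmod (c ij) \<le> C" and uv: "cmod u < 1" "cmod v < 1"
  shows "\<exists>D1 D2. ((\<lambda>x. \<Sum>\<^sub>\<infinity>(i, j). c (i, j) * (fst x ^ i * snd x ^ j)) has_derivative (\<lambda>h. D1 * fst h + D2 * snd h)) (at (u, v))"
proof -
  have C0: "0 \<le> C" using c[of "(0,0)"] norm_ge_zero order_trans by blast
  obtain \<rho> where \<rho>: "max (cmod u) (cmod v) < \<rho>" "\<rho> < 1" using uv dense[of "max (cmod u) (cmod v)" 1] by auto
  have \<rho>0: "0 \<le> \<rho>" using \<rho>(1) norm_ge_zero[of u] by linarith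
  define S where "S = ball (0::complex) \<rho> \<times> ball (0::complex) \<rho>"
  have S: "open S" "convex S" "(u, v) \<in> S" unfolding S_def using \<rho> by (auto intro: open_Times convex_Times)
  have Sb: "cmod (fst x) \<le> \<rho>" "cmod (snd x) \<le> \<rho>" if "x \<in> S" for x using that by (auto simp: S_def)
  define I where "I = (\<lambda>n. fst (prod_decode n))"
  define J where "J = (\<lambda>n. snd (prod_decode n))"
  have bij: "bij_betw prod_decode UNIV UNIV" by (rule bij_prod_decode)
  have geo: "summable (\<lambda>n. \<rho> ^ n)" using \<rho> \<rho>0 by (simp add: summable_geometric)
  have dgeo: "summable (\<lambda>n. real n * \<rho> ^ (n - 1))"
  proof -
    have "summable (\<lambda>n. of_nat (Suc n) * \<rho> ^ n)"
      using geometric_deriv_sums[of \<rho>] \<rho> \<rho>0 by (auto simp: sums_iff)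
    then show ?thesis using summable_Suc_iff[of "\<lambda>n. real n * \<rho> ^ (n - 1)"] by simp
  qed
  have to_nat: "summable (\<lambda>n. C * (f (I n) * g (J n)))"
    if "summable f" "\<And>n. f n \<ge> 0" "summable g" "\<And>n. g n \<ge> 0" for f g :: "nat \<Rightarrow> real"
  proof -
    have "(\<lambda>n. case prod_decode n of (i, j) \<Rightarrow> f i * g j) summable_on UNIV"
      using product_summable[OF that] summable_on_reindex_bij_betw[OF bij, of "\<lambda>(i, j). f i * g j"] by simp
    then have "summable (\<lambda>n. case prod_decode n of (i, j) \<Rightarrow> f i * g j)" by (rule summable_on_imp_summable)
    then show ?thesis unfolding I_def J_def by (intro summable_mult) (simp add: case_prod_unfold)
  qed
  define f where "f = (\<lambda>n x. c (I n, J n) * (fst x ^ I n * snd x ^ J n))"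
  define A where "A = (\<lambda>n x. c (I n, J n) * (of_nat (I n) * fst x ^ (I n - 1) * snd x ^ J n))"
  define B where "B = (\<lambda>n x. c (I n, J n) * (fst x ^ I n * (of_nat (J n) * snd x ^ (J n - 1))))"
  define g' where "g' = (\<lambda>x h. (\<Sum>n. A n x) * fst h + (\<Sum>n. B n x) * snd h)"
  have sA: "uniform_limit S (\<lambda>n x. \<Sum>i<n. A i x) (\<lambda>x. \<Sum>i. A i x) sequentially"
  proof (rule Weierstrass_m_test)
    show "summable (\<lambda>n. C * ((real (I n) * \<rho> ^ (I n - 1)) * \<rho> ^ J n))"
      by (rule to_nat[OF dgeo _ geo]) (use \<rho>0 in auto)
    fix n x assume "x \<in> S"
    then show "cmod (A n x) \<le> C * ((real (I n) * \<rho> ^ (I n - 1)) * \<rho> ^ J n)"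
      unfolding A_def norm_mult norm_power norm_of_nat using Sb[of x] C0 \<rho>0 c
      by (intro mult_mono power_mono mult_nonneg_nonneg order_refl) auto
  qed
  have sB: "uniform_limit S (\<lambda>n x. \<Sum>i<n. B i x) (\<lambda>x. \<Sum>i. B i x) sequentially"
  proof (rule Weierstrass_m_test)
    show "summable (\<lambda>n. C * (\<rho> ^ I n * (real (J n) * \<rho> ^ (J n - 1))))"
      by (rule to_nat[OF geo _ dgeo]) (use \<rho>0 in auto)
    fix n x assume "x \<in> S"
    then show "cmod (B n x) \<le> C * (\<rho> ^ I n * (real (J n) * \<rho> ^ (J n - 1)))"
      unfolding B_def norm_mult norm_power norm_of_nat using Sb[of x] C0 \<rho>0 c
      by (intro mult_mono power_mono mult_nonneg_nonneg order_refl) auto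
  qed
  have hs: "((\<lambda>(i, j). c (i, j) * (fst x ^ i * snd x ^ j)) has_sum (\<Sum>\<^sub>\<infinity>(i, j). c (i, j) * (fst x ^ i * snd x ^ j))) UNIV"
    if x: "x \<in> S" for x
  proof -
    have "(\<lambda>ij. C * (case ij of (i, j) \<Rightarrow> \<rho> ^ i * \<rho> ^ j)) summable_on UNIV"
      by (intro summable_on_cmult_right product_summable geo) (use \<rho>0 in auto)
    then have "(\<lambda>ij. norm (case ij of (i, j) \<Rightarrow> c (i, j) * (fst x ^ i * snd x ^ j))) summable_on UNIV"
    proof (rule Infinite_Sum.abs_summable_on_comparison_test')
      fix ij :: "nat \<times> nat"
      obtain i j where ij: "ij = (i, j)" by force
      show "norm (case ij of (i, j) \<Rightarrow> c (i, j) * (fst x ^ i * snd x ^ j)) \<le> C * (case ij of (i, j) \<Rightarrow> \<rho> ^ i * \<rho> ^ j)"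
        unfolding ij prod.case norm_mult norm_power using Sb[OF x] C0 \<rho>0 c
        by (intro mult_mono power_mono mult_nonneg_nonneg order_refl) auto
    qed
    then show ?thesis by (rule has_sum_infsum[OF abs_summable_summable])
  qed
  have sums: "(\<lambda>n. f n x) sums (\<Sum>\<^sub>\<infinity>(i, j). c (i, j) * (fst x ^ i * snd x ^ j))" if "x \<in> S" for x
  proof -
    have "((\<lambda>n. case prod_decode n of (i, j) \<Rightarrow> c (i, j) * (fst x ^ i * snd x ^ j)) has_sum
        (\<Sum>\<^sub>\<infinity>(i, j). c (i, j) * (fst x ^ i * snd x ^ j))) UNIV"
      using hs[OF that] has_sum_reindex_bij_betw[OF bij] by blast
    from has_sum_imp_sums[OF this] show ?thesis unfolding f_def I_def J_def by (simp add: case_prod_unfold)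
  qed
  have "\<exists>g. \<forall>x\<in>S. (\<lambda>n. f n x) sums g x \<and> (g has_derivative g' x) (at x within S)"
  proof (rule has_derivative_series[where f'="\<lambda>n x h. A n x * fst h + B n x * snd h" and x="(u, v)"])
    show "convex S" "(u, v) \<in> S" by (fact S)+
    show "(\<lambda>n. f n (u, v)) sums (\<Sum>\<^sub>\<infinity>(i, j). c (i, j) * (fst (u, v) ^ i * snd (u, v) ^ j))"
      by (rule sums[OF S(3)])
    show "(f n has_derivative (\<lambda>h. A n x * fst h + B n x * snd h)) (at x within S)" for n x
      unfolding f_def A_def B_def
      by (auto intro!: derivative_eq_intros simp: algebra_simps)
    fix e :: real assume "e > 0"
    then have "\<forall>\<^sub>F n in sequentially. \<forall>x\<in>S. dist (\<Sum>i<n. A i x) (\<Sum>i. A i x) < e/2"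
      "\<forall>\<^sub>F n in sequentially. \<forall>x\<in>S. dist (\<Sum>i<n. B i x) (\<Sum>i. B i x) < e/2"
      using uniform_limitD[OF sA, of "e/2"] uniform_limitD[OF sB, of "e/2"] by auto
    then show "\<forall>\<^sub>F n in sequentially. \<forall>x\<in>S. \<forall>h. norm ((\<Sum>i<n. A i x * fst h + B i x * snd h) - g' x h) \<le> e * norm h"
    proof eventually_elim
      case (elim n)
      show ?case
      proof (intro ballI allI)
        fix x h assume x: "x \<in> S"
        define a where "a = (\<Sum>i<n. A i x) - (\<Sum>i. A i x)"
        define b where "b = (\<Sum>i<n. B i x) - (\<Sum>i. B i x)"
        have ab: "cmod a \<le> e/2" "cmod b \<le> e/2" using elim x by (auto simp: a_def b_def dist_norm intro: less_imp_le)
        have "(\<Sum>i<n. A i x * fst h + B i x * snd h) - g' x h = a * fst h + b * snd h"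
          by (simp add: g'_def a_def b_def sum.distrib left_diff_distrib flip: sum_distrib_right)
        also have "norm \<dots> \<le> cmod a * cmod (fst h) + cmod b * cmod (snd h)"
          by (metis norm_mult norm_triangle_ineq)
        also have "\<dots> \<le> (e/2) * norm h + (e/2) * norm h"
          using ab norm_fst_le[of "fst h" "snd h"] norm_snd_le[of "snd h" "fst h"] \<open>e > 0\<close>
          by (intro add_mono mult_mono) auto
        finally show "norm ((\<Sum>i<n. A i x * fst h + B i x * snd h) - g' x h) \<le> e * norm h" by simp
      qed
    qed
  qed
  then obtain g where g: "\<And>x. x \<in> S \<Longrightarrow> (\<lambda>n. f n x) sums g x" "\<And>x. x \<in> S \<Longrightarrow> (g has_derivative g' x) (at x within S)"
    by blast
  have "(g has_derivative g' (u, v)) (at (u, v))"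
    using g(2)[OF S(3)] at_within_open[OF S(3,1)] by simp
  then have "((\<lambda>x. \<Sum>\<^sub>\<infinity>(i, j). c (i, j) * (fst x ^ i * snd x ^ j)) has_derivative g' (u, v)) (at (u, v))"
    by (rule has_derivative_transform_within_open[OF _ S(1,3)]) (use g(1) sums sums_unique2 in blast)
  then show ?thesis unfolding g'_def by blast
qed

text \<open>In the coordinates \<open>(z/w, w)\<close>, which map the triangle into the bidisc, \<open>w\<close> times the Laurent sum is a
power series.\<close>

lemma holomorphic2_ev: "holomorphic2_on (ev a) hartogs_triangle"
  unfolding holomorphic2_on_def
proof
  fix p assume p: "p \<in> hartogs_triangle"
  obtain z w where zw: "p = (z, w)" by force
  have w: "cmod z < cmod w" "cmod w < 1" "w \<noteq> 0" using p zw by (auto simp: in_triangle)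
  define G where "G = (\<lambda>x. \<Sum>\<^sub>\<infinity>(i, j). coef a (idx (i, j)) * (fst x ^ i * snd x ^ j))"
  have eq: "ev a x = (1 / snd x) * G (fst x / snd x, snd x)" if x: "x \<in> hartogs_triangle" for x
  proof -
    have x0: "snd x \<noteq> 0" using x by (rule triangle_snd_nonzero)
    have "((\<lambda>ij. coef a (idx ij) * mon (idx ij) x) has_sum ev a x) UNIV"
      using has_sum_ev[OF x, of a] has_sum_reindex_bij_betw[OF bij_betw_idx, of "\<lambda>\<alpha>. coef a \<alpha> * mon \<alpha> x"] by simp
    then have "((\<lambda>ij. snd x * (coef a (idx ij) * mon (idx ij) x)) has_sum snd x * ev a x) UNIV"
      by (rule has_sum_cmult_right)
    moreover have "snd x * (coef a (idx ij) * mon (idx ij) x)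
       = (case ij of (i, j) \<Rightarrow> coef a (idx (i, j)) * ((fst x / snd x) ^ i * snd x ^ j))" for ij
      using mon_idx[OF x0, of ij "fst x"] x0 by (simp add: case_prod_unfold)
    ultimately have "((\<lambda>(i, j). coef a (idx (i, j)) * ((fst x / snd x) ^ i * snd x ^ j)) has_sum snd x * ev a x) UNIV"
      by simp
    from infsumI[OF this] have "G (fst x / snd x, snd x) = snd x * ev a x" by (simp add: G_def)
    then show ?thesis using x0 by simp
  qed
  have zw1: "cmod (z / w) < 1" using w by (simp add: norm_divide)
  obtain D1 D2 where D: "(G has_derivative (\<lambda>h. D1 * fst h + D2 * snd h)) (at (z / w, w))"
    using power_series2_has_derivative[where c="\<lambda>ij. coef a (idx ij)", OF norm_coef_le zw1 w(2)]
    unfolding G_def by blast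
  have in': "((\<lambda>x. (fst x / snd x, snd x)) has_derivative (\<lambda>h. ((fst h * w - z * snd h) / (w * w), snd h))) (at p)"
    unfolding zw using w(3) by (auto intro!: derivative_eq_intros simp: field_simps)
  have D': "(G has_derivative (\<lambda>h. D1 * fst h + D2 * snd h)) (at ((\<lambda>x. (fst x / snd x, snd x)) p))"
    using D zw by simp
  have G: "((\<lambda>x. G (fst x / snd x, snd x)) has_derivative (\<lambda>h. D1 * ((fst h * w - z * snd h) / (w * w)) + D2 * snd h)) (at p)"
    using has_derivative_compose[OF in' D'] by simp
  have inv: "((\<lambda>x. 1 / snd x) has_derivative (\<lambda>h. - snd h / (w * w))) (at p)"
    unfolding zw using w(3) by (auto intro!: derivative_eq_intros simp: field_simps)
  have "((\<lambda>x. (1 / snd x) * G (fst x / snd x, snd x)) has_derivative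
      (\<lambda>h. (1 / w) * (D1 * ((fst h * w - z * snd h) / (w * w)) + D2 * snd h) + (- snd h / (w * w)) * G (z / w, w))) (at p)"
    using has_derivative_mult[OF inv G] zw by simp
  moreover have "(\<lambda>h. (1 / w) * (D1 * ((fst h * w - z * snd h) / (w * w)) + D2 * snd h) + (- snd h / (w * w)) * G (z / w, w))
     = (\<lambda>(h, k). (D1 / (w * w)) * h + (D2 / w - D1 * z / (w * w * w) - G (z / w, w) / (w * w)) * k)"
    using w(3) by (auto simp: field_simps)
  ultimately have "((\<lambda>x. (1 / snd x) * G (fst x / snd x, snd x)) has_derivative
     (\<lambda>(h, k). (D1 / (w * w)) * h + (D2 / w - D1 * z / (w * w * w) - G (z / w, w) / (w * w)) * k)) (at p)" by simp
  then have "(ev a has_derivative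
     (\<lambda>(h, k). (D1 / (w * w)) * h + (D2 / w - D1 * z / (w * w * w) - G (z / w, w) / (w * w)) * k)) (at p)"
    by (rule has_derivative_transform_within_open[OF _ open_triangle p]) (simp add: eq)
  then show "\<exists>b c. (ev a has_derivative (\<lambda>(u, v). b * u + c * v)) (at p)" by blast
qed

section \<open>Restriction to tori inside the triangle\<close>

lemma holomorphic2_continuous: "holomorphic2_on f hartogs_triangle \<Longrightarrow> continuous_on hartogs_triangle f"
  unfolding holomorphic2_on_def
  by (intro continuous_at_imp_continuous_on ballI) (meson has_derivative_continuous)

lemma measurable_of_continuous_triangle:
  fixes f :: "complex \<times> complex \<Rightarrow> complex"
  assumes "continuous_on hartogs_triangle f" "\<And>p. p \<notin> hartogs_triangle \<Longrightarrow> f p = 0"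
  shows "f \<in> borel_measurable borel"
proof -
  have "(\<lambda>p. indicator hartogs_triangle p *\<^sub>R f p) \<in> borel_measurable borel"
    using open_triangle assms(1) by (intro borel_measurable_continuous_on_indicator) auto
  also have "(\<lambda>p. indicator hartogs_triangle p *\<^sub>R f p) = f" using assms(2) by (auto simp: indicator_def)
  finally show ?thesis .
qed

definition dilate :: "real \<times> real \<Rightarrow> complex \<times> complex \<Rightarrow> complex \<times> complex" where
  "dilate r p = (of_real (fst r) * fst p, of_real (snd r) * snd p)"

text \<open>The pairs of radii of the tori that lie in the triangle and avoid \<open>z = 0\<close>.\<close>

definition radii :: "(real \<times> real) set" where
  "radii = {r. 0 < fst r \<and> fst r < snd r \<and> snd r < 1}"

definition rpow :: "int \<times> int \<Rightarrow> real \<times> real \<Rightarrow> real" where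
  "rpow \<alpha> r = fst r powi fst \<alpha> * snd r powi snd \<alpha>"

lemma rpow_pos: "r \<in> radii \<Longrightarrow> rpow \<alpha> r > 0"
  by (auto simp: rpow_def radii_def intro!: mult_pos_pos zero_less_power_int)

lemma mon_dilate: "mon \<alpha> (dilate r p) = of_real (rpow \<alpha> r) * mon \<alpha> p"
  by (simp add: mon_def dilate_def rpow_def power_int_mult_distrib of_real_power_int)

lemma dilate_in_triangle:
  "r \<in> radii \<Longrightarrow> cmod (fst p) = 1 \<Longrightarrow> cmod (snd p) = 1 \<Longrightarrow> dilate r p \<in> hartogs_triangle"
  by (auto simp: dilate_def radii_def in_triangle norm_mult)

lemma measurable_dilate [measurable]: "dilate r \<in> borel_measurable borel"
  unfolding dilate_def by (intro borel_measurable_continuous_onI continuous_intros)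

lemma continuous_dilate: "continuous_on A (dilate r)"
  unfolding dilate_def by (intro continuous_intros)

lemma compact_torus: "compact {p :: complex \<times> complex. cmod (fst p) = 1 \<and> cmod (snd p) = 1}"
proof -
  have "{p :: complex \<times> complex. cmod (fst p) = 1 \<and> cmod (snd p) = 1} = sphere 0 1 \<times> sphere 0 1" by auto
  then show ?thesis by (simp add: compact_Times)
qed

lemma bounded_dilate:
  fixes f :: "complex \<times> complex \<Rightarrow> complex"
  assumes f: "continuous_on \<Omega> f" and \<Omega>: "\<And>p. cmod (fst p) = 1 \<Longrightarrow> cmod (snd p) = 1 \<Longrightarrow> dilate r p \<in> \<Omega>"
  shows "\<exists>B. AE p in torus_measure. cmod (f (dilate r p)) \<le> B"
proof -
  define K where "K = {p :: complex \<times> complex. cmod (fst p) = 1 \<and> cmod (snd p) = 1}"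
  have "continuous_on K (\<lambda>p. f (dilate r p))"
    by (rule continuous_on_compose2[OF f continuous_dilate]) (auto simp: K_def \<Omega>)
  then have "compact ((\<lambda>p. f (dilate r p)) ` K)" using compact_torus unfolding K_def by (rule compact_continuous_image)
  then have "bounded ((\<lambda>p. f (dilate r p)) ` K)" by (rule compact_imp_bounded)
  then obtain B where B: "\<And>p. p \<in> K \<Longrightarrow> cmod (f (dilate r p)) \<le> B" unfolding bounded_iff by auto
  have "AE p in torus_measure. cmod (f (dilate r p)) \<le> B"
    using AE_torus by eventually_elim (auto simp: K_def intro!: B)
  then show ?thesis by blast
qed

lemma L2_dilate:
  assumes "continuous_on hartogs_triangle f" and [measurable]: "f \<in> borel_measurable borel" and "r \<in> radii"
  shows "(\<lambda>p. f (dilate r p)) \<in> L2_torus"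
proof -
  obtain B where "AE p in torus_measure. cmod (f (dilate r p)) \<le> B"
    using bounded_dilate[OF assms(1) dilate_in_triangle[OF assms(3)]] by blast
  then show ?thesis by (intro L2_bounded) measurable
qed

text \<open>At interior radii the Laurent series converges absolutely, hence uniformly on the torus.\<close>

lemma fcoef_dilate:
  assumes hs: "\<And>p. p \<in> hartogs_triangle \<Longrightarrow> ((\<lambda>\<alpha>. a \<alpha> * mon \<alpha> p) has_sum f p) index_set"
    and f: "(\<lambda>p. f (dilate r p)) \<in> L2_torus" and r: "r \<in> radii"
  shows "fcoef (\<lambda>p. f (dilate r p)) \<alpha> = (if \<alpha> \<in> index_set then a \<alpha> * of_real (rpow \<alpha> r) else 0)"
proof -
  define c where "c = (\<lambda>\<alpha>. a \<alpha> * of_real (rpow \<alpha> r))"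
  define K where "K = {p :: complex \<times> complex. cmod (fst p) = 1 \<and> cmod (snd p) = 1}"
  have hsc: "((\<lambda>\<alpha>. c \<alpha> * mon \<alpha> p) has_sum f (dilate r p)) index_set" if "p \<in> K" for p
    using hs[OF dilate_in_triangle[OF r]] that by (simp add: c_def K_def mon_dilate mult.assoc)
  have "(1, 1) \<in> K" by (simp add: K_def)
  from hsc[OF this] have "(\<lambda>\<alpha>. c \<alpha> * mon \<alpha> (1, 1)) summable_on index_set" by (auto simp: summable_on_def)
  then have "c summable_on index_set" by (simp add: mon_def)
  then have cs: "(\<lambda>\<alpha>. cmod (c \<alpha>)) summable_on index_set"
    using summable_on_iff_abs_summable_on_complex by blast
  have ul: "uniform_limit K (\<lambda>F p. \<Sum>\<alpha>\<in>F. c \<alpha> * mon \<alpha> p) (\<lambda>p. f (dilate r p)) (finite_subsets_at_top index_set)"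
  proof (rule Weierstrass_m_test_general'[OF _ hsc cs])
    show "cmod (c \<alpha> * mon \<alpha> p) \<le> cmod (c \<alpha>)" if "p \<in> K" for \<alpha> p
      using that norm_mon[of p \<alpha>] by (simp add: norm_mult K_def)
  qed
  have "((\<lambda>F. L2_sq (\<lambda>p. f (dilate r p) - tpoly c F p)) \<longlongrightarrow> 0) (finite_subsets_at_top index_set)"
  proof (rule tendstoI)
    fix e :: real assume e: "e > 0"
    have "\<forall>\<^sub>F F in finite_subsets_at_top index_set. \<forall>p\<in>K. dist (\<Sum>\<alpha>\<in>F. c \<alpha> * mon \<alpha> p) (f (dilate r p)) < sqrt (e/2)"
      using ul e by (intro uniform_limitD) auto
    then show "\<forall>\<^sub>F F in finite_subsets_at_top index_set. dist (L2_sq (\<lambda>p. f (dilate r p) - tpoly c F p)) 0 < e"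
    proof eventually_elim
      case (elim F)
      have "L2_sq (\<lambda>p. f (dilate r p) - tpoly c F p) \<le> (\<integral>p. e/2 \<partial>torus_measure)"
      proof (rule integral_mono_AE)
        show "integrable torus_measure (\<lambda>p. (cmod (f (dilate r p) - tpoly c F p))\<^sup>2)"
          using L2_diff[OF f L2_tpoly[of c F]] by (simp add: L2_torus_def)
        show "AE p in torus_measure. (cmod (f (dilate r p) - tpoly c F p))\<^sup>2 \<le> e/2"
          using AE_torus
        proof eventually_elim
          case (elim p)
          then have "p \<in> K" by (simp add: K_def)
          then have "cmod (f (dilate r p) - tpoly c F p) \<le> sqrt (e/2)"
            using \<open>\<forall>p\<in>K. _ p\<close> by (auto simp: tpoly_def dist_norm norm_minus_commute intro: less_imp_le)
          then have "(cmod (f (dilate r p) - tpoly c F p))\<^sup>2 \<le> (sqrt (e/2))\<^sup>2" by (rule power_mono) simp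
          then show ?case using e by simp
        qed
      qed simp
      also have "\<dots> = e/2" by simp
      finally have "L2_sq (\<lambda>p. f (dilate r p) - tpoly c F p) \<le> e/2" .
      moreover have "0 \<le> L2_sq (\<lambda>p. f (dilate r p) - tpoly c F p)"
        by (rule Bochner_Integration.integral_nonneg) simp
      ultimately show ?case using e by (simp add: dist_real_def)
    qed
  qed
  from fcoef_of_L2_limit[OF f this, of \<alpha>] show ?thesis by (simp add: c_def)
qed

section \<open>The Hardy norm in terms of the coefficients\<close>

lemma radii_st: "s \<in> {0<..<1} \<Longrightarrow> t \<in> {0<..<1} \<Longrightarrow> (s * t, t) \<in> radii"
  by (auto simp: radii_def)

lemma hardy_ennorm2_eq:
  assumes f: "continuous_on hartogs_triangle f" "f \<in> borel_measurable borel"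
  shows "hardy_ennorm2 f = (SUP (s, t) \<in> {0<..<1} \<times> {0<..<1}.
     ennreal ((s * t\<^sup>2) * L2_sq (\<lambda>p. f (dilate (s * t, t) p))))"
  unfolding hardy_ennorm2_def
proof (rule SUP_cong[OF refl], clarify)
  note [measurable] = f(2)
  fix s t :: real assume st: "s \<in> {0<..<1}" "t \<in> {0<..<1}"
  have L: "(\<lambda>p. f (dilate (s * t, t) p)) \<in> L2_torus" by (rule L2_dilate[OF f radii_st[OF st]])
  have st0: "0 \<le> s * t\<^sup>2" using st by simp
  have "ennreal (1 / (4 * pi\<^sup>2)) *
        (\<integral>\<^sup>+ \<theta>\<in>{0..2*pi}. (\<integral>\<^sup>+ \<gamma>\<in>{0..2*pi}.
           ennreal ((cmod (f (of_real (s * t) * cis \<theta>, of_real t * cis \<gamma>)))\<^sup>2 * (s * t\<^sup>2))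
         \<partial>lborel) \<partial>lborel)
      = (\<integral>\<^sup>+ p. ennreal ((cmod (f (dilate (s * t, t) p)))\<^sup>2 * (s * t\<^sup>2)) \<partial>torus_measure)"
    by (subst nn_integral_torus) (simp_all add: dilate_def)
  also have "\<dots> = ennreal (\<integral>p. (cmod (f (dilate (s * t, t) p)))\<^sup>2 * (s * t\<^sup>2) \<partial>torus_measure)"
    using L st0 by (intro nn_integral_eq_integral) (auto simp: L2_torus_def)
  also have "\<dots> = ennreal ((s * t\<^sup>2) * L2_sq (\<lambda>p. f (dilate (s * t, t) p)))"
    by (simp add: mult.commute)
  finally show "ennreal (1 / (4 * pi\<^sup>2)) *
        (\<integral>\<^sup>+ \<theta>\<in>{0..2*pi}. (\<integral>\<^sup>+ \<gamma>\<in>{0..2*pi}.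
           ennreal ((cmod (f (of_real (s * t) * cis \<theta>, of_real t * cis \<gamma>)))\<^sup>2 * (s * t\<^sup>2))
         \<partial>lborel) \<partial>lborel) = ennreal ((s * t\<^sup>2) * L2_sq (\<lambda>p. f (dilate (s * t, t) p)))" .
qed

lemma weight_rpow:
  assumes "s \<in> {0<..<1}" "t \<in> {0<..<1}"
  shows "(s * t\<^sup>2) * (rpow \<alpha> (s * t, t))\<^sup>2 = s powi (2 * fst \<alpha> + 1) * t powi (2 * (fst \<alpha> + snd \<alpha> + 1))"
proof -
  have st: "s \<noteq> 0" "t \<noteq> 0" using assms by auto
  have sq: "(x powi k)\<^sup>2 = x powi (2 * k)" for x :: real and k
    by (simp add: power_int_mult mult.commute)
  have "s powi (2 * fst \<alpha> + 1) = s powi (2 * fst \<alpha>) * s" using st by (simp add: power_int_add)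
  moreover have "t powi (2 * (fst \<alpha> + snd \<alpha> + 1)) = t powi (2 * fst \<alpha>) * t powi (2 * snd \<alpha>) * t\<^sup>2"
    using st by (simp add: distrib_left power_int_add)
  ultimately show ?thesis
    by (simp add: rpow_def power_mult_distrib sq power_int_mult_distrib)
qed

text \<open>The inequality of Bessel on the torus with radii \<open>st\<close> and \<open>t\<close>. The weight \<open>s t\<^sup>2\<close> in the Hardy norm
shifts the exponents so that both are nonnegative exactly on \<^const>\<open>index_set\<close>.\<close>

lemma hardy_coef_bounds:
  assumes f: "continuous_on hartogs_triangle f" "f \<in> borel_measurable borel"
    and K: "\<And>r \<alpha>. r \<in> radii \<Longrightarrow> fcoef (\<lambda>p. f (dilate r p)) \<alpha> = K \<alpha> * of_real (rpow \<alpha> r)"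
    and M: "hardy_ennorm2 f \<le> ennreal M" "0 \<le> M" and F: "finite F"
    and st: "s \<in> {0<..<1}" "t \<in> {0<..<1}"
  shows "(\<Sum>\<alpha>\<in>F. (cmod (K \<alpha>))\<^sup>2 * (s powi (2 * fst \<alpha> + 1) * t powi (2 * (fst \<alpha> + snd \<alpha> + 1)))) \<le> M"
proof -
  define r where "r = (s * t, t)"
  have r: "r \<in> radii" unfolding r_def by (rule radii_st[OF st])
  have "ennreal ((s * t\<^sup>2) * L2_sq (\<lambda>p. f (dilate r p))) \<le> hardy_ennorm2 f"
    unfolding hardy_ennorm2_eq[OF f] r_def by (rule SUP_upper2[where i="(s, t)"]) (use st in auto)
  then have "(s * t\<^sup>2) * L2_sq (\<lambda>p. f (dilate r p)) \<le> M"
    using M by (meson ennreal_le_iff order_trans)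
  moreover have "(\<Sum>\<alpha>\<in>F. (cmod (fcoef (\<lambda>p. f (dilate r p)) \<alpha>))\<^sup>2) \<le> L2_sq (\<lambda>p. f (dilate r p))"
    by (rule bessel_torus[OF F L2_dilate[OF f r]])
  moreover have "0 \<le> s * t\<^sup>2" using st by simp
  ultimately have "(s * t\<^sup>2) * (\<Sum>\<alpha>\<in>F. (cmod (fcoef (\<lambda>p. f (dilate r p)) \<alpha>))\<^sup>2) \<le> M"
    by (meson mult_left_mono order_trans)
  moreover have "(s * t\<^sup>2) * (cmod (fcoef (\<lambda>p. f (dilate r p)) \<alpha>))\<^sup>2
     = (cmod (K \<alpha>))\<^sup>2 * (s powi (2 * fst \<alpha> + 1) * t powi (2 * (fst \<alpha> + snd \<alpha> + 1)))" for \<alpha>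
    unfolding K[OF r] unfolding weight_rpow[OF st, symmetric] r_def by (simp add: norm_mult power_mult_distrib)
  ultimately show ?thesis by (simp add: sum_distrib_left)
qed

text \<open>Both parameters tend to \<open>1\<close>, and with them all weights.\<close>

lemma hardy_coef_sum_le:
  assumes f: "continuous_on hartogs_triangle f" "f \<in> borel_measurable borel"
    and K: "\<And>r \<alpha>. r \<in> radii \<Longrightarrow> fcoef (\<lambda>p. f (dilate r p)) \<alpha> = K \<alpha> * of_real (rpow \<alpha> r)"
    and M: "hardy_ennorm2 f \<le> ennreal M" "0 \<le> M" and F: "finite F"
  shows "(\<Sum>\<alpha>\<in>F. (cmod (K \<alpha>))\<^sup>2) \<le> M"
proof (rule tendsto_upperbound)
  show "((\<lambda>s. \<Sum>\<alpha>\<in>F. (cmod (K \<alpha>))\<^sup>2 * (s powi (2 * fst \<alpha> + 1) * s powi (2 * (fst \<alpha> + snd \<alpha> + 1)))) \<longlongrightarrow> (\<Sum>\<alpha>\<in>F. (cmod (K \<alpha>))\<^sup>2)) (at_left (1::real))"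
    by (rule tendsto_eq_intros refl | simp)+
  show "\<forall>\<^sub>F s in at_left (1::real). (\<Sum>\<alpha>\<in>F. (cmod (K \<alpha>))\<^sup>2 * (s powi (2 * fst \<alpha> + 1) * s powi (2 * (fst \<alpha> + snd \<alpha> + 1)))) \<le> M"
  proof (rule eventually_at_leftI[of 0])
    fix s :: real assume "s \<in> {0<..<1}"
    then show "(\<Sum>\<alpha>\<in>F. (cmod (K \<alpha>))\<^sup>2 * (s powi (2 * fst \<alpha> + 1) * s powi (2 * (fst \<alpha> + snd \<alpha> + 1)))) \<le> M"
      by (intro hardy_coef_bounds[OF f K M F])
  qed simp
qed simp

text \<open>Off \<^const>\<open>index_set\<close> one of the two weights has a negative exponent and is unbounded as its parameter
tends to \<open>0\<close>.\<close>

lemma hardy_coef_outside: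
  assumes f: "continuous_on hartogs_triangle f" "f \<in> borel_measurable borel"
    and K: "\<And>r \<alpha>. r \<in> radii \<Longrightarrow> fcoef (\<lambda>p. f (dilate r p)) \<alpha> = K \<alpha> * of_real (rpow \<alpha> r)"
    and M: "hardy_ennorm2 f \<le> ennreal M" "0 \<le> M" and \<alpha>: "\<alpha> \<notin> index_set"
  shows "K \<alpha> = 0"
proof (rule ccontr)
  assume "K \<alpha> \<noteq> 0"
  then have K0: "(cmod (K \<alpha>))\<^sup>2 > 0" by simp
  have b: "(cmod (K \<alpha>))\<^sup>2 * (s powi (2 * fst \<alpha> + 1) * t powi (2 * (fst \<alpha> + snd \<alpha> + 1))) \<le> M"
    if "s \<in> {0<..<1}" "t \<in> {0<..<1}" for s t
    using hardy_coef_bounds[OF f K M, of "{\<alpha>}" s t] that by simp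
  have grow: False if c: "c > 0" and k: "k < 0" and le: "\<And>s::real. s \<in> {0<..<1} \<Longrightarrow> c * s powi k \<le> M" for c k
  proof -
    \<comment> \<open>Small enough that \<open>c / s\<close> already exceeds \<open>M\<close>.\<close>
    define s where "s = min (1/2) (c / (M + c))"
    have s: "s \<in> {0<..<1}" using c M(2) by (auto simp: s_def)
    have s1: "inverse s \<ge> 1" using s by (simp add: one_le_inverse_iff)
    have "s powi k = inverse s ^ nat (- k)" using k by (simp add: power_int_def)
    also have "\<dots> \<ge> inverse s ^ 1" by (rule power_increasing) (use k s1 in auto)
    finally have "c * inverse s \<le> c * s powi k" using c by simp
    then have "c * inverse s \<le> M" using le[OF s] by linarith
    moreover have "inverse s \<ge> (M + c) / c"
    proof -
      have "s \<le> c / (M + c)" by (simp add: s_def)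
      then have "inverse (c / (M + c)) \<le> inverse s" using s by (intro le_imp_inverse_le) auto
      then show ?thesis by simp
    qed
    then have "c * inverse s \<ge> M + c" using c by (simp add: field_simps)
    ultimately show False using c by linarith
  qed
  have "fst \<alpha> < 0 \<or> fst \<alpha> + snd \<alpha> + 1 < 0" using \<alpha> by (auto simp: index_set_def case_prod_unfold)
  then show False
  proof
    assume "fst \<alpha> < 0"
    then show False
      using grow[of "(cmod (K \<alpha>))\<^sup>2 * (1/2) powi (2 * (fst \<alpha> + snd \<alpha> + 1))" "2 * fst \<alpha> + 1"] K0 b[of _ "1/2"]
      by (simp add: zero_less_power_int mult_ac)
  next
    assume "fst \<alpha> + snd \<alpha> + 1 < 0"
    then show False
      using grow[of "(cmod (K \<alpha>))\<^sup>2 * (1/2) powi (2 * fst \<alpha> + 1)" "2 * (fst \<alpha> + snd \<alpha> + 1)"] K0 b[of "1/2"]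
      by (simp add: zero_less_power_int mult_ac)
  qed
qed

lemma continuous_ev: "continuous_on hartogs_triangle (ev a)"
  by (rule holomorphic2_continuous[OF holomorphic2_ev])
lemma measurable_ev [measurable]: "ev a \<in> borel_measurable borel"
  by (rule measurable_of_continuous_triangle[OF continuous_ev ev_outside])

lemma fcoef_ev:
  assumes a: "a \<in> hardy_coefs" and r: "r \<in> radii"
  shows "fcoef (\<lambda>p. ev a (dilate r p)) \<alpha> = coef a \<alpha> * of_real (rpow \<alpha> r)"
  using fcoef_dilate[OF has_sum_ev L2_dilate[OF continuous_ev measurable_ev r] r, of a \<alpha>]
    hardy_coefs_outside[OF a, of \<alpha>] by (cases "\<alpha> \<in> index_set") simp_all

text \<open>On \<^const>\<open>index_set\<close> the weights are at most \<open>1\<close>, so every torus contributes at most the squared norm; the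
reverse inequality comes from letting the radii tend to \<open>1\<close>.\<close>

lemma hardy_ennorm2_ev:
  assumes a: "a \<in> hardy_coefs"
  shows "hardy_ennorm2 (ev a) = ennreal ((norm a)\<^sup>2)"
proof (rule antisym)
  show le: "hardy_ennorm2 (ev a) \<le> ennreal ((norm a)\<^sup>2)"
    unfolding hardy_ennorm2_eq[OF continuous_ev measurable_ev]
  proof (rule SUP_least, clarify)
    fix s t :: real assume st: "s \<in> {0<..<1}" "t \<in> {0<..<1}"
    define r where "r = (s * t, t)"
    have r: "r \<in> radii" unfolding r_def by (rule radii_st[OF st])
    have L: "(\<lambda>p. ev a (dilate r p)) \<in> L2_torus" by (rule L2_dilate[OF continuous_ev measurable_ev r])
    define b where "b = Abs_ell2 (fcoef (\<lambda>p. ev a (dilate r p)))"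
    have bd: "boundary b (\<lambda>p. ev a (dilate r p))" unfolding b_def by (rule boundary_of_L2_coefs[OF L])
    have cb: "coef b \<alpha> = coef a \<alpha> * of_real (rpow \<alpha> r)" for \<alpha>
      using bd fcoef_ev[OF a r] by (simp add: boundary_def del: split_paired_All)
    have le1: "(s * t\<^sup>2) * (cmod (coef b \<alpha>))\<^sup>2 \<le> (cmod (coef a \<alpha>))\<^sup>2" for \<alpha>
    proof (cases "\<alpha> \<in> index_set")
      case True
      have "s powi (2 * fst \<alpha> + 1) * t powi (2 * (fst \<alpha> + snd \<alpha> + 1)) \<le> 1 * 1"
      proof (rule mult_mono)
        show "s powi (2 * fst \<alpha> + 1) \<le> 1" "t powi (2 * (fst \<alpha> + snd \<alpha> + 1)) \<le> 1"
          using True st by (auto simp: index_set_def power_int_def intro!: power_le_one)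
      qed (use st in \<open>auto intro: zero_le_power_int\<close>)
      then have "(s * t\<^sup>2) * (rpow \<alpha> r)\<^sup>2 \<le> 1" unfolding r_def weight_rpow[OF st] by simp
      then have "(cmod (coef a \<alpha>))\<^sup>2 * ((s * t\<^sup>2) * (rpow \<alpha> r)\<^sup>2) \<le> (cmod (coef a \<alpha>))\<^sup>2 * 1"
        by (intro mult_left_mono) auto
      then show ?thesis by (simp add: cb norm_mult power_mult_distrib mult_ac)
    next
      case False
      then show ?thesis using hardy_coefs_outside[OF a] by (simp add: cb)
    qed
    have st0: "s * t\<^sup>2 > 0" using st by simp
    have "(norm b)\<^sup>2 \<le> (norm a)\<^sup>2 / (s * t\<^sup>2)"
    proof (rule norm_ell2_sq_le)
      fix F :: "(int \<times> int) set" assume F: "finite F"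
      have "(s * t\<^sup>2) * (\<Sum>\<alpha>\<in>F. (cmod (coef b \<alpha>))\<^sup>2) \<le> (\<Sum>\<alpha>\<in>F. (cmod (coef a \<alpha>))\<^sup>2)"
        unfolding sum_distrib_left by (rule sum_mono) (rule le1)
      also have "\<dots> \<le> (norm a)\<^sup>2" by (rule sum_coef_sq_le[OF F])
      finally show "(\<Sum>\<alpha>\<in>F. (cmod (coef b \<alpha>))\<^sup>2) \<le> (norm a)\<^sup>2 / (s * t\<^sup>2)"
        using st0 by (simp add: pos_le_divide_eq mult.commute)
    qed
    then have "(s * t\<^sup>2) * L2_sq (\<lambda>p. ev a (dilate r p)) \<le> (norm a)\<^sup>2"
      using parseval[OF bd] st0 by (simp add: pos_le_divide_eq mult.commute)
    then show "ennreal ((s * t\<^sup>2) * L2_sq (\<lambda>p. ev a (dilate (s * t, t) p))) \<le> ennreal ((norm a)\<^sup>2)"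
      unfolding r_def by (rule ennreal_leI)
  qed
  define M where "M = enn2real (hardy_ennorm2 (ev a))"
  have "hardy_ennorm2 (ev a) < \<infinity>" using le by (rule le_less_trans) simp
  then have M: "hardy_ennorm2 (ev a) = ennreal M" "0 \<le> M" by (auto simp: M_def)
  have "(norm a)\<^sup>2 \<le> M"
    by (rule norm_ell2_sq_le)
      (use hardy_coef_sum_le[OF continuous_ev measurable_ev fcoef_ev[OF a] _ M(2)] M(1) in auto)
  then show "ennreal ((norm a)\<^sup>2) \<le> hardy_ennorm2 (ev a)" unfolding M(1) by (rule ennreal_leI)
qed

lemma hardy_norm_ev: "a \<in> hardy_coefs \<Longrightarrow> hardy_norm (ev a) = norm a"
  by (simp add: hardy_norm_def hardy_ennorm2_ev)

lemma ev_in_hardy: "a \<in> hardy_coefs \<Longrightarrow> ev a \<in> hardy"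
  by (simp add: hardy_def holomorphic2_ev ev_outside hardy_ennorm2_ev)

section \<open>The Laurent expansion of a Hardy function\<close>

text \<open>The theorem of Cauchy for \<open>\<phi>(z) / z\<close> along homotopic circles in the annulus.\<close>

lemma circle_integral_const:
  assumes \<phi>: "\<phi> holomorphic_on {z. a < cmod z \<and> cmod z < b}" and a: "0 \<le> a"
    and \<rho>: "a < \<rho>" "\<rho> < b" and \<sigma>: "a < \<sigma>" "\<sigma> < b"
  shows "(LBINT \<theta>:{0..2*pi}. \<phi> (of_real \<rho> * cis \<theta>)) = (LBINT \<theta>:{0..2*pi}. \<phi> (of_real \<sigma> * cis \<theta>))"
proof -
  define A where "A = {z. a < cmod z \<and> cmod z < b}"
  have oA: "open A" unfolding A_def
    by (intro open_Collect_conj open_Collect_less continuous_intros)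
  have A0: "z \<noteq> 0" if "z \<in> A" for z using that a by (auto simp: A_def)
  have circ: "cmod (circlepath 0 r t) = \<bar>r\<bar>" for r t by (simp add: circlepath norm_mult)
  have hom: "homotopic_loops A (circlepath 0 \<rho>) (circlepath 0 \<sigma>)"
  proof (rule homotopic_loops_linear)
    fix t :: real assume "t \<in> {0..1}"
    show "closed_segment (circlepath 0 \<rho> t) (circlepath 0 \<sigma> t) \<subseteq> A"
    proof
      fix x assume "x \<in> closed_segment (circlepath 0 \<rho> t) (circlepath 0 \<sigma> t)"
      then obtain u where u: "0 \<le> u" "u \<le> 1" and x: "x = (1 - u) *\<^sub>R circlepath 0 \<rho> t + u *\<^sub>R circlepath 0 \<sigma> t"
        by (auto simp: closed_segment_def)
      define r where "r = (1 - u) * \<rho> + u * \<sigma>"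
      have "x = circlepath 0 r t"
        unfolding x circlepath r_def by (simp add: scaleR_conv_of_real algebra_simps)
      then have cx: "cmod x = \<bar>r\<bar>" by (simp add: circ)
      have "r \<in> {a<..<b}"
        unfolding r_def using convexD_alt[OF convex_real_interval(8), of \<rho> a b \<sigma> u] \<rho> \<sigma> u by simp
      then show "x \<in> A" using cx a by (auto simp: A_def)
    qed
  qed auto
  have hol: "(\<lambda>z. \<phi> z / z) holomorphic_on A"
    using \<phi> A0 unfolding A_def[symmetric] by (intro holomorphic_intros) auto
  have eq: "contour_integral (circlepath 0 \<rho>) (\<lambda>z. \<phi> z / z) = contour_integral (circlepath 0 \<sigma>) (\<lambda>z. \<phi> z / z)"
    by (rule Cauchy_theorem_homotopic_loops[OF hom oA hol]) auto
  have ci: "contour_integral (circlepath 0 r) (\<lambda>z. \<phi> z / z) = \<i> * (LBINT \<theta>:{0..2*pi}. \<phi> (of_real r * cis \<theta>))"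
    if r: "a < r" "r < b" for r
  proof -
    have r0: "r > 0" using r a by simp
    have cont: "continuous_on {0..2*pi} (\<lambda>\<theta>. \<phi> (of_real r * cis \<theta>))"
      by (rule continuous_on_compose2[OF holomorphic_on_imp_continuous_on[OF \<phi>]])
        (use r r0 in \<open>auto simp: norm_mult intro!: continuous_intros continuous_cis\<close>)
    have "contour_integral (circlepath 0 r) (\<lambda>z. \<phi> z / z)
       = integral {0..2*pi} (\<lambda>t. \<phi> (0 + r * cis t) / (0 + r * cis t) * r * \<i> * cis t)"
      unfolding circlepath_def by (rule contour_integral_part_circlepath_eq) simp
    also have "\<dots> = integral {0..2*pi} (\<lambda>t. \<i> * \<phi> (r * cis t))"
      using r0 by (intro Henstock_Kurzweil_Integration.integral_cong) (simp add: field_simps)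
    also have "\<dots> = \<i> * integral {0..2*pi} (\<lambda>t. \<phi> (r * cis t))"
      by (rule Henstock_Kurzweil_Integration.integral_mult_right)
    also have "integral {0..2*pi} (\<lambda>t. \<phi> (r * cis t)) = (LBINT \<theta>:{0..2*pi}. \<phi> (of_real r * cis \<theta>))"
      by (rule set_borel_integral_eq_integral(2)[symmetric]) (rule borel_integrable_atLeastAtMost'[OF cont])
    finally show ?thesis .
  qed
  show ?thesis using eq ci[OF \<rho>] ci[OF \<sigma>] by simp
qed

lemma holomorphic2_fst:
  assumes "holomorphic2_on f hartogs_triangle"
  shows "(\<lambda>z. f (z, w)) holomorphic_on {z. cmod z < cmod w \<and> cmod w < 1}"
proof (rule holomorphic_onI)
  fix z assume z: "z \<in> {z. cmod z < cmod w \<and> cmod w < 1}"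
  then have "(z, w) \<in> hartogs_triangle" by (simp add: in_triangle)
  then obtain c d where d: "(f has_derivative (\<lambda>(u, v). c * u + d * v)) (at (z, w))"
    using assms unfolding holomorphic2_on_def by blast
  have "((\<lambda>z. (z, w)) has_derivative (\<lambda>h. (h, 0))) (at z)" by (auto intro!: derivative_eq_intros)
  from has_derivative_compose[OF this d]
  have "((\<lambda>z. f (z, w)) has_field_derivative c) (at z)" by (simp add: has_field_derivative_def)
  then have "((\<lambda>z. f (z, w)) has_field_derivative c) (at z within {z. cmod z < cmod w \<and> cmod w < 1})"
    by (rule has_field_derivative_at_within)
  then show "(\<lambda>z. f (z, w)) field_differentiable at z within {z. cmod z < cmod w \<and> cmod w < 1}"
    by (auto simp: field_differentiable_def)
qed

lemma holomorphic2_snd: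
  assumes "holomorphic2_on f hartogs_triangle"
  shows "(\<lambda>w. f (z, w)) holomorphic_on {w. cmod z < cmod w \<and> cmod w < 1}"
proof (rule holomorphic_onI)
  fix w assume w: "w \<in> {w. cmod z < cmod w \<and> cmod w < 1}"
  then have "(z, w) \<in> hartogs_triangle" by (simp add: in_triangle)
  then obtain c d where d: "(f has_derivative (\<lambda>(u, v). c * u + d * v)) (at (z, w))"
    using assms unfolding holomorphic2_on_def by blast
  have "((\<lambda>w. (z, w)) has_derivative (\<lambda>h. (0, h))) (at w)" by (auto intro!: derivative_eq_intros)
  from has_derivative_compose[OF this d]
  have "((\<lambda>w. f (z, w)) has_field_derivative d) (at w)" by (simp add: has_field_derivative_def)
  then have "((\<lambda>w. f (z, w)) has_field_derivative d) (at w within {w. cmod z < cmod w \<and> cmod w < 1})"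
    by (rule has_field_derivative_at_within)
  then show "(\<lambda>w. f (z, w)) field_differentiable at w within {w. cmod z < cmod w \<and> cmod w < 1}"
    by (auto simp: field_differentiable_def)
qed

text \<open>One radius is moved at a time, using holomorphy in the corresponding variable; two arbitrary pairs of
radii are joined through a common smaller first radius, which keeps the path in the triangle.\<close>

lemma torus_integral_radii_const:
  assumes f: "holomorphic2_on f hartogs_triangle" "f \<in> borel_measurable borel"
    and r: "r \<in> radii" "r' \<in> radii"
  shows "(\<integral>p. f (dilate r p) * mon \<beta> (dilate r p) \<partial>torus_measure)
    = (\<integral>p. f (dilate r' p) * mon \<beta> (dilate r' p) \<partial>torus_measure)"
proof -
  define g where "g = (\<lambda>p. f p * mon \<beta> p)"
  define \<Phi> where "\<Phi> = (\<lambda>r. \<integral>p. g (dilate r p) \<partial>torus_measure)"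
  note [measurable] = f(2)
  define \<Omega> where "\<Omega> = {p \<in> hartogs_triangle. fst p \<noteq> 0}"
  have gc: "continuous_on \<Omega> g"
    unfolding g_def mon_def
    by (intro continuous_intros continuous_on_subset[OF holomorphic2_continuous[OF f(1)]])
      (auto simp: \<Omega>_def dest: triangle_snd_nonzero)
  have int: "integrable torus_measure (\<lambda>p. g (dilate r p))" if r: "r \<in> radii" for r
  proof -
    have "dilate r p \<in> \<Omega>" if "cmod (fst p) = 1" "cmod (snd p) = 1" for p
      using dilate_in_triangle[OF r that] r that by (auto simp: \<Omega>_def dilate_def radii_def)
    from bounded_dilate[OF gc this] obtain B where "AE p in torus_measure. cmod (g (dilate r p)) \<le> B" by blast
    then show ?thesis by (intro integrable_torus_bounded) (simp add: g_def, measurable)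
  qed
  have hol1: "(\<lambda>z. g (z, w)) holomorphic_on {z. 0 < cmod z \<and> cmod z < cmod w}" if w: "cmod w < 1" for w
    unfolding g_def mon_def
    by (intro holomorphic_intros holomorphic_on_subset[OF holomorphic2_fst[OF f(1), of w]]) (use w in auto)
  have hol2: "(\<lambda>w. g (z, w)) holomorphic_on {w. cmod z < cmod w \<and> cmod w < 1}" if "z \<noteq> 0" for z
    unfolding g_def mon_def
    by (intro holomorphic_intros holomorphic_on_subset[OF holomorphic2_snd[OF f(1), of z]])
      (use that in \<open>auto dest: le_less_trans[OF norm_ge_zero]\<close>)
  have move1: "\<Phi> (x, y) = \<Phi> (x', y)" if "(x, y) \<in> radii" "(x', y) \<in> radii" for x x' y
  proof -
    have "(LBINT \<theta>:{0..2*pi}. g (of_real x * cis \<theta>, of_real y * cis \<gamma>))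
       = (LBINT \<theta>:{0..2*pi}. g (of_real x' * cis \<theta>, of_real y * cis \<gamma>))" for \<gamma>
      using that by (intro circle_integral_const[OF hol1]) (auto simp: radii_def norm_mult)
    then show ?thesis unfolding \<Phi>_def integral_torus_snd[OF int[OF that(1)]] integral_torus_snd[OF int[OF that(2)]]
      by (simp add: dilate_def)
  qed
  have move2: "\<Phi> (x, y) = \<Phi> (x, y')" if "(x, y) \<in> radii" "(x, y') \<in> radii" for x y y'
  proof -
    have "(LBINT \<gamma>:{0..2*pi}. g (of_real x * cis \<theta>, of_real y * cis \<gamma>))
       = (LBINT \<gamma>:{0..2*pi}. g (of_real x * cis \<theta>, of_real y' * cis \<gamma>))" for \<theta>
      using that by (intro circle_integral_const[OF hol2]) (auto simp: radii_def norm_mult)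
    then show ?thesis unfolding \<Phi>_def integral_torus_fst[OF int[OF that(1)]] integral_torus_fst[OF int[OF that(2)]]
      by (simp add: dilate_def)
  qed
  obtain x y x' y' where xy: "r = (x, y)" "r' = (x', y')" by (cases r, cases r')
  define m where "m = min x x'"
  have "(m, y) \<in> radii" "(m, y') \<in> radii" using r xy by (auto simp: m_def radii_def)
  then have "\<Phi> r = \<Phi> r'" unfolding xy using move1[of x y m] move2[of m y y'] move1[of m y' x'] r xy by simp
  then show ?thesis by (simp add: \<Phi>_def g_def)
qed

text \<open>Dividing the Fourier coefficient by the monomial in the radii gives the integral of \<open>f\<close> times a
monomial over the torus, which does not depend on the radii.\<close>

lemma laurent_coef_exists:
  assumes f: "holomorphic2_on f hartogs_triangle" "f \<in> borel_measurable borel"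
  shows "\<exists>K. \<forall>r\<in>radii. \<forall>\<alpha>. fcoef (\<lambda>p. f (dilate r p)) \<alpha> = K \<alpha> * of_real (rpow \<alpha> r)"
proof -
  note [measurable] = f(2)
  \<comment> \<open>Any pair of admissible radii serves as the base point.\<close>
  define K where "K = (\<lambda>\<alpha>. \<integral>p. f (dilate (1/4, 1/2) p) * mon (- \<alpha>) (dilate (1/4, 1/2) p) \<partial>torus_measure)"
  have r0: "(1/4, 1/2) \<in> radii" by (simp add: radii_def)
  have "fcoef (\<lambda>p. f (dilate r p)) \<alpha> = K \<alpha> * of_real (rpow \<alpha> r)" if r: "r \<in> radii" for r \<alpha>
  proof -
    have r1: "rpow \<alpha> r * rpow (- \<alpha>) r = 1"
      using r by (simp add: rpow_def radii_def power_int_minus field_simps)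
    have "K \<alpha> = (\<integral>p. f (dilate r p) * mon (- \<alpha>) (dilate r p) \<partial>torus_measure)"
      unfolding K_def by (rule torus_integral_radii_const[OF f r0 r])
    also have "\<dots> = (\<integral>p. of_real (rpow (- \<alpha>) r) * (f (dilate r p) * cnj (mon \<alpha> p)) \<partial>torus_measure)"
    proof (rule integral_cong_AE)
      show "AE p in torus_measure. f (dilate r p) * mon (- \<alpha>) (dilate r p)
         = of_real (rpow (- \<alpha>) r) * (f (dilate r p) * cnj (mon \<alpha> p))"
        using AE_torus by eventually_elim (simp add: mon_dilate cnj_mon)
    qed measurable
    also have "\<dots> = of_real (rpow (- \<alpha>) r) * fcoef (\<lambda>p. f (dilate r p)) \<alpha>" by (simp add: fcoef_def)
    finally show ?thesis using r1 by (simp add: mult.commute mult.assoc[symmetric] flip: of_real_mult)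
  qed
  then show ?thesis by blast
qed

text \<open>The zero set of a continuous function is closed, and a closed set that contains almost every point of
an open box contains the box, hence also its closure.\<close>

lemma AE_zero_continuous_torus:
  fixes h :: "complex \<times> complex \<Rightarrow> complex"
  assumes c: "continuous_on {p. cmod (fst p) = 1 \<and> cmod (snd p) = 1} h"
    and m: "h \<in> borel_measurable borel" and z: "AE p in torus_measure. h p = 0"
    and p: "cmod (fst p) = 1" "cmod (snd p) = 1"
  shows "h p = 0"
proof -
  define k where "k = (\<lambda>x. h (torus_param x))"
  have tc: "continuous_on UNIV torus_param"
    by (auto simp: case_prod_unfold intro!: continuous_intros continuous_on_compose2[OF continuous_cis])
  have kc: "continuous_on UNIV k" unfolding k_def
    by (rule continuous_on_compose2[OF c tc]) auto
  have km: "{x. h x = 0} \<in> sets borel" using m by measurable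
  have cbx: "cbox (0, 0) (2*pi, 2*pi) = param_box" by (auto simp: cbox_Pair_eq)
  have "AE x in uniform_measure lborel param_box. k x = 0"
    using z unfolding torus_measure_def k_def by (subst (asm) AE_distr_iff) (use km in auto)
  then have "AE x in lborel. x \<in> param_box \<longrightarrow> k x = 0"
    by (subst (asm) AE_uniform_measure) (auto simp: emeasure_param_box)
  then have "AE x in lborel. x \<in> box (0, 0) (2*pi, 2*pi) \<longrightarrow> x \<in> {x. k x = 0}"
    by eventually_elim (use box_subset_cbox[of "(0,0)" "(2*pi,2*pi)"] cbx in auto)
  then have ae: "AE x in lebesgue. x \<in> box (0, 0) (2*pi, 2*pi) \<longrightarrow> x \<in> {x. k x = 0}"
    by (rule AE_completion)
  have cl: "closed {x. k x = 0}"
    by (intro closed_Collect_eq kc continuous_intros)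
  have zero: "k x = 0" if "x \<in> box (0, 0) (2*pi, 2*pi)" for x
    using mem_closed_if_AE_lebesgue_open[OF open_box cl ae that] by simp
  have "(pi, pi) \<in> box (0, 0) (2*pi, 2*pi)" by (auto simp: mem_box Basis_prod_def)
  then have "box (0, 0) (2*pi, 2*pi) \<noteq> {}" by blast
  then have clo: "closure (box (0, 0) (2*pi, 2*pi)) = param_box"
    using closure_box cbx by metis
  have "fst p = cis (Arg2pi (fst p))" "snd p = cis (Arg2pi (snd p))"
    using Arg2pi_eq[of "fst p"] Arg2pi_eq[of "snd p"] p by (simp_all add: cis_conv_exp)
  then have "h p = k (Arg2pi (fst p), Arg2pi (snd p))" unfolding k_def by (metis case_prod_conv prod.collapse)
  also have "\<dots> = 0"
  proof (rule continuous_constant_on_closure[of "box (0, 0) (2*pi, 2*pi)" k])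
    show "continuous_on (closure (box (0, 0) (2*pi, 2*pi))) k" using kc continuous_on_subset by blast
    show "(Arg2pi (fst p), Arg2pi (snd p)) \<in> closure (box (0, 0) (2*pi, 2*pi))"
      unfolding clo using Arg2pi_ge_0 Arg2pi_lt_2pi by (auto intro: less_imp_le)
  qed (rule zero)
  finally show ?thesis .
qed

text \<open>A Hardy function and the sum of its Laurent series have the same Fourier coefficients on each torus,
so they agree there. The tori cover the triangle except for the disc \<open>z = 0\<close>, which is reached by
continuity.\<close>

theorem hardy_eq_ev: "hardy = ev ` hardy_coefs"
proof
  show "ev ` hardy_coefs \<subseteq> hardy" using ev_in_hardy by blast
  show "hardy \<subseteq> ev ` hardy_coefs"
  proof
    fix f assume "f \<in> hardy"
    then have hol: "holomorphic2_on f hartogs_triangle" and out: "\<And>p. p \<notin> hartogs_triangle \<Longrightarrow> f p = 0"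
      and fin: "hardy_ennorm2 f < \<infinity>" by (auto simp: hardy_def)
    have fc: "continuous_on hartogs_triangle f" by (rule holomorphic2_continuous[OF hol])
    have fm [measurable]: "f \<in> borel_measurable borel" by (rule measurable_of_continuous_triangle[OF fc out])
    define M where "M = enn2real (hardy_ennorm2 f)"
    have M: "hardy_ennorm2 f \<le> ennreal M" "0 \<le> M" using fin by (auto simp: M_def)
    obtain K where K: "\<And>r \<alpha>. r \<in> radii \<Longrightarrow> fcoef (\<lambda>p. f (dilate r p)) \<alpha> = K \<alpha> * of_real (rpow \<alpha> r)"
      using laurent_coef_exists[OF hol fm] by blast
    define a where "a = Abs_ell2 K"
    have "(\<lambda>\<alpha>. (cmod (K \<alpha>))\<^sup>2) summable_on UNIV"
      by (rule square_summable_bounded[OF hardy_coef_sum_le[OF fc fm K M]])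
    then have ca: "coef a = K" unfolding a_def by (rule coef_Abs_ell2)
    have aH: "a \<in> hardy_coefs" unfolding hardy_coefs_def mem_Collect_eq ca
      by (intro allI impI) (rule hardy_coef_outside[OF fc fm K M])
    have on_circle: "f (dilate r p) = ev a (dilate r p)"
      if r: "r \<in> radii" and p: "cmod (fst p) = 1" "cmod (snd p) = 1" for r p
    proof -
      have L: "(\<lambda>p. f (dilate r p)) \<in> L2_torus" "(\<lambda>p. ev a (dilate r p)) \<in> L2_torus"
        by (rule L2_dilate[OF fc fm r] L2_dilate[OF continuous_ev measurable_ev r])+
      have ae: "AE p in torus_measure. f (dilate r p) = ev a (dilate r p)"
        by (rule L2_fcoef_unique[OF L]) (simp only: K[OF r] fcoef_ev[OF aH r] ca)
      have "f (dilate r p) - ev a (dilate r p) = 0"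
      proof (rule AE_zero_continuous_torus[where h="\<lambda>p. f (dilate r p) - ev a (dilate r p)", OF _ _ _ p])
        show "continuous_on {p. cmod (fst p) = 1 \<and> cmod (snd p) = 1} (\<lambda>p. f (dilate r p) - ev a (dilate r p))"
          by (intro continuous_on_diff continuous_on_compose2[OF fc continuous_dilate]
              continuous_on_compose2[OF continuous_ev continuous_dilate])
            (use dilate_in_triangle[OF r] in auto)
        show "AE p in torus_measure. f (dilate r p) - ev a (dilate r p) = 0" using ae by simp
      qed measurable
      then show ?thesis by simp
    qed
    have nz: "f p = ev a p" if p: "p \<in> hartogs_triangle" "fst p \<noteq> 0" for p
    proof -
      obtain z w where zw: "p = (z, w)" by force
      have c: "0 < cmod z" "cmod z < cmod w" "cmod w < 1" using p zw by (auto simp: in_triangle)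
      have zw0: "z \<noteq> 0" "w \<noteq> 0" using c by auto
      have "(cmod z, cmod w) \<in> radii" using c by (simp add: radii_def)
      moreover have "p = dilate (cmod z, cmod w) (sgn z, sgn w)"
        using c zw0 by (simp add: zw dilate_def sgn_div_norm scaleR_conv_of_real)
      ultimately show ?thesis
        using on_circle[of "(cmod z, cmod w)" "(sgn z, sgn w)"] zw0 by (simp add: norm_sgn)
    qed
    have "f p = ev a p" for p
    proof (cases "p \<in> hartogs_triangle")
      case True
      show ?thesis
      proof (cases "fst p = 0")
        case z: True
        obtain w where w: "p = (0, w)" using z by (metis prod.collapse)
        have w1: "0 < cmod w" "cmod w < 1" using True w by (auto simp: in_triangle)
        define x where "x = (\<lambda>n::nat. (of_real (cmod w / of_nat (n + 2)) :: complex, w))"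
        have xin: "x n \<in> hartogs_triangle" "fst (x n) \<noteq> 0" for n
        proof -
          have "cmod w / of_nat (n + 2) < cmod w"
            using w1(1) mult_strict_left_mono[OF _ w1(1), of 1 "real (n + 2)"]
            by (simp add: pos_divide_less_eq)
          then show "x n \<in> hartogs_triangle" using w1
            by (simp add: x_def in_triangle del: of_nat_add of_real_divide)
          show "fst (x n) \<noteq> 0" using w1 by (auto simp: x_def simp del: of_nat_add of_real_divide)
        qed
        have "(\<lambda>n. cmod w / of_nat (n + 2)) \<longlonglongrightarrow> 0"
          by (intro tendsto_divide_0[OF tendsto_const] filterlim_at_top_imp_at_infinity
              filterlim_compose[OF filterlim_real_sequentially] filterlim_add_const_nat_at_top)
        then have "(\<lambda>n. of_real (cmod w / of_nat (n + 2)) :: complex) \<longlonglongrightarrow> of_real 0" by (rule tendsto_of_real)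
        then have lim: "x \<longlonglongrightarrow> p" unfolding w x_def by (intro tendsto_Pair tendsto_const) simp
        have "(\<lambda>n. f (x n)) \<longlonglongrightarrow> f p"
          by (rule continuous_on_tendsto_compose[OF fc lim True]) (simp add: xin)
        moreover have "(\<lambda>n. ev a (x n)) \<longlonglongrightarrow> ev a p"
          by (rule continuous_on_tendsto_compose[OF continuous_ev lim True]) (simp add: xin)
        ultimately show ?thesis using nz[OF xin] LIMSEQ_unique by simp
      qed (use nz True in blast)
    qed (simp add: out ev_outside)
    then have "f = ev a" by blast
    then show "f \<in> ev ` hardy_coefs" using aH by blast
  qed
qed

section \<open>Multiplication operators and inner product on coefficients\<close>

abbreviation ez :: "int \<times> int" where "ez \<equiv> (1, 0)"
abbreviation ew :: "int \<times> int" where "ew \<equiv> (0, 1)"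

lemma ev_zero: "ev 0 = (\<lambda>_. 0)" by (rule ext) (simp add: ev_def)

lemma hardy_coefs_add: "a \<in> hardy_coefs \<Longrightarrow> b \<in> hardy_coefs \<Longrightarrow> a + b \<in> hardy_coefs" unfolding hardy_coefs_def by simp
lemma hardy_coefs_cscale: "a \<in> hardy_coefs \<Longrightarrow> cscale k a \<in> hardy_coefs" unfolding hardy_coefs_def by simp
lemma hardy_coefs_diff: "a \<in> hardy_coefs \<Longrightarrow> b \<in> hardy_coefs \<Longrightarrow> a - b \<in> hardy_coefs" unfolding hardy_coefs_def by simp
lemma hardy_coefs_zero: "0 \<in> hardy_coefs" unfolding hardy_coefs_def by simp

lemma ev_inj: "a \<in> hardy_coefs \<Longrightarrow> b \<in> hardy_coefs \<Longrightarrow> ev a = ev b \<Longrightarrow> a = b"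
proof -
  assume a: "a \<in> hardy_coefs" "b \<in> hardy_coefs" "ev a = ev b"
  then have "ev (a - b) = ev 0" by (auto simp: ev_diff ev_zero)
  then have "norm (a - b) = norm (0 :: (int \<times> int) ell2)"
    using hardy_norm_ev[OF hardy_coefs_diff[OF a(1,2)]] hardy_norm_ev[OF hardy_coefs_zero] by simp
  then show ?thesis by simp
qed

lemma continuous_coef: "continuous_on UNIV (\<lambda>a. coef a i)"
  unfolding continuous_on_iff dist_norm
  by (metis coef_diff norm_coef_le order_le_less_trans)

lemma closed_hardy_coefs: "closed hardy_coefs"
proof -
  have "hardy_coefs = (\<Inter>\<alpha>\<in>- index_set. {a. coef a \<alpha> = 0})" unfolding hardy_coefs_def by blast
  moreover have "closed (\<Inter>\<alpha>\<in>- index_set. {a. coef a \<alpha> = 0})"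
    by (intro closed_INT ballI closed_Collect_eq continuous_coef continuous_on_const)
  ultimately show ?thesis by simp
qed

lemma continuous_shift: "continuous_on A (shift \<beta>)"
  unfolding continuous_on_iff dist_norm by (metis norm_shift shift_diff)

lemma mon_add_nonneg:
  assumes "0 \<le> fst \<alpha>" "0 \<le> fst \<beta>" "snd p \<noteq> 0"
  shows "mon (\<alpha> + \<beta>) p = mon \<beta> p * mon \<alpha> p"
proof -
  have "fst p powi (fst \<alpha> + fst \<beta>) = fst p powi fst \<alpha> * fst p powi fst \<beta>"
    using assms by (simp add: power_int_def nat_add_distrib power_add)
  moreover have "snd p powi (snd \<alpha> + snd \<beta>) = snd p powi snd \<alpha> * snd p powi snd \<beta>"
    using assms by (simp add: power_int_add)
  ultimately show ?thesis by (simp add: mon_def)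
qed

lemma hardy_coefs_shift:
  assumes a: "a \<in> hardy_coefs" and \<beta>: "0 \<le> fst \<beta>" "0 \<le> fst \<beta> + snd \<beta>"
  shows "shift \<beta> a \<in> hardy_coefs"
proof -
  have "coef a (\<alpha> - \<beta>) = 0" if "\<alpha> \<notin> index_set" for \<alpha>
    by (rule hardy_coefs_outside[OF a]) (use that \<beta> in \<open>auto simp: index_set_def case_prod_unfold\<close>)
  then show ?thesis unfolding hardy_coefs_def by simp
qed

lemma ev_shift:
  assumes a: "a \<in> hardy_coefs" and \<beta>: "0 \<le> fst \<beta>" "0 \<le> fst \<beta> + snd \<beta>" and p: "p \<in> hartogs_triangle"
  shows "ev (shift \<beta> a) p = mon \<beta> p * ev a p"
proof -
  have "((\<lambda>\<alpha>. mon \<beta> p * (coef a \<alpha> * mon \<alpha> p)) has_sum mon \<beta> p * ev a p) index_set"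
    by (rule has_sum_cmult_right[OF has_sum_ev[OF p]])
  then have "((\<lambda>\<alpha>. coef a \<alpha> * mon (\<alpha> + \<beta>) p) has_sum mon \<beta> p * ev a p) index_set"
    by (rule has_sum_cong[THEN iffD1, rotated])
      (use \<beta>(1) triangle_snd_nonzero[OF p] in \<open>auto simp: index_set_def mon_add_nonneg\<close>)
  then have "((\<lambda>\<alpha>. coef a (\<alpha> - \<beta>) * mon \<alpha> p) has_sum mon \<beta> p * ev a p) ((\<lambda>\<alpha>. \<alpha> + \<beta>) ` index_set)"
    by (subst has_sum_reindex) (auto simp: inj_on_def o_def)
  moreover have "(\<lambda>\<alpha>. \<alpha> + \<beta>) ` index_set \<subseteq> index_set"
    using \<beta> by (cases \<beta>) (auto simp: index_set_def)
  moreover have "coef a (\<alpha> - \<beta>) = 0" if "\<alpha> \<notin> (\<lambda>\<alpha>. \<alpha> + \<beta>) ` index_set" for \<alpha>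
  proof (rule hardy_coefs_outside[OF a])
    show "\<alpha> - \<beta> \<notin> index_set" using that by (metis diff_add_cancel imageI)
  qed
  ultimately have "((\<lambda>\<alpha>. coef (shift \<beta> a) \<alpha> * mon \<alpha> p) has_sum mon \<beta> p * ev a p) index_set"
    by (subst has_sum_cong_neutral[where T="(\<lambda>\<alpha>. \<alpha> + \<beta>) ` index_set" and g="\<lambda>\<alpha>. coef a (\<alpha> - \<beta>) * mon \<alpha> p"]) auto
  then show ?thesis using has_sum_ev[OF p] has_sum_unique by blast
qed

lemma mult_z_ev: "a \<in> hardy_coefs \<Longrightarrow> mult_z (ev a) = ev (shift ez a)"
proof (rule ext)
  fix p assume a: "a \<in> hardy_coefs"
  show "mult_z (ev a) p = ev (shift ez a) p"
    using ev_shift[OF a, of ez p] ev_outside[of p]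
    by (cases "p \<in> hartogs_triangle") (auto simp: mult_z_def mon_def case_prod_unfold)
qed

lemma mult_w_ev: "a \<in> hardy_coefs \<Longrightarrow> mult_w (ev a) = ev (shift ew a)"
proof (rule ext)
  fix p assume a: "a \<in> hardy_coefs"
  show "mult_w (ev a) p = ev (shift ew a) p"
    using ev_shift[OF a, of ew p] ev_outside[of p]
    by (cases "p \<in> hartogs_triangle") (auto simp: mult_w_def mon_def case_prod_unfold)
qed

lemma polarization:
  "(of_real ((norm (a + b))\<^sup>2) - of_real ((norm (a - b))\<^sup>2)
      + \<i> * of_real ((norm (a + cscale \<i> b))\<^sup>2)
      - \<i> * of_real ((norm (a - cscale \<i> b))\<^sup>2)) / 4 = cinner a b"
proof -
  have m: "(norm (a - c))\<^sup>2 = (norm a)\<^sup>2 + (norm c)\<^sup>2 - 2 * Re (cinner a c)" for c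
    using norm_ell2_sq_add[of a "- c"] cinner_diff_right[of a 0 c] by simp
  show ?thesis
    unfolding m norm_ell2_sq_add by (simp add: cinner_cscale_right complex_eq_iff)
qed

lemma hardy_inner_ev:
  assumes a: "a \<in> hardy_coefs" and b: "b \<in> hardy_coefs"
  shows "hardy_inner (ev a) (ev b) = cinner a b"
proof -
  have "(\<lambda>p. ev a p + ev b p) = ev (a + b)" "(\<lambda>p. ev a p - ev b p) = ev (a - b)"
    "(\<lambda>p. ev a p + \<i> * ev b p) = ev (a + cscale \<i> b)" "(\<lambda>p. ev a p - \<i> * ev b p) = ev (a - cscale \<i> b)"
    by (auto simp: ev_add ev_diff ev_cscale)
  then show ?thesis
    unfolding hardy_inner_def using polarization[of a b] a b
    by (simp add: hardy_norm_ev hardy_coefs_add hardy_coefs_diff hardy_coefs_cscale)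
qed

section \<open>Wandering vectors of invariant subspaces\<close>

definition csubspace_closed :: "(int \<times> int) ell2 set \<Rightarrow> bool" where
  "csubspace_closed M \<longleftrightarrow> 0 \<in> M \<and> (\<forall>a\<in>M. \<forall>b\<in>M. a + b \<in> M) \<and> (\<forall>k. \<forall>a\<in>M. cscale k a \<in> M) \<and> closed M"

lemma csubspace_zero: "csubspace_closed M \<Longrightarrow> 0 \<in> M" by (simp add: csubspace_closed_def)
lemma csubspace_add: "csubspace_closed M \<Longrightarrow> a \<in> M \<Longrightarrow> b \<in> M \<Longrightarrow> a + b \<in> M"
  by (simp add: csubspace_closed_def)
lemma csubspace_cscale: "csubspace_closed M \<Longrightarrow> a \<in> M \<Longrightarrow> cscale k a \<in> M"
  by (simp add: csubspace_closed_def)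
lemma csubspace_diff: "csubspace_closed M \<Longrightarrow> a \<in> M \<Longrightarrow> b \<in> M \<Longrightarrow> a - b \<in> M"
  using csubspace_add[of M a "cscale (-1) b"] csubspace_cscale[of M b "-1"] by (simp add: cscale_minus_one)
lemma csubspace_closedD: "csubspace_closed M \<Longrightarrow> closed M" by (simp add: csubspace_closed_def)
lemma csubspace_sum: "csubspace_closed M \<Longrightarrow> (\<And>x. x \<in> F \<Longrightarrow> f x \<in> M) \<Longrightarrow> sum f F \<in> M"
  by (induction F rule: infinite_finite_induct) (auto simp: csubspace_zero csubspace_add)

lemma csubspace_projection:
  assumes M: "csubspace_closed M"
  shows "\<exists>p\<in>M. \<forall>m\<in>M. cinner (x - p) m = 0"
proof (rule complex_projection_exists)
  show "subspace M" unfolding subspace_def scaleR_ell2_def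
    using M by (simp add: csubspace_closed_def)
qed (use M in \<open>auto simp: csubspace_closed_def\<close>)

lemma csubspace_hardy_coefs: "csubspace_closed hardy_coefs"
  by (simp add: csubspace_closed_def hardy_coefs_zero hardy_coefs_add hardy_coefs_cscale closed_hardy_coefs)

lemma csubspace_shift:
  assumes M: "csubspace_closed M"
  shows "csubspace_closed (shift \<beta> ` M)"
proof -
  have eq: "shift \<beta> ` M = shift (- \<beta>) -` M"
  proof (intro equalityI subsetI)
    fix x assume "x \<in> shift (- \<beta>) -` M"
    then have "x = shift \<beta> (shift (- \<beta>) x)" "shift (- \<beta>) x \<in> M" by (auto simp: shift_shift)
    then show "x \<in> shift \<beta> ` M" by blast
  qed (auto simp: shift_shift)
  show ?thesis unfolding eq csubspace_closed_def
    using M closed_vimage[OF csubspace_closedD[OF M] continuous_shift]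
    by (auto simp: csubspace_zero csubspace_add csubspace_cscale shift_add shift_cscale)
qed

text \<open>The orthogonal complement of the shifted space within \<open>M\<close>: for closed invariant \<open>M\<close>, the
kernel of the adjoint of the shift on \<open>M\<close>.\<close>

definition defect :: "(int \<times> int) ell2 set \<Rightarrow> int \<times> int \<Rightarrow> (int \<times> int) ell2 set" where
  "defect M \<beta> = {e \<in> M. \<forall>x\<in>M. cinner (shift \<beta> x) e = 0}"

lemma defectD: "e \<in> defect M \<beta> \<Longrightarrow> x \<in> M \<Longrightarrow> cinner (shift \<beta> x) e = 0"
  by (simp add: defect_def)

lemma cinner_zero_commute: "cinner a b = 0 \<Longrightarrow> cinner b a = 0"
  by (subst cinner_commute) simp

lemma csubspace_defect:
  assumes M: "csubspace_closed M"
  shows "csubspace_closed (defect M \<beta>)"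
proof -
  have "defect M \<beta> = M \<inter> (\<Inter>x\<in>M. {e. cinner e (shift \<beta> x) = 0})"
    unfolding defect_def using cinner_zero_commute by blast
  moreover have "closed {e. cinner e y = 0}" for y :: "(int \<times> int) ell2"
    by (intro closed_Collect_eq continuous_on_const)
      (auto simp: continuous_on_def intro!: tendsto_cinner_left tendsto_ident_at)
  ultimately have "closed (defect M \<beta>)" using csubspace_closedD[OF M]
    by (simp add: closed_Int closed_INT)
  then show ?thesis unfolding csubspace_closed_def
    by (auto simp: defect_def csubspace_zero[OF M] csubspace_add[OF M] csubspace_cscale[OF M]
        cinner_add_right cinner_cscale_right)
qed

lemma defect_decomposition:
  assumes M: "csubspace_closed M" and inv: "\<And>x. x \<in> M \<Longrightarrow> shift \<beta> x \<in> M" and t: "t \<in> M"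
  shows "\<exists>e\<in>defect M \<beta>. \<exists>c\<in>M. t = e + shift \<beta> c"
proof -
  obtain p where p: "p \<in> shift \<beta> ` M" "\<And>m. m \<in> shift \<beta> ` M \<Longrightarrow> cinner (t - p) m = 0"
    using csubspace_projection[OF csubspace_shift[OF M, of \<beta>], of t] by blast
  then obtain c where c: "c \<in> M" "p = shift \<beta> c" by blast
  have "t - p \<in> defect M \<beta>" unfolding defect_def
    using p(2) cinner_zero_commute csubspace_diff[OF M t] inv[OF c(1)] c(2) by blast
  then show ?thesis using c by (intro bexI[of _ "t - p"] bexI[of _ c]) auto
qed

text \<open>Otherwise every element of \<open>M\<close> would be a shift by \<open>n \<beta>\<close> of an element of \<open>M\<close>, for every \<open>n\<close>, and
each of its coefficients would come from a coefficient off \<^const>\<open>index_set\<close>.\<close>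

lemma defect_nonzero:
  assumes M: "csubspace_closed M" and MH: "M \<subseteq> hardy_coefs" and inv: "\<And>x. x \<in> M \<Longrightarrow> shift \<beta> x \<in> M"
    and ne: "x \<in> M" "x \<noteq> 0"
    and pure: "\<And>\<alpha>. \<exists>n::nat. \<alpha> - (of_nat n * fst \<beta>, of_nat n * snd \<beta>) \<notin> index_set"
  shows "\<exists>q\<in>defect M \<beta>. q \<noteq> 0"
proof (rule ccontr)
  assume "\<not> ?thesis"
  then have zero: "e = 0" if "e \<in> defect M \<beta>" for e using that by blast
  have all: "\<exists>c\<in>M. t = shift \<beta> c" if "t \<in> M" for t
  proof -
    obtain e c where "e \<in> defect M \<beta>" "c \<in> M" "t = e + shift \<beta> c"
      using defect_decomposition[OF M inv \<open>t \<in> M\<close>] by blast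
    then show ?thesis using zero by (intro bexI[of _ c]) auto
  qed
  have it: "\<exists>c\<in>M. t = shift (of_nat n * fst \<beta>, of_nat n * snd \<beta>) c" if "t \<in> M" for t n
    using that
  proof (induction n arbitrary: t)
    case 0
    then show ?case by (auto simp: zero_prod_def[symmetric])
  next
    case (Suc n)
    obtain c where c: "c \<in> M" "t = shift (of_nat n * fst \<beta>, of_nat n * snd \<beta>) c" using Suc by blast
    obtain d where d: "d \<in> M" "c = shift \<beta> d" using all[OF c(1)] by blast
    have "(of_nat n * fst \<beta>, of_nat n * snd \<beta>) + \<beta> = (of_nat (Suc n) * fst \<beta>, of_nat (Suc n) * snd \<beta>)"
      by (cases \<beta>) (simp add: algebra_simps)
    then show ?case using c d by (auto simp: shift_shift)
  qed
  have "coef x \<alpha> = 0" for \<alpha>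
  proof -
    obtain n where n: "\<alpha> - (of_nat n * fst \<beta>, of_nat n * snd \<beta>) \<notin> index_set" using pure by blast
    obtain c where "c \<in> M" "x = shift (of_nat n * fst \<beta>, of_nat n * snd \<beta>) c" using it[OF ne(1)] by blast
    then show ?thesis using hardy_coefs_outside[OF _ n, of c] MH by auto
  qed
  then show False using ne(2) ell2_eqI[of x 0] by simp
qed

lemma pure_z: "\<exists>n::nat. \<alpha> - (of_nat n * fst ez, of_nat n * snd ez) \<notin> index_set"
  by (intro exI[of _ "nat (fst \<alpha> + 1)"]) (cases \<alpha>, auto simp: index_set_def)
lemma pure_w: "\<exists>n::nat. \<alpha> - (of_nat n * fst ew, of_nat n * snd ew) \<notin> index_set"
  by (intro exI[of _ "nat (fst \<alpha> + snd \<alpha> + 2)"]) (cases \<alpha>, auto simp: index_set_def)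

lemma shift_power_mem:
  assumes "\<And>x. x \<in> M \<Longrightarrow> shift \<beta> x \<in> M" "x \<in> M"
  shows "shift (of_nat n * fst \<beta>, of_nat n * snd \<beta>) x \<in> M"
proof (induction n)
  case 0
  then show ?case using assms(2) by (simp add: zero_prod_def[symmetric])
next
  case (Suc n)
  have "shift (of_nat (Suc n) * fst \<beta>, of_nat (Suc n) * snd \<beta>) x = shift \<beta> (shift (of_nat n * fst \<beta>, of_nat n * snd \<beta>) x)"
    by (cases \<beta>) (simp add: shift_shift algebra_simps)
  then show ?case using assms(1)[OF Suc] by simp
qed

lemma shift_nat_mem:
  assumes "\<And>x. x \<in> M \<Longrightarrow> shift ez x \<in> M" "\<And>x. x \<in> M \<Longrightarrow> shift ew x \<in> M" "x \<in> M"
  shows "shift (int m, int n) x \<in> M"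
  using shift_power_mem[of M ez, OF assms(1) shift_power_mem[of M ew, OF assms(2,3), of n], of m]
  by (simp add: shift_shift)

text \<open>The hypothesis \<open>dc\<close> is double commutativity in terms of the defect space: the kernel of the adjoint of
multiplication by \<open>z\<close> is invariant under \<open>w\<close>. It holds with the roles of \<open>z\<close> and \<open>w\<close> exchanged as well,
and this symmetry settles the exponents of mixed sign.\<close>

proposition wandering_vector:
  assumes T: "csubspace_closed T" and TH: "T \<subseteq> hardy_coefs" and ne: "t0 \<in> T" "t0 \<noteq> 0"
    and inv: "\<And>x. x \<in> T \<Longrightarrow> shift ez x \<in> T" "\<And>x. x \<in> T \<Longrightarrow> shift ew x \<in> T"
    and dc: "\<And>e. e \<in> defect T ez \<Longrightarrow> shift ew e \<in> defect T ez"
  shows "\<exists>q\<in>T. (\<forall>\<alpha>. cinner (shift \<alpha> q) q = (if \<alpha> = 0 then 1 else 0)) \<and>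
     (\<forall>r\<in>T. (\<forall>m n::nat. cinner r (shift (int m, int n) q) = 0) \<longrightarrow> r = 0)"
proof -
  define E where "E = defect T ez"
  have E: "csubspace_closed E" unfolding E_def by (rule csubspace_defect[OF T])
  have ET: "E \<subseteq> T" by (auto simp: E_def defect_def)
  obtain e where e: "e \<in> E" "e \<noteq> 0"
    using defect_nonzero[OF T TH inv(1) ne pure_z] unfolding E_def by blast
  have invE: "shift ew x \<in> E" if "x \<in> E" for x using dc that unfolding E_def .
  have EH: "E \<subseteq> hardy_coefs" using ET TH by (rule subset_trans)
  obtain q0 where q0: "q0 \<in> defect E ew" "q0 \<noteq> 0"
    using defect_nonzero[OF E EH invE e pure_w] by auto
  \<comment> \<open>A unit vector in \<open>E \<ominus> wE\<close>.\<close>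
  define q where "q = cscale (of_real (1 / norm q0)) q0"
  have qd: "q \<in> defect E ew" unfolding q_def by (rule csubspace_cscale[OF csubspace_defect[OF E] q0(1)])
  have nq: "norm q = 1" using q0(2) by (simp add: q_def norm_cscale norm_divide)
  have qE: "q \<in> E" using qd by (simp add: defect_def)
  have qT: "q \<in> T" using qE ET by blast
  have E0: "cinner (shift ez x) y = 0" if "x \<in> T" "y \<in> E" for x y
    using defectD[of y T "ez" x] that unfolding E_def by simp
  have dec: "\<exists>e\<in>E. \<exists>c\<in>T. t = e + shift ez c" if "t \<in> T" for t
    using defect_decomposition[OF T inv(1) that] unfolding E_def .
  define E2 where "E2 = defect T ew"
  \<comment> \<open>Being orthogonal to \<open>wE\<close> and to \<open>zT\<close>, the vector \<open>q\<close> is orthogonal to all of \<open>wT\<close>.\<close>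
  have qE2: "q \<in> E2" unfolding E2_def defect_def
  proof (intro CollectI conjI ballI qT)
    fix t assume "t \<in> T"
    then obtain e c where ec: "e \<in> E" "c \<in> T" "t = e + shift ez c" using dec by blast
    have "cinner (shift ew t) q = cinner (shift ew e) q + cinner (shift ez (shift ew c)) q"
      by (simp add: ec(3) shift_add shift_shift cinner_add_left)
    also have "\<dots> = 0" using defectD[OF qd ec(1)] E0[OF inv(2)[OF ec(2)] qE] by simp
    finally show "cinner (shift ew t) q = 0" .
  qed
  \<comment> \<open>Double commutativity is symmetric: the defect space of \<open>w\<close> is invariant under \<open>z\<close>.\<close>
  have E2_inv: "shift ez x \<in> E2" if x: "x \<in> E2" for x
    unfolding E2_def defect_def
  proof (intro CollectI conjI ballI)
    have xT: "x \<in> T" using x by (simp add: E2_def defect_def)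
    then show "shift ez x \<in> T" by (rule inv(1))
    fix t assume "t \<in> T"
    then obtain e c where ec: "e \<in> E" "c \<in> T" "t = e + shift ez c" using dec by blast
    have "cinner (shift ew t) (shift ez x) = cinner (shift ew e) (shift ez x) + cinner (shift ez (shift ew c)) (shift ez x)"
      by (simp add: ec(3) shift_add shift_shift cinner_add_left)
    also have "cinner (shift ew e) (shift ez x) = 0"
      by (rule cinner_zero_commute[OF E0[OF xT invE[OF ec(1)]]])
    also have "cinner (shift ez (shift ew c)) (shift ez x) = 0"
      unfolding cinner_shift using x ec(2) by (simp add: E2_def defect_def)
    finally show "cinner (shift ew t) (shift ez x) = 0" by simp
  qed
  have E20: "cinner (shift ew x) y = 0" if "x \<in> T" "y \<in> E2" for x y
    using defectD[of y T "ew" x] that unfolding E2_def by simp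
  have nT: "shift (int m, int n) x \<in> T" if "x \<in> T" for m n x by (rule shift_nat_mem[OF inv that])
  have wE: "shift (0, int n) q \<in> E" for n using shift_power_mem[OF invE qE, of n] by simp
  have zE2: "shift (int m, 0) q \<in> E2" for m using shift_power_mem[OF E2_inv qE2, of m] by simp
  have zpos: "cinner (shift (int (Suc m), int n) x) y = 0" if "x \<in> T" "y \<in> E" for m n x y
  proof -
    have "shift (int (Suc m), int n) x = shift ez (shift (int m, int n) x)" by (simp add: shift_shift)
    then show ?thesis using E0[OF nT[OF that(1)] that(2)] by simp
  qed
  have wpos: "cinner (shift (int m, int (Suc n)) x) y = 0" if "x \<in> T" "y \<in> E2" for m n x y
  proof -
    have "shift (int m, int (Suc n)) x = shift ew (shift (int m, int n) x)" by (simp add: shift_shift)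
    then show ?thesis using E20[OF nT[OF that(1)] that(2)] by simp
  qed
  have zside: "cinner (shift (int (Suc m), k) x) q = 0" if x: "x \<in> T" for m k x
  proof (cases "k \<ge> 0")
    case True
    then show ?thesis using zpos[OF x qE, of m "nat k"] by simp
  next
    case False
    have "cinner (shift (int (Suc m), k) x) q = cinner (shift (int (Suc m), int 0) x) (shift (0, int (nat (- k))) q)"
      using False by (simp add: cinner_shift_shift)
    then show ?thesis using zpos[OF x wE] by (simp only:)
  qed
  have pos: "cinner (shift \<alpha> q) q = 0" if "fst \<alpha> > 0 \<or> (fst \<alpha> = 0 \<and> snd \<alpha> > 0)" for \<alpha>
    using that
  proof
    assume "fst \<alpha> > 0"
    then have "\<alpha> = (int (Suc (nat (fst \<alpha> - 1))), snd \<alpha>)" by (cases \<alpha>) simp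
    then show ?thesis using zside[OF qT] by metis
  next
    assume "fst \<alpha> = 0 \<and> snd \<alpha> > 0"
    then have "\<alpha> = (int 0, int (Suc (nat (snd \<alpha> - 1))))" by (cases \<alpha>) simp
    then show ?thesis using wpos[OF qT qE2] by metis
  qed
  have orth: "cinner (shift \<alpha> q) q = (if \<alpha> = 0 then 1 else 0)" for \<alpha>
  proof (cases "\<alpha> = 0")
    case True
    then show ?thesis using nq by (simp add: cinner_same)
  next
    case False
    show ?thesis
    proof (cases "fst \<alpha> > 0 \<or> (fst \<alpha> = 0 \<and> snd \<alpha> > 0)")
      case True
      then show ?thesis using pos False by simp
    next
      case neg: False
      have "fst (- \<alpha>) > 0 \<or> (fst (- \<alpha>) = 0 \<and> snd (- \<alpha>) > 0)"
        using neg False by (cases \<alpha>) (auto simp: zero_prod_def)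
      then have "cinner (shift (- \<alpha>) q) q = 0" by (rule pos)
      then have "cinner q (shift (- \<alpha>) q) = 0" by (rule cinner_zero_commute)
      moreover have "cinner q (shift (- \<alpha>) q) = cinner (shift \<alpha> q) q"
        using cinner_shift_shift[of 0 q "- \<alpha>" q] by simp
      ultimately show ?thesis using False by simp
    qed
  qed
  have "r = 0" if r: "r \<in> T" and h: "\<forall>m n::nat. cinner r (shift (int m, int n) q) = 0" for r
  proof (rule zero_if_orthogonal_to_shifts[OF orth])
    fix \<alpha> :: "int \<times> int"
    obtain m n where \<alpha>: "\<alpha> = (m, n)" by force
    \<comment> \<open>Negative exponents are moved from \<open>q\<close> to \<open>r\<close>.\<close>
    have swap: "cinner r (shift (a, b) q) = cinner (shift (- c, - d) r) (shift (a - c, b - d) q)" for a b c d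
      using cinner_shift[of "(- c, - d)" r "shift (a, b) q"] by (simp add: shift_shift)
    show "cinner r (shift \<alpha> q) = 0"
    proof (cases "m < 0")
      case True
      have "cinner r (shift \<alpha> q) = cinner (shift (int (Suc (nat (- m - 1))), - n) r) q"
        using swap[of m n m n] True \<alpha> by (simp add: zero_prod_def[symmetric])
      then show ?thesis using zside[OF r] by (simp only:)
    next
      case m: False
      show ?thesis
      proof (cases "n < 0")
        case True
        have "cinner r (shift \<alpha> q) = cinner (shift (int 0, int (Suc (nat (- n - 1)))) r) (shift (int (nat m), 0) q)"
          using swap[of m n 0 n] True \<alpha> m by simp
        then show ?thesis using wpos[OF r zE2] by metis
      next
        case False
        then have "\<alpha> = (int (nat m), int (nat n))" using m \<alpha> by simp
        then show ?thesis using h by metis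
      qed
    qed
  qed
  then show ?thesis using qT orth by blast
qed

section \<open>Multiplication by a unimodular function\<close>

definition quadrant :: "(int \<times> int) set" where "quadrant = {\<alpha>. 0 \<le> fst \<alpha> \<and> 0 \<le> snd \<alpha>}"
definition plus_coefs :: "(int \<times> int) ell2 set" where "plus_coefs = {a. \<forall>\<alpha>. \<alpha> \<notin> quadrant \<longrightarrow> coef a \<alpha> = 0}"

lemma plus_coefs_outside: "a \<in> plus_coefs \<Longrightarrow> \<alpha> \<notin> quadrant \<Longrightarrow> coef a \<alpha> = 0" unfolding plus_coefs_def by blast
lemma quadrant_index: "quadrant \<subseteq> index_set" by (auto simp: quadrant_def index_set_def)
lemma plus_coefs_imp_hardy_coefs: "a \<in> plus_coefs \<Longrightarrow> a \<in> hardy_coefs" unfolding plus_coefs_def hardy_coefs_def using quadrant_index by blast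
lemma plus_coefs_add: "a \<in> plus_coefs \<Longrightarrow> b \<in> plus_coefs \<Longrightarrow> a + b \<in> plus_coefs" unfolding plus_coefs_def by simp
lemma plus_coefs_diff: "a \<in> plus_coefs \<Longrightarrow> b \<in> plus_coefs \<Longrightarrow> a - b \<in> plus_coefs" unfolding plus_coefs_def by simp
lemma plus_coefs_cscale: "a \<in> plus_coefs \<Longrightarrow> cscale k a \<in> plus_coefs" unfolding plus_coefs_def by simp

lemma bij_betw_quadrant: "bij_betw (\<lambda>(i, j). (int i, int j)) UNIV quadrant"
  by (rule bij_betwI[where g="\<lambda>\<alpha>. (nat (fst \<alpha>), nat (snd \<alpha>))"]) (auto simp: quadrant_def)

lemma has_sum_ev_quadrant:
  assumes "p \<in> hartogs_triangle" "c \<in> plus_coefs"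
  shows "((\<lambda>\<alpha>. coef c \<alpha> * mon \<alpha> p) has_sum ev c p) quadrant"
  using has_sum_ev[OF assms(1), of c]
  by (subst has_sum_cong_neutral[where T=index_set and g="\<lambda>\<alpha>. coef c \<alpha> * mon \<alpha> p"])
    (use quadrant_index plus_coefs_outside[OF assms(2)] in auto)

lemma hardy_plus_eq: "hardy_plus = ev ` plus_coefs"
proof (intro equalityI subsetI)
  fix f assume "f \<in> hardy_plus"
  then obtain a :: "nat \<times> nat \<Rightarrow> complex" where f: "f \<in> hardy" and
    a: "\<And>z w. (z, w) \<in> hartogs_triangle \<Longrightarrow> ((\<lambda>(i, j). a (i, j) * z ^ i * w ^ j) has_sum f (z, w)) UNIV"
    by (auto simp: hardy_plus_def)
  obtain c where c: "c \<in> hardy_coefs" "f = ev c" using f hardy_eq_ev by blast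
  define d where "d = (\<lambda>\<alpha>. if \<alpha> \<in> quadrant then a (nat (fst \<alpha>), nat (snd \<alpha>)) else 0)"
  have hs: "((\<lambda>\<alpha>. d \<alpha> * mon \<alpha> p) has_sum ev c p) index_set" if p: "p \<in> hartogs_triangle" for p
  proof -
    have "((\<lambda>ij. d (case ij of (i, j) \<Rightarrow> (int i, int j)) * mon (case ij of (i, j) \<Rightarrow> (int i, int j)) p) has_sum ev c p) UNIV"
      using a[of "fst p" "snd p"] p c(2)
      by (simp add: case_prod_unfold d_def quadrant_def mon_def mult.assoc)
    then have "((\<lambda>\<alpha>. d \<alpha> * mon \<alpha> p) has_sum ev c p) quadrant"
      using has_sum_reindex_bij_betw[OF bij_betw_quadrant, of "\<lambda>\<alpha>. d \<alpha> * mon \<alpha> p"] by simp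
    then show ?thesis
      by (subst has_sum_cong_neutral[where T=quadrant and g="\<lambda>\<alpha>. d \<alpha> * mon \<alpha> p"])
        (use quadrant_index in \<open>auto simp: d_def\<close>)
  qed
  have r: "(1/4, 1/2) \<in> radii" by (simp add: radii_def)
  have "coef c \<alpha> = 0" if "\<alpha> \<notin> quadrant" for \<alpha>
  proof -
    have "coef c \<alpha> * of_real (rpow \<alpha> (1/4, 1/2)) = (if \<alpha> \<in> index_set then d \<alpha> * of_real (rpow \<alpha> (1/4, 1/2)) else 0)"
      using fcoef_ev[OF c(1) r, of \<alpha>] fcoef_dilate[OF hs L2_dilate[OF continuous_ev measurable_ev r] r, of \<alpha>] by simp
    then show ?thesis using that rpow_pos[OF r, of \<alpha>] by (auto simp: d_def split: if_splits)
  qed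
  then have "c \<in> plus_coefs" unfolding plus_coefs_def by blast
  then show "f \<in> ev ` plus_coefs" using c by blast
next
  fix f assume "f \<in> ev ` plus_coefs"
  then obtain c where c: "c \<in> plus_coefs" "f = ev c" by blast
  have "((\<lambda>(i, j). coef c (int i, int j) * z ^ i * w ^ j) has_sum f (z, w)) UNIV" if p: "(z, w) \<in> hartogs_triangle" for z w
  proof -
    have "((\<lambda>\<alpha>. coef c \<alpha> * mon \<alpha> (z, w)) has_sum ev c (z, w)) quadrant"
      by (rule has_sum_ev_quadrant[OF p c(1)])
    then show ?thesis
      using has_sum_reindex_bij_betw[OF bij_betw_quadrant, of "\<lambda>\<alpha>. coef c \<alpha> * mon \<alpha> (z, w)"] c(2)
      by (simp add: case_prod_unfold mon_def mult.assoc)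
  qed
  then show "f \<in> hardy_plus" unfolding hardy_plus_def
    using c ev_in_hardy[OF plus_coefs_imp_hardy_coefs[OF c(1)]] by (auto intro!: exI[of _ "\<lambda>(i, j). coef c (int i, int j)"])
qed

lemma orthonormal_translates:
  assumes "\<And>\<alpha>. cinner (shift \<alpha> q) q = (if \<alpha> = 0 then 1 else 0)"
  shows "cinner (shift \<alpha> q) (shift \<beta> q) = (if \<alpha> = \<beta> then 1 else 0)"
  using assms[of "\<alpha> - \<beta>"] by (simp add: cinner_shift_shift)

text \<open>The series of the translates of \<open>q\<close> with coefficients \<open>c\<close> represents the product of the two functions,
since evaluation at a point is continuous. So multiplication by \<open>ev q\<close> is isometric on
\<^const>\<open>hardy_plus\<close> and stays in every closed subspace that contains the translates.\<close>

lemma multiplication_series: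
  assumes M: "csubspace_closed M" and q: "q \<in> hardy_coefs" and qM: "\<And>\<alpha>. \<alpha> \<in> quadrant \<Longrightarrow> shift \<alpha> q \<in> M"
    and on: "\<And>\<alpha>. cinner (shift \<alpha> q) q = (if \<alpha> = 0 then 1 else 0)" and c: "c \<in> plus_coefs"
  shows "\<exists>x\<in>M. norm x = norm c \<and> (\<forall>p. ev x p = ev q p * ev c p) \<and>
     (\<forall>\<alpha>\<in>quadrant. cinner x (shift \<alpha> q) = coef c \<alpha>)"
proof -
  note on' = orthonormal_translates[of q, OF on]
  have cs: "((\<lambda>\<alpha>. (cmod (coef c \<alpha>))\<^sup>2) has_sum (norm c)\<^sup>2) quadrant"
  proof -
    have "((\<lambda>\<alpha>. (cmod (coef c \<alpha>))\<^sup>2) has_sum (norm c)\<^sup>2) UNIV"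
      unfolding norm_ell2_sq by (intro has_sum_infsum square_summable_coef)
    then show ?thesis
      by (subst has_sum_cong_neutral[where T=UNIV and g="\<lambda>\<alpha>. (cmod (coef c \<alpha>))\<^sup>2"]) (use plus_coefs_outside[OF c] in auto)
  qed
  obtain x where x: "((\<lambda>\<alpha>. cscale (coef c \<alpha>) (shift \<alpha> q)) has_sum x) quadrant"
    and nx: "(norm x)\<^sup>2 = (\<Sum>\<^sub>\<infinity>\<alpha>\<in>quadrant. (cmod (coef c \<alpha>))\<^sup>2)"
    using orthonormal_series[where e="\<lambda>\<alpha>. shift \<alpha> q" and A=quadrant and c="coef c"] on' cs by (auto simp: summable_on_def)
  have lim: "((\<lambda>F. \<Sum>\<alpha>\<in>F. cscale (coef c \<alpha>) (shift \<alpha> q)) \<longlongrightarrow> x) (finite_subsets_at_top quadrant)"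
    using x unfolding has_sum_def .
  have "x \<in> M"
  proof (rule Lim_in_closed_set[OF csubspace_closedD[OF M] _ _ lim])
    show "\<forall>\<^sub>F F in finite_subsets_at_top quadrant. (\<Sum>\<alpha>\<in>F. cscale (coef c \<alpha>) (shift \<alpha> q)) \<in> M"
      by (rule eventually_finite_subsets_at_top_weakI) (auto intro!: csubspace_sum[OF M] csubspace_cscale[OF M] qM)
  qed simp
  moreover have "norm x = norm c"
    using nx infsumI[OF cs] by (simp add: power2_eq_iff_nonneg)
  moreover have "ev x p = ev q p * ev c p" for p
  proof (cases "p \<in> hartogs_triangle")
    case True
    have ev_sum: "ev (sum f F) p = (\<Sum>\<alpha>\<in>F. ev (f \<alpha>) p)" for f :: "int \<times> int \<Rightarrow> _" and F
      by (simp add: ev_def cinner_sum_left)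
    have "((\<lambda>F. ev (\<Sum>\<alpha>\<in>F. cscale (coef c \<alpha>) (shift \<alpha> q)) p) \<longlongrightarrow> ev x p) (finite_subsets_at_top quadrant)"
      by (rule ev_tendsto[OF lim])
    then have "((\<lambda>\<alpha>. coef c \<alpha> * ev (shift \<alpha> q) p) has_sum ev x p) quadrant"
      by (simp add: has_sum_def ev_sum ev_cscale)
    then have "((\<lambda>\<alpha>. ev q p * (coef c \<alpha> * mon \<alpha> p)) has_sum ev x p) quadrant"
      by (rule has_sum_cong[THEN iffD1, rotated]) (use ev_shift[OF q _ _ True] in \<open>auto simp: quadrant_def\<close>)
    moreover have "((\<lambda>\<alpha>. ev q p * (coef c \<alpha> * mon \<alpha> p)) has_sum ev q p * ev c p) quadrant"
      by (rule has_sum_cmult_right[OF has_sum_ev_quadrant[OF True c]])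
    ultimately show ?thesis by (rule has_sum_unique)
  qed (simp add: ev_outside)
  moreover have "cinner x (shift \<beta> q) = coef c \<beta>" if \<beta>: "\<beta> \<in> quadrant" for \<beta>
  proof -
    have "((\<lambda>F. cinner (\<Sum>\<alpha>\<in>F. cscale (coef c \<alpha>) (shift \<alpha> q)) (shift \<beta> q)) \<longlongrightarrow> cinner x (shift \<beta> q)) (finite_subsets_at_top quadrant)"
      by (rule tendsto_cinner_left[OF lim])
    then have "((\<lambda>\<alpha>. if \<alpha> = \<beta> then coef c \<beta> else 0) has_sum cinner x (shift \<beta> q)) quadrant"
      by (simp add: has_sum_def cinner_sum_left cinner_cscale_left on' if_distrib cong: if_cong)
    moreover have "((\<lambda>\<alpha>. if \<alpha> = \<beta> then coef c \<beta> else 0) has_sum coef c \<beta>) quadrant"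
    proof -
      have "((\<lambda>\<alpha>. if \<alpha> = \<beta> then coef c \<beta> else 0) has_sum (\<Sum>\<alpha>\<in>{\<beta>}. if \<alpha> = \<beta> then coef c \<beta> else 0)) {\<beta>}"
        by (rule has_sum_finite) simp
      then show ?thesis
        by (subst has_sum_cong_neutral[where T="{\<beta>}" and g="\<lambda>\<alpha>. if \<alpha> = \<beta> then coef c \<beta> else 0"]) (use \<beta> in auto)
    qed
    ultimately show ?thesis by (rule has_sum_unique)
  qed
  ultimately show ?thesis by blast
qed

lemma nn_integral_dist_tpoly:
  assumes "b \<in> L2_torus"
  shows "(\<integral>\<^sup>+ (\<zeta>, \<omega>). ennreal ((cmod (b (\<zeta>, \<omega>)
      - (\<Sum>(m, n)\<in>F. a (m, n) * (\<zeta> powi m) * (\<omega> powi n))))\<^sup>2) \<partial>torus_measure)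
    = ennreal (L2_sq (\<lambda>p. b p - tpoly a F p))"
  using L2_diff[OF assms L2_tpoly[of a F]]
  by (subst nn_integral_eq_integral[symmetric])
    (auto simp: L2_torus_def tpoly_def mon_def case_prod_unfold mult.assoc)

lemma unimodular_ev:
  assumes q: "q \<in> hardy_coefs" and on: "\<And>\<alpha>. cinner (shift \<alpha> q) q = (if \<alpha> = 0 then 1 else 0)"
  shows "unimodular (ev q)"
proof -
  obtain b where b: "boundary q b" using boundary_exists by blast
  have bL: "b \<in> L2_torus" by (rule boundary_L2[OF b])
  note nn = nn_integral_dist_tpoly[OF bL]
  have "((\<lambda>F. ennreal (L2_sq (\<lambda>p. b p - tpoly (coef q) F p))) \<longlongrightarrow> ennreal 0) (finite_subsets_at_top index_set)"
    by (rule tendsto_ennrealI[OF boundary_tendsto[OF b hardy_coefs_outside[OF q]]])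
  then have "has_boundary_function (ev q) b"
    unfolding has_boundary_function_def nn[symmetric]
    using L2_measurable[OF bL] has_sum_ev[of _ q]
    by (auto intro!: exI[of _ "coef q"] simp: mon_def case_prod_unfold mult.assoc nn)
  moreover have "AE p in torus_measure. cmod (b p) = 1" using unimodular_boundary_iff[OF b] on by blast
  ultimately show ?thesis unfolding unimodular_def using ev_in_hardy[OF q] by blast
qed

text \<open>The boundary function in the definition of \<^const>\<open>unimodular\<close> comes with some Laurent coefficients
of \<open>u\<close>. As Fourier coefficients of a square-integrable function they are square-summable on
\<^const>\<open>index_set\<close>.\<close>

lemma unimodularE:
  assumes "unimodular u"
  obtains q where "q \<in> hardy_coefs" "u = ev q" "\<And>\<alpha>. cinner (shift \<alpha> q) q = (if \<alpha> = 0 then 1 else 0)"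
proof -
  obtain b a where u: "u \<in> hardy" and bm [measurable]: "b \<in> borel_measurable borel"
    and ae: "AE p in torus_measure. cmod (b p) = 1"
    and hs: "\<forall>(z, w) \<in> hartogs_triangle. ((\<lambda>(m, n). a (m, n) * (z powi m) * (w powi n)) has_sum u (z, w)) index_set"
    and lim: "((\<lambda>F. \<integral>\<^sup>+ (\<zeta>, \<omega>). ennreal ((cmod (b (\<zeta>, \<omega>)
                 - (\<Sum>(m, n)\<in>F. a (m, n) * (\<zeta> powi m) * (\<omega> powi n))))\<^sup>2) \<partial>torus_measure)
           \<longlongrightarrow> 0) (finite_subsets_at_top index_set)"
    using assms unfolding unimodular_def has_boundary_function_def by blast
  have bL: "b \<in> L2_torus" by (rule L2_bounded[where B=1]) (use ae in auto)
  note nn = nn_integral_dist_tpoly[OF bL]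
  have "((\<lambda>F. ennreal (L2_sq (\<lambda>p. b p - tpoly a F p))) \<longlongrightarrow> ennreal 0) (finite_subsets_at_top index_set)"
    using lim unfolding nn by simp
  then have "((\<lambda>F. L2_sq (\<lambda>p. b p - tpoly a F p)) \<longlongrightarrow> 0) (finite_subsets_at_top index_set)"
    by (subst (asm) tendsto_ennreal_iff) (auto intro!: always_eventually Bochner_Integration.integral_nonneg)
  from fcoef_of_L2_limit[OF bL this]
  have fc: "fcoef b \<alpha> = (if \<alpha> \<in> index_set then a \<alpha> else 0)" for \<alpha> .
  define q where "q = Abs_ell2 (fcoef b)"
  have qb: "boundary q b" unfolding q_def by (rule boundary_of_L2_coefs[OF bL])
  then have cq: "coef q \<alpha> = (if \<alpha> \<in> index_set then a \<alpha> else 0)" for \<alpha>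
    using fc unfolding boundary_def by metis
  have qH: "q \<in> hardy_coefs" unfolding hardy_coefs_def using cq by auto
  have "u p = ev q p" for p
  proof (cases "p \<in> hartogs_triangle")
    case True
    have "((\<lambda>\<alpha>. a \<alpha> * mon \<alpha> p) has_sum u p) index_set"
      using hs True by (cases p) (auto simp: mon_def case_prod_unfold mult.assoc)
    then have "((\<lambda>\<alpha>. coef q \<alpha> * mon \<alpha> p) has_sum u p) index_set"
      by (rule has_sum_cong[THEN iffD1, rotated]) (simp add: cq)
    then show ?thesis using has_sum_ev[OF True, of q] has_sum_unique by blast
  next
    case False
    then have "u p = 0" using u unfolding hardy_def by blast
    then show ?thesis using False by (simp add: ev_outside)
  qed
  then have "u = ev q" by blast
  moreover have "\<And>\<alpha>. cinner (shift \<alpha> q) q = (if \<alpha> = 0 then 1 else 0)"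
    using unimodular_boundary_iff[OF qb] ae by blast
  ultimately show ?thesis using that qH by blast
qed

section \<open>Doubly commuting submodules\<close>

text \<open>An isometric parametrization \<open>U\<close> of \<open>S\<close> carries the operator \<open>A\<close> to an operator \<open>V\<close> on coefficients,
where the adjoint can be read off; positivity of the inner product gives the uniqueness that
\<^const>\<open>adjoint_on\<close> requires.\<close>

lemma adjoint_on_eqI:
  assumes S: "S = U ` X" and X: "\<And>c d. c \<in> X \<Longrightarrow> d \<in> X \<Longrightarrow> c - d \<in> X"
    and U: "\<And>c d. c \<in> X \<Longrightarrow> d \<in> X \<Longrightarrow> hardy_inner (U c) (U d) = cinner c d"
    and V: "\<And>x. x \<in> X \<Longrightarrow> V x \<in> X" "\<And>x. x \<in> X \<Longrightarrow> A (U x) = U (V x)"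
    and a: "a \<in> X" and c: "c \<in> X" and adj: "\<And>x. x \<in> X \<Longrightarrow> cinner (V x) a = cinner x c"
  shows "adjoint_on S A (U a) = U c"
  unfolding adjoint_on_def
proof (rule the_equality)
  show "U c \<in> S \<and> (\<forall>f\<in>S. hardy_inner (A f) (U a) = hardy_inner f (U c))"
    unfolding S using a c by (auto simp: V U adj)
  fix k assume k: "k \<in> S \<and> (\<forall>f\<in>S. hardy_inner (A f) (U a) = hardy_inner f k)"
  then obtain d where d: "d \<in> X" "k = U d" unfolding S by blast
  have "cinner x d = cinner x c" if x: "x \<in> X" for x
    using bspec[OF conjunct2[OF k], of "U x"] x a d S by (simp add: V U adj)
  then have "cinner (d - c) (d - c) = 0" using X[OF d(1) c] by (simp add: cinner_diff_right)
  then show "k = U c" unfolding d(2) cinner_same by simp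
qed

text \<open>After passing to coefficients, elements of the defect space are those killed by the adjoint of
multiplication by \<open>z\<close>, so double commutativity makes the defect space invariant under \<open>w\<close>. The expansion
of an element of \<open>S\<close> along the translates of the wandering vector is its quotient by \<open>q\<close>.\<close>

lemma doubly_commuting_imp_unimodular:
  assumes S: "hardy_submodule S" and ne: "S \<noteq> {\<lambda>_. 0}" and dc: "doubly_commuting S"
  shows "\<exists>q. unimodular q \<and> S = (\<lambda>f p. q p * f p) ` hardy_plus"
proof -
  note D = S[unfolded hardy_submodule_def closed_hardy_subspace_def]
  have S1: "S \<subseteq> hardy" "(\<lambda>_. 0) \<in> S" using D by simp_all
  have "\<forall>f\<in>S. \<forall>g\<in>S. (\<lambda>p. f p + g p) \<in> S" using D by (elim conjE)
  then have S_add: "(\<lambda>p. f p + g p) \<in> S" if "f \<in> S" "g \<in> S" for f g using that by blast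
  have "\<forall>c. \<forall>f\<in>S. (\<lambda>p. c * f p) \<in> S" using D by (elim conjE)
  then have S_scale: "(\<lambda>p. c * f p) \<in> S" if "f \<in> S" for c f using that by blast
  have S_lim: "\<forall>F f. (\<forall>n::nat. F n \<in> S) \<and> f \<in> hardy \<and>
        (\<lambda>n. hardy_norm (\<lambda>p. F n p - f p)) \<longlonglongrightarrow> 0 \<longrightarrow> f \<in> S" using D by (elim conjE)
  have Sz: "mult_z f \<in> S" and Sw: "mult_w f \<in> S" if "f \<in> S" for f
    using D that by (auto simp: image_subset_iff)
  define T where "T = {a \<in> hardy_coefs. ev a \<in> S}"
  have TH: "T \<subseteq> hardy_coefs" by (auto simp: T_def)
  have ST: "S = ev ` T" using S1(1) unfolding T_def hardy_eq_ev by blast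
  have T: "csubspace_closed T"
    unfolding csubspace_closed_def
  proof (intro conjI ballI allI)
    show "0 \<in> T" using S1(2) by (simp add: T_def hardy_coefs_zero ev_zero)
    show "a + b \<in> T" if "a \<in> T" "b \<in> T" for a b
    proof -
      have "ev (a + b) = (\<lambda>p. ev a p + ev b p)" by (simp add: ev_add[abs_def])
      then show ?thesis using that S_add[of "ev a" "ev b"] by (simp add: T_def hardy_coefs_add)
    qed
    show "cscale k a \<in> T" if "a \<in> T" for k a
    proof -
      have "ev (cscale k a) = (\<lambda>p. k * ev a p)" by (simp add: ev_cscale[abs_def])
      then show ?thesis using that S_scale[of "ev a" k] by (simp add: T_def hardy_coefs_cscale)
    qed
    show "closed T"
      unfolding closed_sequential_limits
    proof (intro allI impI, elim conjE)
      fix x l assume x: "\<forall>n. x n \<in> T" and l: "x \<longlonglongrightarrow> l"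
      have lH: "l \<in> hardy_coefs" using closed_sequentially[OF closed_hardy_coefs _ l] x by (auto simp: T_def)
      have "hardy_norm (\<lambda>p. ev (x n) p - ev l p) = norm (x n - l)" for n
      proof -
        have "(\<lambda>p. ev (x n) p - ev l p) = ev (x n - l)" by (simp add: ev_diff[abs_def])
        then show ?thesis using hardy_norm_ev[of "x n - l"] x lH by (simp add: T_def hardy_coefs_diff)
      qed
      moreover have "(\<lambda>n. norm (x n - l)) \<longlonglongrightarrow> 0" using l by (simp add: LIM_zero_iff tendsto_norm_zero_iff)
      ultimately have "ev l \<in> S" using x ev_in_hardy[OF lH]
        by (intro S_lim[THEN spec, THEN spec, THEN mp, of "\<lambda>n. ev (x n)" "ev l"]) (auto simp: T_def)
      then show "l \<in> T" using lH by (simp add: T_def)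
    qed
  qed
  have invz: "shift ez x \<in> T" if "x \<in> T" for x
    using that Sz[of "ev x"] hardy_coefs_shift[of x "ez"] by (simp add: T_def mult_z_ev)
  have invw: "shift ew x \<in> T" if "x \<in> T" for x
    using that Sw[of "ev x"] hardy_coefs_shift[of x "ew"] by (simp add: T_def mult_w_ev)
  have adj: "adjoint_on S mult_z (ev a) = ev c"
    if "a \<in> T" "c \<in> T" and "\<And>x. x \<in> T \<Longrightarrow> cinner (shift ez x) a = cinner x c" for a c
    by (rule adjoint_on_eqI[OF ST, where V="shift ez"])
      (use that subsetD[OF TH] invz csubspace_diff[OF T] in \<open>auto simp: mult_z_ev hardy_inner_ev\<close>)
  have adj_ex: "\<exists>c\<in>T. \<forall>x\<in>T. cinner (shift ez x) a = cinner x c" if a: "a \<in> T" for a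
  proof -
    obtain e c where ec: "e \<in> defect T ez" "c \<in> T" "a = e + shift ez c"
      using defect_decomposition[OF T invz a] by blast
    then have "cinner (shift ez x) a = cinner x c" if "x \<in> T" for x
      using defectD[OF ec(1) that] by (simp add: cinner_add_right cinner_shift)
    then show ?thesis using ec(2) by blast
  qed
  have dcT: "shift ew e \<in> defect T ez" if e: "e \<in> defect T ez" for e
  proof -
    have eT: "e \<in> T" using e by (simp add: defect_def)
    have e0: "adjoint_on S mult_z (ev e) = ev 0"
      by (rule adj[OF eT csubspace_zero[OF T]]) (simp add: defectD[OF e])
    obtain c where c: "c \<in> T" "\<And>x. x \<in> T \<Longrightarrow> cinner (shift ez x) (shift ew e) = cinner x c"
      using adj_ex[OF invw[OF eT]] by blast
    have "ev c = adjoint_on S mult_z (mult_w (ev e))"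
      using adj[OF invw[OF eT] c] eT TH by (simp add: mult_w_ev subset_iff)
    also have "\<dots> = mult_w (ev 0)" using dc eT e0 unfolding doubly_commuting_def ST by auto
    also have "\<dots> = ev 0" by (simp add: mult_w_ev[OF hardy_coefs_zero])
    finally have "c = 0" using ev_inj c(1) TH hardy_coefs_zero by blast
    then show ?thesis using c(2) invw[OF eT] by (simp add: defect_def)
  qed
  obtain t0 where t0: "t0 \<in> T" "t0 \<noteq> 0"
  proof -
    have "T \<noteq> {0}" using ne ST by (auto simp: ev_zero)
    then show ?thesis using that csubspace_zero[OF T] by blast
  qed
  obtain q where qT: "q \<in> T" and on: "\<And>\<alpha>. cinner (shift \<alpha> q) q = (if \<alpha> = 0 then 1 else 0)"
    and full: "\<And>r. r \<in> T \<Longrightarrow> (\<forall>m n::nat. cinner r (shift (int m, int n) q) = 0) \<Longrightarrow> r = 0"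
    using wandering_vector[OF T TH t0 invz invw dcT] by blast
  have qH: "q \<in> hardy_coefs" using qT TH by blast
  have quad: "\<exists>m n. \<alpha> = (int m, int n)" if "\<alpha> \<in> quadrant" for \<alpha>
    using that by (intro exI[of _ "nat (fst \<alpha>)"] exI[of _ "nat (snd \<alpha>)"]) (auto simp: quadrant_def)
  have qsh: "shift \<alpha> q \<in> T" if "\<alpha> \<in> quadrant" for \<alpha>
    using quad[OF that] shift_nat_mem[OF invz invw qT] by auto
  have series: "\<exists>x\<in>T. norm x = norm c \<and> (\<forall>p. ev x p = ev q p * ev c p) \<and>
     (\<forall>\<alpha>\<in>quadrant. cinner x (shift \<alpha> q) = coef c \<alpha>)" if "c \<in> plus_coefs" for c
    by (rule multiplication_series[OF T qH qsh on that])
  have "S = (\<lambda>f p. ev q p * f p) ` hardy_plus"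
  proof (intro equalityI subsetI)
    fix f assume "f \<in> S"
    then obtain x where x: "x \<in> T" "f = ev x" unfolding ST by blast
    define c where "c = Abs_ell2 (\<lambda>\<alpha>. if \<alpha> \<in> quadrant then cinner x (shift \<alpha> q) else 0)"
    note on' = orthonormal_translates[of q, OF on]
    have "(\<lambda>\<alpha>. (cmod (if \<alpha> \<in> quadrant then cinner x (shift \<alpha> q) else 0))\<^sup>2) summable_on UNIV"
    proof (rule square_summable_bounded)
      fix F :: "(int \<times> int) set" assume F: "finite F"
      have "(\<Sum>\<alpha>\<in>F. (cmod (if \<alpha> \<in> quadrant then cinner x (shift \<alpha> q) else 0))\<^sup>2) \<le> (\<Sum>\<alpha>\<in>F. (cmod (cinner x (shift \<alpha> q)))\<^sup>2)"
        by (intro sum_mono) auto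
      also have "\<dots> \<le> (norm x)\<^sup>2" by (rule bessel_inequality[where A=UNIV, OF on' F]) simp
      finally show "(\<Sum>\<alpha>\<in>F. (cmod (if \<alpha> \<in> quadrant then cinner x (shift \<alpha> q) else 0))\<^sup>2) \<le> (norm x)\<^sup>2" .
    qed
    then have cc: "coef c \<alpha> = (if \<alpha> \<in> quadrant then cinner x (shift \<alpha> q) else 0)" for \<alpha>
      unfolding c_def by (simp add: coef_Abs_ell2)
    have cP: "c \<in> plus_coefs" unfolding plus_coefs_def by (simp add: cc)
    obtain y where y: "y \<in> T" "\<And>p. ev y p = ev q p * ev c p" "\<And>\<alpha>. \<alpha> \<in> quadrant \<Longrightarrow> cinner y (shift \<alpha> q) = coef c \<alpha>"
      using series[OF cP] by blast
    have "x - y = 0"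
    proof (rule full[OF csubspace_diff[OF T x(1) y(1)]], intro allI)
      fix m n :: nat
      have "(int m, int n) \<in> quadrant" by (simp add: quadrant_def)
      then show "cinner (x - y) (shift (int m, int n) q) = 0" by (simp add: cinner_diff_left y(3) cc)
    qed
    then have "f = (\<lambda>p. ev q p * ev c p)" using x(2) y(2) by auto
    then show "f \<in> (\<lambda>f p. ev q p * f p) ` hardy_plus" unfolding hardy_plus_eq using cP by blast
  next
    fix f assume "f \<in> (\<lambda>f p. ev q p * f p) ` hardy_plus"
    then obtain c where c: "c \<in> plus_coefs" "f = (\<lambda>p. ev q p * ev c p)" unfolding hardy_plus_eq by blast
    obtain y where y: "y \<in> T" "\<And>p. ev y p = ev q p * ev c p" using series[OF c(1)] by blast
    then have "f = ev y" using c(2) by auto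
    then show "f \<in> S" unfolding ST using y(1) by blast
  qed
  then show ?thesis using unimodular_ev[OF qH on] by blast
qed

text \<open>Multiplication by \<open>u\<close> transports the question to \<^const>\<open>hardy_plus\<close>, where the adjoint of
multiplication by \<open>z\<close> is the backward shift \<open>L\<close>.\<close>

lemma unimodular_imp_doubly_commuting:
  assumes u: "unimodular u" and S: "S = (\<lambda>f p. u p * f p) ` hardy_plus"
  shows "doubly_commuting S"
proof -
  obtain q where qH: "q \<in> hardy_coefs" and uq: "u = ev q" and on: "\<And>\<alpha>. cinner (shift \<alpha> q) q = (if \<alpha> = 0 then 1 else 0)"
    using unimodularE[OF u] by blast
  define U where "U = (\<lambda>c p. u p * ev c p)"
  have SU: "S = U ` plus_coefs" unfolding S hardy_plus_eq U_def by auto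
  have norm_U: "hardy_norm (U c) = norm c" if c: "c \<in> plus_coefs" for c
  proof -
    have "shift \<alpha> q \<in> hardy_coefs" if "\<alpha> \<in> quadrant" for \<alpha>
      using that by (intro hardy_coefs_shift[OF qH]) (auto simp: quadrant_def)
    from multiplication_series[OF csubspace_hardy_coefs qH this on c]
    obtain x where x: "x \<in> hardy_coefs" "norm x = norm c" "\<And>p. ev x p = ev q p * ev c p" by blast
    have "U c = ev x" using x(3) by (auto simp: U_def uq)
    then show ?thesis using hardy_norm_ev[OF x(1)] x(2) by simp
  qed
  have inner_U: "hardy_inner (U c) (U d) = cinner c d" if c: "c \<in> plus_coefs" and d: "d \<in> plus_coefs" for c d
  proof -
    have "(\<lambda>p. U c p + U d p) = U (c + d)" "(\<lambda>p. U c p - U d p) = U (c - d)"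
      "(\<lambda>p. U c p + \<i> * U d p) = U (c + cscale \<i> d)" "(\<lambda>p. U c p - \<i> * U d p) = U (c - cscale \<i> d)"
      by (auto simp: U_def ev_add ev_diff ev_cscale algebra_simps)
    then show ?thesis
      unfolding hardy_inner_def using polarization[of c d] c d
      by (simp add: norm_U plus_coefs_add plus_coefs_diff plus_coefs_cscale)
  qed
  have plus_coefs_shift: "shift \<beta> c \<in> plus_coefs" if c: "c \<in> plus_coefs" and "\<beta> \<in> quadrant" for c \<beta>
  proof -
    have "coef c (\<alpha> - \<beta>) = 0" if "\<alpha> \<notin> quadrant" for \<alpha>
      by (rule plus_coefs_outside[OF c]) (use that \<open>\<beta> \<in> quadrant\<close> in \<open>auto simp: quadrant_def\<close>)
    then show ?thesis unfolding plus_coefs_def by simp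
  qed
  have eq: "ez \<in> quadrant" "ew \<in> quadrant" by (auto simp: quadrant_def)
  have zU: "mult_z (U c) = U (shift ez c)" if "c \<in> plus_coefs" for c
    using mult_z_ev[OF plus_coefs_imp_hardy_coefs[OF that]] by (auto simp: U_def mult_z_def fun_eq_iff)
  have wU: "mult_w (U c) = U (shift ew c)" if "c \<in> plus_coefs" for c
    using mult_w_ev[OF plus_coefs_imp_hardy_coefs[OF that]] by (auto simp: U_def mult_w_def fun_eq_iff)
  define L where "L = (\<lambda>c. Abs_ell2 (\<lambda>\<alpha>. if \<alpha> \<in> quadrant then coef c (\<alpha> + ez) else 0))"
  have cL: "coef (L c) \<alpha> = (if \<alpha> \<in> quadrant then coef c (\<alpha> + ez) else 0)" for c \<alpha>
  proof -
    have "(\<lambda>\<alpha>. (cmod (if \<alpha> \<in> quadrant then coef c (\<alpha> + ez) else 0))\<^sup>2) summable_on UNIV"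
    proof (rule square_summable_bounded)
      fix F :: "(int \<times> int) set" assume F: "finite F"
      have "(\<Sum>\<alpha>\<in>F. (cmod (if \<alpha> \<in> quadrant then coef c (\<alpha> + ez) else 0))\<^sup>2) \<le> (\<Sum>\<alpha>\<in>F. (cmod (coef (shift (- ez) c) \<alpha>))\<^sup>2)"
        by (intro sum_mono) auto
      also have "\<dots> \<le> (norm c)\<^sup>2" using sum_coef_sq_le[OF F, of "shift (- ez) c"] by simp
      finally show "(\<Sum>\<alpha>\<in>F. (cmod (if \<alpha> \<in> quadrant then coef c (\<alpha> + ez) else 0))\<^sup>2) \<le> (norm c)\<^sup>2" .
    qed
    then show ?thesis unfolding L_def by (simp add: coef_Abs_ell2)
  qed
  have LP: "L c \<in> plus_coefs" for c unfolding plus_coefs_def by (simp add: cL)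
  have L_adj: "cinner (shift ez d) c = cinner d (L c)" if d: "d \<in> plus_coefs" for c d
  proof -
    have "cinner (shift ez d) c = cinner d (shift (- ez) c)"
      using cinner_shift[of "ez" d "shift (- ez) c"] by (simp add: shift_shift zero_prod_def[symmetric])
    also have "\<dots> = cinner d (L c)"
      unfolding cinner_def by (rule infsum_cong) (use plus_coefs_outside[OF d] in \<open>auto simp: cL\<close>)
    finally show ?thesis .
  qed
  have adj: "adjoint_on S mult_z (U c) = U (L c)" if "c \<in> plus_coefs" for c
    by (rule adjoint_on_eqI[OF SU, where V="shift ez"])
      (use that in \<open>auto simp: zU inner_U plus_coefs_shift plus_coefs_diff eq LP L_adj\<close>)
  have comm: "L (shift ew c) = shift ew (L c)" if c: "c \<in> plus_coefs" for c
  proof (rule ell2_eqI)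
    fix \<alpha> :: "int \<times> int"
    obtain m n where \<alpha>: "\<alpha> = (m, n)" by force
    show "coef (L (shift ew c)) \<alpha> = coef (shift ew (L c)) \<alpha>"
      using plus_coefs_outside[OF c, of "(m + 1, n - 1)"] unfolding \<alpha>
      by (auto simp: cL quadrant_def)
  qed
  show ?thesis unfolding doubly_commuting_def SU
    using adj by (auto simp: wU plus_coefs_shift eq LP comm SU)
qed

theorem theorem1p2:
  fixes S :: "(complex \<times> complex \<Rightarrow> complex) set"
  assumes "hardy_submodule S" and "S \<noteq> {\<lambda>_. 0}"
  shows "doubly_commuting S \<longleftrightarrow>
    (\<exists>q. unimodular q \<and> S = (\<lambda>f p. q p * f p) ` hardy_plus)"
  using doubly_commuting_imp_unimodular[OF assms] unimodular_imp_doubly_commuting by blast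

end
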